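(* Let $\eta=\min(\alpha-1,\beta,\gamma)$. There exists a constant $\nu>0$ (depending only on the model data) such that the following holds. Let $\mu\in(0,\eta)$ and let $\mathcal C$ be a subset of $\ell_2^2$ such that $\mathcal I(\mathcal C)>0$. There exists $\varepsilon_1>0$, depending only on $\mu$, $\mathcal I(\mathcal C)$ and the model data, such that for all $\varepsilon\in(0,\varepsilon_1]$ and all $X^0\in\mathcal C$ with $\|X^0\|_2=\varepsilon$, the solution $X$ of $\dot X=JX+G(X)$ in $\ell_2^2$ with $X(0)=X^0$ is defined on $[0,\mu\,\nu\,|\ln\varepsilon|\,\varepsilon^{1-\alpha}]$ and satisfies $$\forall t\in[0,\mu\,\nu\,|\ln\varepsilon|\,\varepsilon^{1-\alpha}],\qquad\|X(t)\|_\infty\ge M\,\varepsilon,\qquad\text{with }M=\tfrac12\Big(\tfrac12\,\mathcal I(\mathcal C)\Big)^{\frac{\alpha+1}{\alpha-1}}.$$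
   Context: **Lattice model.** Fix $\alpha>1$, real $(k_-,k_+)\ne(0,0)$ and $\beta,\gamma>0$. Let $V\in C^2(\mathbb R,\mathbb R)$, $V=V_\alpha+W$, where $V_\alpha(r)=\frac{k_-}{1+\alpha}|r|^{\alpha+1}$ for $r\le0$, $V_\alpha(r)=\frac{k_+}{1+\alpha}r^{\alpha+1}$ for $r\ge0$, and $W'(0)=0$, $W''(r)=O(|r|^{\alpha-1+\beta})$ as $r\to0$. Let $\phi\in C^2(\mathbb R,\mathbb R)$ with $\phi'(0)=0$, $\phi''(x)=O(|x|^{\alpha-1+\gamma})$ as $x\to0$. For sequences, $(\delta^+x)_n=x_{n+1}-x_n$, $(\delta^-x)_n=x_n-x_{n-1}$, and scalar functions act componentwise. Set $F(x)=\delta^+V'(\delta^-x)-\phi'(x)$. The lattice $\ddot x_n+x_n=F(x)_n$, $n\in\mathbb Z$, is written for $X=(x,\dot x)^T\in\ell_2^2=\ell_2(\mathbb Z,\mathbb R)^2$ as $\dot X=JX+G(X)$, with $J=\begin{pmatrix}0&\mathrm{Id}\\-\mathrm{Id}&0\end{pmatrix}$ and $G(X_1,X_2)=(0,F(X_1))^T$. Norms: for $X=(x,y)^T$ a pair of real sequences, $\|X\|_q=\big(\sum_n(x_n^2+y_n^2)^{q/2}\big)^{1/q}$ if $1\le q<\infty$, and $\|X\|_\infty=\sup_n(x_n^2+y_n^2)^{1/2}$. "Model data" means $(\alpha,k_\pm,W,\phi,\beta,\gamma)$. **The constant $\mathcal I(\mathcal C)$.** For $\mathcal C\subset\ell_2^2$,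 $$\mathcal I(\mathcal C)=\inf\{Q_\alpha(X):X\in\mathcal C,\ X\ne0\},\qquad Q_\alpha(X)=\frac{\|\delta^+X\|_{\alpha+1}}{\|X\|_2},$$ where $\delta^+$ acts on each component of $X$. *)

theory Defs
  imports "HOL-Analysis.Analysis" "HOL-Library.Function_Algebras"
begin

definition C2 :: "(real \<Rightarrow> real) \<Rightarrow> bool" where
  "C2 f \<longleftrightarrow> f differentiable_on UNIV \<and> deriv f C1_differentiable_on UNIV"

definition V_pow :: "real \<Rightarrow> real \<Rightarrow> real \<Rightarrow> real \<Rightarrow> real" where
  "V_pow \<alpha> k_minus k_plus r =
     (if r \<le> 0 then k_minus / (1 + \<alpha>) * \<bar>r\<bar> powr (\<alpha> + 1)
      else k_plus / (1 + \<alpha>) * r powr (\<alpha> + 1))"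

type_synonym seq_pair = "(int \<Rightarrow> real) \<times> (int \<Rightarrow> real)"

definition l2_pairs :: "seq_pair set" where
  "l2_pairs = {X. (\<lambda>n. (fst X n)\<^sup>2) summable_on UNIV \<and> (\<lambda>n. (snd X n)\<^sup>2) summable_on UNIV}"

text \<open>
  The two norms below are real valued, hence only meaningful when the series converges,
  respectively when the supremum is finite. They are applied to elements of \<^term>\<open>l2_pairs\<close>,
  for which this holds for all exponents \<open>q \<ge> 2\<close>.
\<close>

definition norm_q :: "real \<Rightarrow> seq_pair \<Rightarrow> real" where
  "norm_q q X = (\<Sum>\<^sub>\<infinity>n. ((fst X n)\<^sup>2 + (snd X n)\<^sup>2) powr (q / 2)) powr (1 / q)"

definition norm_inf :: "seq_pair \<Rightarrow> real" where
  "norm_inf X = (SUP n. sqrt ((fst X n)\<^sup>2 + (snd X n)\<^sup>2))"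

definition delta_plus :: "(int \<Rightarrow> real) \<Rightarrow> int \<Rightarrow> real" where
  "delta_plus x n = x (n + 1) - x n"

definition delta_minus :: "(int \<Rightarrow> real) \<Rightarrow> int \<Rightarrow> real" where
  "delta_minus x n = x n - x (n - 1)"

definition F_lattice :: "(real \<Rightarrow> real) \<Rightarrow> (real \<Rightarrow> real) \<Rightarrow> (int \<Rightarrow> real) \<Rightarrow> int \<Rightarrow> real" where
  "F_lattice V \<phi> x = delta_plus (\<lambda>n. deriv V (delta_minus x n)) - (\<lambda>n. deriv \<phi> (x n))"

definition J_lattice :: "seq_pair \<Rightarrow> seq_pair" where
  "J_lattice X = (snd X, - fst X)"

definition G_lattice :: "(real \<Rightarrow> real) \<Rightarrow> (real \<Rightarrow> real) \<Rightarrow> seq_pair \<Rightarrow> seq_pair" where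
  "G_lattice V \<phi> X = (0, F_lattice V \<phi> (fst X))"

definition seq_scale :: "real \<Rightarrow> seq_pair \<Rightarrow> seq_pair" where
  "seq_scale c X = (\<lambda>n. c * fst X n, \<lambda>n. c * snd X n)"

text \<open>
  Differentiability of a curve with respect to the norm of the Hilbert space (not merely
  componentwise). The derivative is required to belong to the space, since otherwise
  \<^term>\<open>norm_q 2\<close> of the remainder would be meaningless.
\<close>

definition has_l2_derivative ::
    "(real \<Rightarrow> seq_pair) \<Rightarrow> seq_pair \<Rightarrow> real \<Rightarrow> real set \<Rightarrow> bool" where
  "has_l2_derivative X D t S \<longleftrightarrow>
     (\<forall>s\<in>S. X s \<in> l2_pairs) \<and> D \<in> l2_pairs \<and>
     ((\<lambda>s. norm_q 2 (seq_scale (1 / (s - t)) (X s - X t) - D)) \<longlongrightarrow> 0) (at t within S)"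

definition lattice_solution ::
    "(real \<Rightarrow> real) \<Rightarrow> (real \<Rightarrow> real) \<Rightarrow> (real \<Rightarrow> seq_pair) \<Rightarrow> real set \<Rightarrow> bool" where
  "lattice_solution V \<phi> X S \<longleftrightarrow>
     (\<forall>t\<in>S. X t \<in> l2_pairs \<and>
            has_l2_derivative X (J_lattice (X t) + G_lattice V \<phi> (X t)) t S)"

definition Q_quot :: "real \<Rightarrow> seq_pair \<Rightarrow> real" where
  "Q_quot \<alpha> X = norm_q (\<alpha> + 1) (delta_plus (fst X), delta_plus (snd X)) / norm_q 2 X"

text \<open>
  The infimum is taken in \<^typ>\<open>real\<close>, so it is unspecified when \<open>C\<close> has no nonzero element.
\<close>

definition I_const :: "real \<Rightarrow> seq_pair set \<Rightarrow> real" where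
  "I_const \<alpha> C = Inf {Q_quot \<alpha> X | X. X \<in> C \<and> X \<noteq> 0}"

end

theory Submission
  imports Defs
begin

text \<open>
  A pair of real sequences \<open>(x, y)\<close> is written as the complex sequence \<open>Z = x + i y\<close>, so that the
  lattice becomes \<open>Z' = - i (Z - F)\<close> and the linear part of the flow is multiplication by
  \<open>exp (- i t)\<close>. In the difference variable \<open>U n = Z n - Z (n - 1)\<close> consider
  \<open>N = (\<Sum> n. |U n| powr (\<alpha> + 1))\<close>. It is invariant under the rotation, hence changes only at the
  rate \<open>\<epsilon> powr (2 * \<alpha>)\<close>. This rate alone would be too large: over times of order
  \<open>|ln \<epsilon>| * \<epsilon> powr (1 - \<alpha>)\<close> it allows a change of \<open>N\<close> by more than its own size
  \<open>\<epsilon> powr (\<alpha> + 1)\<close>.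

  The rate of change of \<open>N\<close> vanishes on average, however. To leading order it is the inner product
  of \<open>w = |U| powr (\<alpha> - 1) * U\<close> with \<open>i\<close> times the discrete Laplacian of \<open>f (Re U)\<close>, where \<open>f\<close> is
  the homogeneous force of degree \<open>\<alpha>\<close>. Averaging over a full rotation of \<open>U\<close> picks the first
  harmonic of \<open>f\<close>, which by homogeneity and reflection symmetry is a real multiple of \<open>w\<close> itself
  (\<open>circle_average\<close>), and the Laplacian is symmetric, so that \<open>\<langle>w, i \<Delta> w\<rangle> = 0\<close>
  (\<open>resonant_average_zero\<close>). Over one period \<open>2 \<pi>\<close> the solution differs from a rotation by
  \<open>O(\<epsilon> powr \<alpha>)\<close> and the force from \<open>f\<close> by \<open>O(\<epsilon> powr (\<alpha> + \<eta>))\<close>, so \<open>N\<close> changes by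
  \<open>O(\<epsilon> powr (2 * \<alpha> + \<eta>))\<close> only (\<open>pow_sum_period\<close>). Adding up the periods gives a relative change
  of \<open>N\<close> of order \<open>\<epsilon> powr (\<alpha> - 1) + |ln \<epsilon>| * \<epsilon> powr \<eta>\<close>, which tends to zero
  (\<open>pow_sum_almost_conserved\<close>). In particular one can take \<open>\<nu> = 1\<close>.

  Conservation of the energy keeps the norm of the solution close to \<open>\<epsilon>\<close> for all times
  (\<open>energy_bound\<close>); together with a truncation of the forces it also gives global existence. The
  conclusion follows from the interpolation inequality
  \<open>N \<le> (2 * sup |Z|) powr (\<alpha> - 1) * (2 * norm Z)\<^sup>2\<close>: the left-hand side is almost its initial value,
  which is at least \<open>(\<iota> * \<epsilon>) powr (\<alpha> + 1)\<close> by definition of \<open>\<iota>\<close>.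
\<close>

section \<open>Square-summable complex sequences\<close>

text \<open>Square-summable sequences form a type of their own, so that the general theory of Banach and
  inner product spaces (derivatives, integrals, contractions) applies to them directly.\<close>

typedef l2 = "{x :: int \<Rightarrow> complex. (\<lambda>n. (norm (x n))\<^sup>2) summable_on UNIV}"
  morphisms coord Abs_l2
proof
  show "(\<lambda>_. 0) \<in> {x :: int \<Rightarrow> complex. (\<lambda>n. (norm (x n))\<^sup>2) summable_on UNIV}"
    by simp
qed

setup_lifting type_definition_l2

lemma summable_coord: "(\<lambda>n. (norm (coord Z n))\<^sup>2) summable_on UNIV"
  using coord by auto

lemma l2_eqI: "(\<And>n. coord Z n = coord Y n) \<Longrightarrow> Z = Y"
  using coord_inject by blast

lemma square_summable_dominated:
  fixes x :: "'a \<Rightarrow> 'b::real_normed_vector" and y :: "'a \<Rightarrow> 'c::real_normed_vector"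
  assumes "(\<lambda>n. (norm (y n))\<^sup>2) summable_on A" and "\<And>n. n \<in> A \<Longrightarrow> norm (x n) \<le> K * norm (y n)"
  shows "(\<lambda>n. (norm (x n))\<^sup>2) summable_on A"
proof (rule summable_on_comparison_test)
  show "(\<lambda>n. K\<^sup>2 * (norm (y n))\<^sup>2) summable_on A"
    using assms(1) by (rule summable_on_cmult_right)
  show "(norm (x n))\<^sup>2 \<le> K\<^sup>2 * (norm (y n))\<^sup>2" if "n \<in> A" for n
    using power_mono[OF assms(2)[OF that], of 2] by (simp add: power_mult_distrib)
qed auto

lemma square_summable_add:
  fixes x y :: "'a \<Rightarrow> 'b::real_normed_vector"
  assumes "(\<lambda>n. (norm (x n))\<^sup>2) summable_on A" and "(\<lambda>n. (norm (y n))\<^sup>2) summable_on A"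
  shows "(\<lambda>n. (norm (x n + y n))\<^sup>2) summable_on A"
proof (rule summable_on_comparison_test)
  show "(\<lambda>n. 2 * (norm (x n))\<^sup>2 + 2 * (norm (y n))\<^sup>2) summable_on A"
    using assms by (intro summable_on_add summable_on_cmult_right)
  show "(norm (x n + y n))\<^sup>2 \<le> 2 * (norm (x n))\<^sup>2 + 2 * (norm (y n))\<^sup>2" for n
  proof -
    have "(norm (x n + y n))\<^sup>2 \<le> (norm (x n) + norm (y n))\<^sup>2"
      by (intro power_mono norm_triangle_ineq) auto
    then show ?thesis
      using sum_squares_bound[of "norm (x n)" "norm (y n)"] by (simp add: power2_sum)
  qed
qed auto

lemma summable_inner_coord: "(\<lambda>n. inner (coord Z n) (coord Y n)) summable_on UNIV"
proof -
  have "(\<lambda>n. (norm (coord Z n))\<^sup>2 + (norm (coord Y n))\<^sup>2) summable_on UNIV"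
    by (intro summable_on_add summable_coord)
  moreover have "norm (inner (coord Z n) (coord Y n)) \<le> (norm (coord Z n))\<^sup>2 + (norm (coord Y n))\<^sup>2" for n
    using Cauchy_Schwarz_ineq2[of "coord Z n" "coord Y n"]
      sum_squares_bound[of "norm (coord Z n)" "norm (coord Y n)"]
    zero_le_power2[of "norm (coord Z n)"] zero_le_power2[of "norm (coord Y n)"]
    by (simp only: real_norm_def)
  ultimately have "(\<lambda>n. norm (inner (coord Z n) (coord Y n))) summable_on UNIV"
    by (rule summable_on_comparison_test) simp_all
  then show ?thesis
    by (rule summable_on_iff_abs_summable_on_real[THEN iffD2])
qed

instantiation l2 :: real_inner
begin

lift_definition zero_l2 :: l2 is "\<lambda>_. 0" by simp

lift_definition plus_l2 :: "l2 \<Rightarrow> l2 \<Rightarrow> l2" is "\<lambda>x y n. x n + y n"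
  by (simp add: square_summable_add)

lift_definition uminus_l2 :: "l2 \<Rightarrow> l2" is "\<lambda>x n. - x n"
  by simp

definition minus_l2 :: "l2 \<Rightarrow> l2 \<Rightarrow> l2" where "minus_l2 x y = x + - y"

lift_definition scaleR_l2 :: "real \<Rightarrow> l2 \<Rightarrow> l2" is "\<lambda>c x n. c *\<^sub>R x n"
  by (auto simp: power_mult_distrib intro: summable_on_cmult_right)

definition inner_l2 :: "l2 \<Rightarrow> l2 \<Rightarrow> real" where
  "inner_l2 Z Y = (\<Sum>\<^sub>\<infinity>n. inner (coord Z n) (coord Y n))"

definition norm_l2 :: "l2 \<Rightarrow> real" where "norm_l2 Z = sqrt (inner Z Z)"

definition sgn_l2 :: "l2 \<Rightarrow> l2" where "sgn_l2 Z = scaleR (inverse (norm Z)) Z"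

definition dist_l2 :: "l2 \<Rightarrow> l2 \<Rightarrow> real" where "dist_l2 Z Y = norm (Z - Y)"

definition uniformity_l2 :: "(l2 \<times> l2) filter" where
  "uniformity_l2 = (INF e\<in>{0 <..}. principal {(x, y). dist x y < e})"

definition open_l2 :: "l2 set \<Rightarrow> bool" where
  "open_l2 S = (\<forall>x\<in>S. \<forall>\<^sub>F (x', y) in uniformity. x' = x \<longrightarrow> y \<in> S)"

instance
proof
  fix x y z :: l2 and a b :: real
  show "x + y + z = x + (y + z)" "x + y = y + x" "0 + x = x" "- x + x = 0"
    by (transfer; simp add: ac_simps)+
  show "x - y = x + - y" by (simp add: minus_l2_def)
  show "a *\<^sub>R (x + y) = a *\<^sub>R x + a *\<^sub>R y" "(a + b) *\<^sub>R x = a *\<^sub>R x + b *\<^sub>R x"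
    "a *\<^sub>R b *\<^sub>R x = (a * b) *\<^sub>R x" "1 *\<^sub>R x = x"
    by (transfer; simp add: algebra_simps)+
  show "dist x y = norm (x - y)" by (simp add: dist_l2_def)
  show "sgn x = scaleR (inverse (norm x)) x" by (simp add: sgn_l2_def)
  show "(uniformity :: (l2 \<times> l2) filter) = (INF e\<in>{0 <..}. principal {(x, y). dist x y < e})"
    by (simp add: uniformity_l2_def)
  show "open U = (\<forall>x\<in>U. \<forall>\<^sub>F (x', y) in uniformity. x' = x \<longrightarrow> y \<in> U)" for U :: "l2 set"
    by (simp add: open_l2_def)
  show "inner x y = inner y x" by (simp add: inner_l2_def inner_commute)
  have "inner (x + y) z = (\<Sum>\<^sub>\<infinity>n. inner (coord x n) (coord z n) + inner (coord y n) (coord z n))"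
    by (simp add: inner_l2_def plus_l2.rep_eq inner_add_left)
  then show "inner (x + y) z = inner x z + inner y z"
    by (simp add: inner_l2_def infsum_add summable_inner_coord)
  show "inner (a *\<^sub>R x) y = a * inner x y"
    by (simp add: inner_l2_def scaleR_l2.rep_eq infsum_cmult_right summable_inner_coord)
  show "0 \<le> inner x x" by (simp add: inner_l2_def infsum_nonneg)
  show "(inner x x = 0) = (x = 0)"
  proof
    assume "inner x x = 0"
    then have s0: "infsum (\<lambda>n. inner (coord x n) (coord x n)) UNIV = 0"
      by (simp add: inner_l2_def)
    have "inner (coord x n) (coord x n) = 0" for n
      by (rule nonneg_infsum_le_0D[of "\<lambda>n. inner (coord x n) (coord x n)" UNIV])
         (use s0 summable_inner_coord in auto)
    then have "coord x n = coord 0 n" for n by (simp add: zero_l2.rep_eq)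
    then show "x = 0" by (rule l2_eqI)
  qed (simp add: inner_l2_def zero_l2.rep_eq)
  show "norm x = sqrt (inner x x)" by (simp add: norm_l2_def)
qed

end

lemma coord_zero [simp]: "coord 0 n = 0"
  and coord_add [simp]: "coord (Z + Y) n = coord Z n + coord Y n"
  and coord_uminus [simp]: "coord (- Z) n = - coord Z n"
  and coord_diff [simp]: "coord (Z - Y) n = coord Z n - coord Y n"
  and coord_scaleR [simp]: "coord (c *\<^sub>R Z) n = c *\<^sub>R coord Z n"
proof -
  show "coord 0 n = 0" "coord (Z + Y) n = coord Z n + coord Y n" "coord (- Z) n = - coord Z n"
    "coord (c *\<^sub>R Z) n = c *\<^sub>R coord Z n"
    by (simp_all add: zero_l2.rep_eq plus_l2.rep_eq uminus_l2.rep_eq scaleR_l2.rep_eq)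
  show "coord (Z - Y) n = coord Z n - coord Y n"
    unfolding minus_l2_def plus_l2.rep_eq uminus_l2.rep_eq by (rule add_uminus_conv_diff)
qed

lemma norm_l2_power2: "(norm Z)\<^sup>2 = (\<Sum>\<^sub>\<infinity>n. (norm (coord Z n))\<^sup>2)"
  by (simp add: power2_norm_eq_inner inner_l2_def)

lemma norm_l2_le:
  assumes "c \<ge> 0" and "\<And>S. finite S \<Longrightarrow> (\<Sum>n\<in>S. (norm (coord Z n))\<^sup>2) \<le> c\<^sup>2"
  shows "norm Z \<le> c"
proof (rule power2_le_imp_le)
  show "(norm Z)\<^sup>2 \<le> c\<^sup>2"
    unfolding norm_l2_power2 by (rule infsum_le_finite_sums) (use assms summable_coord in auto)
qed (use assms in auto)

lemma sum_coord_le: "finite S \<Longrightarrow> (\<Sum>n\<in>S. (norm (coord Z n))\<^sup>2) \<le> (norm Z)\<^sup>2"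
  unfolding norm_l2_power2 by (rule finite_sum_le_infsum) (use summable_coord in auto)

lemma norm_coord_le: "norm (coord Z n) \<le> norm Z"
  by (rule power2_le_imp_le) (use sum_coord_le[of "{n}" Z] in simp_all)

lemma bounded_linear_coord: "bounded_linear (\<lambda>Z. coord Z n)"
  by (rule bounded_linear_intro[where K = 1]) (use norm_coord_le in auto)

lemma norm_l2_mono:
  assumes "K \<ge> 0" "\<And>n. norm (coord Z n) \<le> K * norm (coord Y n)"
  shows "norm Z \<le> K * norm Y"
proof (rule norm_l2_le)
  fix S :: "int set" assume S: "finite S"
  have "(\<Sum>n\<in>S. (norm (coord Z n))\<^sup>2) \<le> (\<Sum>n\<in>S. K\<^sup>2 * (norm (coord Y n))\<^sup>2)"
    by (rule sum_mono) (metis assms(2) norm_ge_zero power_mono power_mult_distrib)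
  also have "\<dots> \<le> K\<^sup>2 * (norm Y)\<^sup>2"
    using sum_coord_le[OF S, of Y] by (simp add: sum_distrib_left[symmetric] mult_left_mono)
  finally show "(\<Sum>n\<in>S. (norm (coord Z n))\<^sup>2) \<le> (K * norm Y)\<^sup>2"
    by (simp add: power_mult_distrib)
qed (use assms in auto)

text \<open>Completeness: the coordinatewise limit of a Cauchy sequence is its limit, because the
  Cauchy estimate passes to the limit in every finite partial sum of squares.\<close>

instance l2 :: complete_space
proof
  fix X :: "nat \<Rightarrow> l2" assume C: "Cauchy X"
  have "Cauchy (\<lambda>k. coord (X k) n)" for n
    using bounded_linear.Cauchy[OF bounded_linear_coord C] .
  then have "\<exists>l. (\<lambda>k. coord (X k) n) \<longlonglongrightarrow> l" for n
    using Cauchy_convergent convergent_def by blast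
  then obtain x where x: "\<And>n. (\<lambda>k. coord (X k) n) \<longlonglongrightarrow> x n" by metis
  have fin: "(\<Sum>n\<in>S. (norm (x n - coord (X m) n))\<^sup>2) \<le> e\<^sup>2"
    if "finite S" and M: "\<forall>k\<ge>M. \<forall>m\<ge>M. norm (X k - X m) < e" and "m \<ge> M" for S e m M
  proof (rule LIMSEQ_le_const2)
    show "(\<lambda>k. \<Sum>n\<in>S. (norm (coord (X k) n - coord (X m) n))\<^sup>2)
        \<longlonglongrightarrow> (\<Sum>n\<in>S. (norm (x n - coord (X m) n))\<^sup>2)"
      by (intro tendsto_intros x)
    show "\<exists>N. \<forall>k\<ge>N. (\<Sum>n\<in>S. (norm (coord (X k) n - coord (X m) n))\<^sup>2) \<le> e\<^sup>2"
    proof (intro exI[of _ M] allI impI)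
      fix k assume "k \<ge> M"
      then have "norm (X k - X m) \<le> e" using M \<open>m \<ge> M\<close> less_imp_le by blast
      then have "(norm (X k - X m))\<^sup>2 \<le> e\<^sup>2" by (simp add: power_mono)
      then show "(\<Sum>n\<in>S. (norm (coord (X k) n - coord (X m) n))\<^sup>2) \<le> e\<^sup>2"
        using sum_coord_le[OF \<open>finite S\<close>, of "X k - X m"] by simp
    qed
  qed
  have Cd: "\<exists>M. \<forall>k\<ge>M. \<forall>m\<ge>M. norm (X k - X m) < e" if "e > 0" for e
    using C that unfolding Cauchy_def dist_norm by blast
  obtain M where M: "\<forall>k\<ge>M. \<forall>m\<ge>M. norm (X k - X m) < 1"
    using Cd[of 1] by auto
  have "(\<lambda>n. (norm (x n - coord (X M) n))\<^sup>2) summable_on UNIV"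
  proof (rule nonneg_bdd_above_summable_on)
    show "bdd_above (sum (\<lambda>n. (norm (x n - coord (X M) n))\<^sup>2) ` {F. F \<subseteq> UNIV \<and> finite F})"
      using fin[OF _ M order_refl] by (intro bdd_aboveI2[where M = "1\<^sup>2"]) blast
  qed simp
  from square_summable_add[OF this summable_coord[of "X M"]]
  have "(\<lambda>n. (norm (x n))\<^sup>2) summable_on UNIV" by simp
  then have Z: "coord (Abs_l2 x) n = x n" for n by (simp add: Abs_l2_inverse)
  have "X \<longlonglongrightarrow> Abs_l2 x"
  proof (rule LIMSEQ_I)
    fix e :: real assume "e > 0"
    then obtain M where M: "\<forall>k\<ge>M. \<forall>m\<ge>M. norm (X k - X m) < e / 2"
      using Cd[of "e / 2"] by auto
    have "norm (Abs_l2 x - X m) \<le> e / 2" if "m \<ge> M" for m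
    proof (rule norm_l2_le)
      show "(\<Sum>n\<in>S. (norm (coord (Abs_l2 x - X m) n))\<^sup>2) \<le> (e / 2)\<^sup>2" if "finite S" for S
        using fin[OF that M \<open>m \<ge> M\<close>] by (simp only: coord_diff Z)
    qed (use \<open>e > 0\<close> in simp)
    then have "norm (X m - Abs_l2 x) < e" if "m \<ge> M" for m
      using \<open>e > 0\<close> that by (subst norm_minus_commute) fastforce
    then show "\<exists>no. \<forall>n\<ge>no. norm (X n - Abs_l2 x) < e" by blast
  qed
  then show "convergent X" by (auto simp: convergent_def)
qed

instance l2 :: banach ..

section \<open>Shifts, differences and superposition operators\<close>

lift_definition shift :: "int \<Rightarrow> l2 \<Rightarrow> l2" is "\<lambda>k x n. x (n + k)"
proof -
  fix k and x :: "int \<Rightarrow> complex"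
  assume s: "(\<lambda>n. (norm (x n))\<^sup>2) summable_on UNIV"
  show "(\<lambda>n. (norm (x (n + k)))\<^sup>2) summable_on UNIV"
    using summable_on_reindex_bij_betw[of "\<lambda>n. n + k" UNIV UNIV "\<lambda>n. (norm (x n))\<^sup>2"] s
    by (simp add: bij_plus_right)
qed

lift_definition cmul :: "complex \<Rightarrow> l2 \<Rightarrow> l2" is "\<lambda>c x n. c * x n"
  by (auto simp: norm_mult power_mult_distrib intro: summable_on_cmult_right)

lemma coord_shift [simp]: "coord (shift k Z) n = coord Z (n + k)"
  by (simp add: shift.rep_eq)

lemma coord_cmul [simp]: "coord (cmul c Z) n = c * coord Z n"
  by (simp add: cmul.rep_eq)

lemma inner_shift: "inner (shift k Z) Y = inner Z (shift (- k) Y)"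
  unfolding inner_l2_def
  by (rule infsum_reindex_bij_witness[where j = "\<lambda>n. n + k" and i = "\<lambda>n. n - k"]) auto

lemma norm_shift [simp]: "norm (shift k Z) = norm Z"
  by (simp add: norm_eq_sqrt_inner inner_shift)
     (metis (no_types, lifting) add.right_neutral add.right_inverse coord_shift group_cancel.add1 l2_eqI)

lemma inner_cmul: "inner (cmul c Z) Y = inner Z (cmul (cnj c) Y)"
  by (simp add: inner_l2_def inner_complex_def algebra_simps)

lemma cmul_cmul [simp]: "cmul c (cmul d Z) = cmul (c * d) Z"
  by (rule l2_eqI) (simp add: mult.assoc)

lemma norm_cmul [simp]: "norm (cmul c Z) = norm c * norm Z"
proof -
  have "cnj c * c = complex_of_real ((norm c)\<^sup>2)"
    using complex_norm_square[of c] by (simp only: mult.commute)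
  then have "cmul (cnj c * c) Z = (norm c)\<^sup>2 *\<^sub>R Z"
    by (intro l2_eqI) (simp only: coord_cmul coord_scaleR scaleR_conv_of_real)
  then have "inner (cmul c Z) (cmul c Z) = (norm c)\<^sup>2 * inner Z Z"
    by (simp add: inner_cmul)
  then show ?thesis
    by (simp add: norm_eq_sqrt_inner real_sqrt_mult)
qed

lemma bounded_bilinear_cmul: "bounded_bilinear cmul"
proof
  show "\<exists>K. \<forall>c Z. norm (cmul c Z) \<le> norm c * norm Z * K"
    by (intro exI[of _ 1]) simp
qed (auto intro!: l2_eqI simp: algebra_simps)

lemma bounded_linear_shift: "bounded_linear (shift k)"
  by (rule bounded_linear_intro[where K = 1]) (auto intro!: l2_eqI)

lemma cmul_ii_skew: "inner Z (cmul \<i> Z) = 0"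
proof -
  have "cmul (- \<i>) Z = - cmul \<i> Z" by (rule l2_eqI) simp
  with inner_cmul[of \<i> Z Z] have "inner (cmul \<i> Z) Z = - inner Z (cmul \<i> Z)" by simp
  then show ?thesis by (simp add: inner_commute)
qed

definition fdiff :: "l2 \<Rightarrow> l2" where "fdiff Z = shift 1 Z - Z"

definition bdiff :: "l2 \<Rightarrow> l2" where "bdiff Z = Z - shift (- 1) Z"

lemma coord_fdiff [simp]: "coord (fdiff Z) n = coord Z (n + 1) - coord Z n"
  and coord_bdiff [simp]: "coord (bdiff Z) n = coord Z n - coord Z (n - 1)"
  by (simp_all add: fdiff_def bdiff_def)

text \<open>Summation by parts.\<close>

lemma inner_fdiff: "inner (fdiff Z) Y = - inner Z (bdiff Y)"
  by (simp add: fdiff_def bdiff_def inner_diff_left inner_diff_right inner_shift)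

lemma bounded_linear_fdiff: "bounded_linear fdiff"
  unfolding fdiff_def by (intro bounded_linear_sub bounded_linear_shift bounded_linear_ident)

lemma bounded_linear_bdiff: "bounded_linear bdiff"
  unfolding bdiff_def by (intro bounded_linear_sub bounded_linear_shift bounded_linear_ident)

lemma norm_fdiff_le: "norm (fdiff Z) \<le> 2 * norm Z"
  unfolding fdiff_def using norm_triangle_ineq4[of "shift 1 Z" Z] by simp

lemma norm_bdiff_le: "norm (bdiff Z) \<le> 2 * norm Z"
  unfolding bdiff_def using norm_triangle_ineq4[of Z "shift (- 1) Z"] by simp

lemma bdiff_cmul: "bdiff (cmul c Z) = cmul c (bdiff Z)"
  by (rule l2_eqI) (simp add: algebra_simps)

lemma fdiff_cmul: "fdiff (cmul c Z) = cmul c (fdiff Z)"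
  by (rule l2_eqI) (simp add: algebra_simps)

text \<open>The superposition (Nemytskii) operator of \<open>g\<close>. Its value is meaningful only if the image
  sequence is square summable, which holds when \<open>g\<close> vanishes at \<open>0\<close> and is Lipschitz on a set
  containing all entries.\<close>

definition superpos :: "(complex \<Rightarrow> complex) \<Rightarrow> l2 \<Rightarrow> l2" where
  "superpos g Z = Abs_l2 (\<lambda>n. g (coord Z n))"

lemma coord_superpos_aux:
  assumes "\<And>n. norm (g (coord Z n)) \<le> K * norm (coord Z n)"
  shows "coord (superpos g Z) n = g (coord Z n)"
proof -
  have "(\<lambda>n. (norm (g (coord Z n)))\<^sup>2) summable_on UNIV"
    by (rule square_summable_dominated[OF summable_coord]) (rule assms)
  then show ?thesis by (simp add: superpos_def Abs_l2_inverse)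
qed

lemma lipschitz_at_zero:
  assumes "L-lipschitz_on S g" "0 \<in> S" "g 0 = 0" "z \<in> S"
  shows "norm (g z) \<le> L * norm z"
  using lipschitz_onD[OF assms(1) assms(4,2)] assms(3) by (simp add: dist_norm)

lemma coord_superpos:
  assumes "L-lipschitz_on S g" "0 \<in> S" "g 0 = 0" "\<And>n. coord Z n \<in> S"
  shows "coord (superpos g Z) n = g (coord Z n)"
  using coord_superpos_aux lipschitz_at_zero[OF assms(1-3)] assms(4) by blast

lemma norm_superpos_le:
  assumes "K \<ge> 0" "\<And>n. norm (g (coord Z n)) \<le> K * norm (coord Z n)"
  shows "norm (superpos g Z) \<le> K * norm Z"
  by (rule norm_l2_mono[OF assms(1)]) (simp add: coord_superpos_aux[of g Z, OF assms(2)] assms(2))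

lemma norm_superpos_diff_le:
  assumes "L-lipschitz_on S g" "0 \<in> S" "g 0 = 0" "\<And>n. coord Z n \<in> S" "\<And>n. coord Y n \<in> S"
  shows "norm (superpos g Z - superpos g Y) \<le> L * norm (Z - Y)"
  using assms(1)
  by (intro norm_l2_mono)
     (auto simp: coord_superpos[OF assms(1-3)] assms(4,5) lipschitz_on_nonneg
           intro: lipschitz_onD[OF assms(1), unfolded dist_norm])

definition on_Re :: "(real \<Rightarrow> real) \<Rightarrow> complex \<Rightarrow> complex" where
  "on_Re f z = complex_of_real (f (Re z))"

lemma lipschitz_on_Re:
  assumes "L-lipschitz_on T f"
  shows "L-lipschitz_on (Re -` T) (on_Re f)"
proof (rule lipschitz_onI)
  fix z y assume zy: "z \<in> Re -` T" "y \<in> Re -` T"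
  have "dist (on_Re f z) (on_Re f y) = dist (f (Re z)) (f (Re y))"
    by (simp add: on_Re_def dist_norm flip: of_real_diff)
  also have "\<dots> \<le> L * dist (Re z) (Re y)"
    using lipschitz_onD[OF assms] zy by simp
  also have "\<dots> \<le> L * dist z y"
    using abs_Re_le_cmod[of "z - y"] lipschitz_on_nonneg[OF assms]
    by (auto simp: dist_norm intro: mult_left_mono)
  finally show "dist (on_Re f z) (on_Re f y) \<le> L * dist z y" .
qed (rule lipschitz_on_nonneg[OF assms])

section \<open>Sums of a potential over the lattice\<close>

text \<open>The function \<open>u \<mapsto> h u - \<langle>g z, u\<rangle>\<close> has gradient \<open>g u - g z\<close>, whose size on the segment from \<open>z\<close>
  to \<open>y\<close> is at most \<open>L * norm (y - z)\<close>; so the mean value inequality applies. The constant is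
  not optimal, but the quadratic order is all that differentiability requires.\<close>

lemma taylor_lipschitz_gradient:
  fixes h :: "'a::real_inner \<Rightarrow> real"
  assumes "convex S" and der: "\<And>z. z \<in> S \<Longrightarrow> (h has_derivative (\<lambda>v. inner (g z) v)) (at z within S)"
    and lip: "L-lipschitz_on S g" and "z \<in> S" "y \<in> S"
  shows "\<bar>h y - h z - inner (g z) (y - z)\<bar> \<le> L * (norm (y - z))\<^sup>2"
proof -
  let ?T = "closed_segment z y"
  have T: "?T \<subseteq> S" using assms by (simp add: closed_segment_subset)
  have "norm ((h y - inner (g z) y) - (h z - inner (g z) z)) \<le> (L * norm (y - z)) * norm (y - z)"
  proof (rule differentiable_bound)
    show "convex ?T" by (rule convex_closed_segment)
    fix u assume u: "u \<in> ?T"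
    show "((\<lambda>u. h u - inner (g z) u) has_derivative (\<lambda>v. inner (g u) v - inner (g z) v)) (at u within ?T)"
      using u T by (intro has_derivative_diff has_derivative_subset[OF der T]
          bounded_linear_imp_has_derivative bounded_linear_inner_right) auto
    have "L \<ge> 0" using lip by (rule lipschitz_on_nonneg)
    have "norm (g u - g z) \<le> L * norm (u - z)"
      using lipschitz_onD[OF lip, of u z] u T \<open>z \<in> S\<close> by (auto simp: dist_norm)
    also have "\<dots> \<le> L * norm (y - z)"
      using segment_bound(1)[OF u] \<open>L \<ge> 0\<close> by (simp add: mult_left_mono norm_minus_commute)
    finally have b: "norm (g u - g z) \<le> L * norm (y - z)" .
    show "onorm (\<lambda>v. inner (g u) v - inner (g z) v) \<le> L * norm (y - z)"
    proof (rule onorm_bound)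
      show "0 \<le> L * norm (y - z)" using \<open>L \<ge> 0\<close> by simp
      fix v
      have "norm (inner (g u) v - inner (g z) v) \<le> norm (g u - g z) * norm v"
        using Cauchy_Schwarz_ineq2[of "g u - g z" v] by (simp add: inner_diff_left)
      also have "\<dots> \<le> L * norm (y - z) * norm v"
        using b by (simp add: mult_right_mono)
      finally show "norm (inner (g u) v - inner (g z) v) \<le> L * norm (y - z) * norm v" .
    qed
  qed auto
  then show ?thesis by (simp add: inner_diff_right power2_eq_square algebra_simps)
qed

definition lattice_sum :: "(complex \<Rightarrow> real) \<Rightarrow> l2 \<Rightarrow> real" where
  "lattice_sum h Z = (\<Sum>\<^sub>\<infinity>n. h (coord Z n))"

lemma has_derivative_zero_of_quadratic_bound:
  fixes r q :: "real \<Rightarrow> real"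
  assumes "(q has_real_derivative 0) (at t within T)" and "q t = 0"
    and "\<And>s. s \<in> T \<Longrightarrow> \<bar>r s\<bar> \<le> q s" and "t \<in> T"
  shows "(r has_real_derivative 0) (at t within T)"
proof -
  have "r t = 0" using assms(2,3,4) by fastforce
  have lq: "((\<lambda>s. q s / (s - t)) \<longlongrightarrow> 0) (at t within T)"
    using assms(1,2) by (simp add: has_field_derivative_iff)
  have "((\<lambda>s. r s / (s - t)) \<longlongrightarrow> 0) (at t within T)"
  proof (rule Lim_null_comparison[OF _ tendsto_norm_zero[OF lq]])
    show "\<forall>\<^sub>F s in at t within T. norm (r s / (s - t)) \<le> norm (q s / (s - t))"
      unfolding eventually_at_filter
      by (rule always_eventually) (use assms(3) in \<open>force simp: intro!: divide_right_mono\<close>)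
  qed
  then show ?thesis by (simp add: has_field_derivative_iff \<open>r t = 0\<close>)
qed

text \<open>For a potential \<open>h\<close> with Lipschitz gradient \<open>g\<close> the Taylor remainders of the individual terms are
  dominated by squares, hence summable. The sum over the lattice is therefore differentiable along
  curves in the Hilbert space, with gradient \<open>superpos g\<close>. The set \<open>S\<close> allows for gradients that are
  Lipschitz on bounded sets only.\<close>

context
  fixes S :: "complex set" and h :: "complex \<Rightarrow> real" and g :: "complex \<Rightarrow> complex" and L :: real
  assumes S: "convex S" "0 \<in> S" and h: "h 0 = 0" "g 0 = 0"
    and der: "\<And>z. z \<in> S \<Longrightarrow> (h has_derivative (\<lambda>v. inner (g z) v)) (at z within S)"
    and lip: "L-lipschitz_on S g"
begin

lemma potential_bound: "z \<in> S \<Longrightarrow> \<bar>h z\<bar> \<le> L * (norm z)\<^sup>2"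
  using taylor_lipschitz_gradient[OF S(1) der lip S(2), of z] h by simp

lemma summable_potential:
  assumes "\<And>n. coord Z n \<in> S"
  shows "(\<lambda>n. h (coord Z n)) summable_on UNIV"
proof (rule summable_on_iff_abs_summable_on_real[THEN iffD2])
  show "(\<lambda>n. norm (h (coord Z n))) summable_on UNIV"
  proof (rule summable_on_comparison_test)
    show "(\<lambda>n. L * (norm (coord Z n))\<^sup>2) summable_on UNIV"
      by (intro summable_on_cmult_right summable_coord)
  qed (use potential_bound assms in auto)
qed

lemma lattice_sum_bound:
  assumes "\<And>n. coord Z n \<in> S"
  shows "\<bar>lattice_sum h Z\<bar> \<le> L * (norm Z)\<^sup>2"
proof -
  have s: "(\<lambda>n. L * (norm (coord Z n))\<^sup>2) summable_on UNIV"
    by (intro summable_on_cmult_right summable_coord)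
  have "norm (infsum (\<lambda>n. h (coord Z n)) UNIV) \<le> infsum (\<lambda>n. L * (norm (coord Z n))\<^sup>2) UNIV"
    by (rule norm_infsum_le[OF has_sum_infsum has_sum_infsum])
       (use potential_bound assms s summable_potential in auto)
  then show ?thesis
    unfolding lattice_sum_def norm_l2_power2 by (simp add: infsum_cmult_right')
qed

lemma lattice_sum_taylor:
  assumes Z: "\<And>n. coord Z n \<in> S" and Y: "\<And>n. coord Y n \<in> S"
  shows "\<bar>lattice_sum h Y - lattice_sum h Z - inner (superpos g Z) (Y - Z)\<bar> \<le> L * (norm (Y - Z))\<^sup>2"
proof -
  note g = coord_superpos[OF lip S(2) h(2), of Z, OF Z]
  let ?r = "\<lambda>n. h (coord Y n) + - h (coord Z n) + - inner (coord (superpos g Z) n) (coord (Y - Z) n)"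
  have s: "(\<lambda>n. L * (norm (coord (Y - Z) n))\<^sup>2) summable_on UNIV"
    by (intro summable_on_cmult_right summable_coord)
  have s1: "(\<lambda>n. h (coord Y n)) summable_on UNIV" "(\<lambda>n. - h (coord Z n)) summable_on UNIV"
    "(\<lambda>n. - inner (coord (superpos g Z) n) (coord (Y - Z) n)) summable_on UNIV"
    using summable_potential[of Y] summable_potential[of Z] summable_inner_coord[of "superpos g Z" "Y - Z"] Y Z
    by (auto intro: summable_on_uminus[THEN iffD2])
  then have sr: "?r summable_on UNIV" by (intro summable_on_add)
  have "norm (infsum ?r UNIV) \<le> infsum (\<lambda>n. L * (norm (coord (Y - Z) n))\<^sup>2) UNIV"
  proof (rule norm_infsum_le[OF has_sum_infsum[OF sr] has_sum_infsum[OF s]])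
    show "norm (?r n) \<le> L * (norm (coord (Y - Z) n))\<^sup>2" for n
      using taylor_lipschitz_gradient[OF S(1) der lip Z Y, of n n] by (simp add: g)
  qed
  moreover have "infsum ?r UNIV = lattice_sum h Y - lattice_sum h Z - inner (superpos g Z) (Y - Z)"
    unfolding lattice_sum_def inner_l2_def
    by (subst infsum_add, (intro summable_on_add s1)+, subst infsum_add, (intro s1)+) (simp add: infsum_uminus)
  ultimately show ?thesis
    by (simp add: infsum_cmult_right' norm_l2_power2)
qed

lemma lattice_sum_has_derivative:
  assumes der: "(Z has_vector_derivative D) (at t within T)" and t: "t \<in> T"
    and ZS: "\<And>s n. s \<in> T \<Longrightarrow> coord (Z s) n \<in> S"
  shows "((\<lambda>s. lattice_sum h (Z s)) has_real_derivative inner (superpos g (Z t)) D) (at t within T)"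
proof -
  let ?l = "\<lambda>s. inner (superpos g (Z t)) (Z s - Z t)"
  let ?q = "\<lambda>s. L * inner (Z s - Z t) (Z s - Z t)"
  have "(?q has_vector_derivative L * (inner (Z t - Z t) (D - 0) + inner (D - 0) (Z t - Z t))) (at t within T)"
    by (intro has_vector_derivative_mult_right bounded_bilinear.has_vector_derivative[OF bounded_bilinear_inner]
        has_vector_derivative_diff der has_vector_derivative_const)
  then have q: "(?q has_real_derivative 0) (at t within T)"
    by (simp add: has_real_derivative_iff_has_vector_derivative)
  have "((\<lambda>s. lattice_sum h (Z s) - lattice_sum h (Z t) - ?l s) has_real_derivative 0) (at t within T)"
  proof (rule has_derivative_zero_of_quadratic_bound[OF q])
    show "\<bar>lattice_sum h (Z s) - lattice_sum h (Z t) - ?l s\<bar> \<le> ?q s" if "s \<in> T" for s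
      using lattice_sum_taylor[of "Z t" "Z s"] ZS that t by (simp add: power2_norm_eq_inner)
  qed (use t in auto)
  moreover have "(?l has_real_derivative inner (superpos g (Z t)) D) (at t within T)"
    unfolding has_real_derivative_iff_has_vector_derivative
    using bounded_linear.has_vector_derivative[OF bounded_linear_inner_right
        has_vector_derivative_diff[OF der has_vector_derivative_const]] by simp
  ultimately have "((\<lambda>s. (lattice_sum h (Z s) - lattice_sum h (Z t) - ?l s) + ?l s + lattice_sum h (Z t))
      has_real_derivative 0 + inner (superpos g (Z t)) D + 0) (at t within T)"
    by (intro DERIV_add DERIV_const)
  then show ?thesis by simp
qed

end

section \<open>Differential equations with Lipschitz right-hand side\<close>

lemma norm_increment_le:
  fixes f :: "real \<Rightarrow> 'a::real_normed_vector"
  assumes "a \<le> b"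
    and f: "\<And>t. t \<in> {a..b} \<Longrightarrow> (f has_vector_derivative f' t) (at t within {a..b})"
    and \<phi>: "\<And>t. t \<in> {a..b} \<Longrightarrow> (\<phi> has_vector_derivative \<phi>' t) (at t within {a..b})"
    and le: "\<And>t. t \<in> {a..b} \<Longrightarrow> norm (f' t) \<le> \<phi>' t"
  shows "norm (f b - f a) \<le> \<phi> b - (\<phi> a :: real)"
proof (cases "a = b")
  case False
  show ?thesis
  proof (rule differentiable_bound_general)
    show "a < b" using False assms(1) by simp
    show "continuous_on {a..b} f" "continuous_on {a..b} \<phi>"
      using f \<phi> by (meson continuous_on_eq_continuous_within has_vector_derivative_continuous)+
    show "(f has_vector_derivative f' t) (at t)" "(\<phi> has_vector_derivative \<phi>' t) (at t)" "norm (f' t) \<le> \<phi>' t"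
      if "a < t" "t < b" for t
      using f[of t] \<phi>[of t] le[of t] that by (simp_all add: at_within_Icc_at)
  qed
qed simp

lemma norm_increment_le_linear:
  fixes f :: "real \<Rightarrow> 'a::real_normed_vector"
  assumes "a \<le> b"
    and "\<And>t. t \<in> {a..b} \<Longrightarrow> (f has_vector_derivative f' t) (at t within {a..b})"
    and "\<And>t. t \<in> {a..b} \<Longrightarrow> norm (f' t) \<le> B"
  shows "norm (f b - f a) \<le> B * (b - a)"
proof -
  have "norm (f b - f a) \<le> B * b - B * a"
    by (rule norm_increment_le[where \<phi>' = "\<lambda>_. B", OF assms(1,2)])
       (auto intro!: derivative_eq_intros assms(3))
  then show ?thesis by (simp add: algebra_simps)
qed

text \<open>Picard iteration in the variable \<open>z t = exp (- 2 * l * t) * X t\<close>. The weight makes the integral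
  operator a contraction with factor \<open>1 / 2\<close> on the bounded continuous functions on the whole half
  line, so that global existence needs no continuation of local solutions. Functions are
  extended to negative times by their value at \<open>0\<close>, because the space of bounded continuous
  functions lives on all of \<open>\<real>\<close>.\<close>

lemma lipschitz_ode_exists:
  fixes A :: "'a::banach \<Rightarrow> 'a"
  assumes lip: "L-lipschitz_on UNIV A"
  shows "\<exists>X. X 0 = x0 \<and> (\<forall>t\<ge>0. (X has_vector_derivative A (X t)) (at t within {0..}))"
proof -
  define l where "l = L + 1"
  have l: "l > 0" using lipschitz_on_nonneg[OF lip] by (simp add: l_def)
  have A: "norm (A x - A y) \<le> l * norm (x - y)" for x y
  proof -
    have "norm (A x - A y) \<le> L * norm (x - y)"
      using lipschitz_onD[OF lip, of x y] by (simp add: dist_norm)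
    also have "\<dots> \<le> l * norm (x - y)" by (simp add: l_def mult_right_mono)
    finally show ?thesis .
  qed
  define G where "G z s = A (exp (2 * l * s) *\<^sub>R apply_bcontfun z s)" for z :: "real \<Rightarrow>\<^sub>C 'a" and s
  define P where "P z t = integral {0..t} (G z)" for z t
  define R where "R z t = exp (- (2 * l * max 0 t)) *\<^sub>R (x0 + P z (max 0 t))" for z t
  have "continuous_on S (G z)" for S z
    unfolding G_def
    by (rule continuous_on_compose2[OF lipschitz_on_continuous_on[OF lip]]) (auto intro!: continuous_intros)
  then have dP: "(P z has_vector_derivative G z t) (at t within {0..b})" if "t \<in> {0..b}" for z t b
    unfolding P_def using that by (intro integral_has_vector_derivative)
  have dP': "(P z has_vector_derivative G z t) (at t within {0..})" if "t \<ge> 0" for z t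
  proof -
    have "at t within {0..t+1} = at t within {0..}"
      by (rule at_within_nhd[of t "{..<t+1}"]) auto
    then show ?thesis using dP[of t "t + 1" z] that by simp
  qed
  have P_diff: "norm (P z t - P y t) \<le> exp (2 * l * t) * (dist z y / 2)" if "t \<ge> 0" for z y t
  proof -
    have "norm ((P z t - P y t) - (P z 0 - P y 0)) \<le> exp (2 * l * t) * (dist z y / 2) - exp (2 * l * 0) * (dist z y / 2)"
    proof (rule norm_increment_le[OF that])
      fix s assume s: "s \<in> {0..t}"
      show "((\<lambda>s. P z s - P y s) has_vector_derivative G z s - G y s) (at s within {0..t})"
        by (intro has_vector_derivative_diff dP s)
      show "((\<lambda>s. exp (2 * l * s) * (dist z y / 2)) has_vector_derivative l * (exp (2 * l * s) * dist z y)) (at s within {0..t})"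
        unfolding has_real_derivative_iff_has_vector_derivative[symmetric]
        by (auto intro!: derivative_eq_intros)
      have "norm (G z s - G y s) \<le> l * (exp (2 * l * s) * norm (apply_bcontfun z s - apply_bcontfun y s))"
        unfolding G_def by (rule order_trans[OF A]) (simp flip: scaleR_diff_right)
      also have "\<dots> \<le> l * (exp (2 * l * s) * dist z y)"
        using dist_bounded[of z s y] l by (simp add: dist_norm mult_left_mono)
      finally show "norm (G z s - G y s) \<le> l * (exp (2 * l * s) * dist z y)" .
    qed
    moreover have "P z 0 = 0" "P y 0 = 0" by (simp_all add: P_def)
    ultimately show ?thesis
      using zero_le_dist[of z y] by (simp only: diff_zero mult_zero_right exp_zero)
  qed
  have R_diff: "norm (R z t - R y t) \<le> dist z y / 2" for z y t
  proof -
    let ?t = "max 0 t"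
    have "R z t - R y t = exp (- (2 * l * ?t)) *\<^sub>R (P z ?t - P y ?t)"
      unfolding R_def scaleR_diff_right[symmetric] by simp
    then have "norm (R z t - R y t) = exp (- (2 * l * ?t)) * norm (P z ?t - P y ?t)"
      by simp
    also have "\<dots> \<le> exp (- (2 * l * ?t)) * (exp (2 * l * ?t) * (dist z y / 2))"
      by (intro mult_left_mono P_diff) auto
    also have "\<dots> = dist z y / 2"
      by (simp add: mult.assoc[symmetric] flip: exp_add)
    finally show ?thesis .
  qed
  have R0: "norm (R 0 t) \<le> norm x0 + norm (A 0) / (2 * l)" for t
  proof -
    let ?t = "max 0 t"
    have "2 * l * ?t \<le> exp (2 * l * ?t)"
      using exp_ge_add_one_self[of "2 * l * ?t"] by linarith
    then have "exp (- (2 * l * ?t)) * (2 * l * ?t) \<le> exp (- (2 * l * ?t)) * exp (2 * l * ?t)"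
      by (intro mult_left_mono) auto
    then have e: "exp (- (2 * l * ?t)) * ?t \<le> 1 / (2 * l)"
      using l by (simp add: field_simps flip: exp_add)
    have "G 0 = (\<lambda>_. A 0)" by (simp add: G_def fun_eq_iff)
    then have "P 0 ?t = ?t *\<^sub>R A 0" by (simp add: P_def)
    then have "norm (R 0 t) \<le> exp (- (2 * l * ?t)) * (norm x0 + ?t * norm (A 0))"
      unfolding R_def norm_scaleR
      by (simp add: mult_left_mono norm_triangle_le)
    also have "\<dots> = exp (- (2 * l * ?t)) * norm x0 + (exp (- (2 * l * ?t)) * ?t) * norm (A 0)"
      by (simp add: algebra_simps)
    also have "\<dots> \<le> 1 * norm x0 + (1 / (2 * l)) * norm (A 0)"
      using l by (intro add_mono mult_right_mono e) auto
    finally show ?thesis by simp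
  qed
  have Rb: "R z \<in> bcontfun" for z
  proof (rule bcontfun_normI)
    have "continuous_on {0..} (P z)"
      using dP' by (meson atLeast_iff continuous_on_eq_continuous_within has_vector_derivative_continuous)
    then have "continuous_on UNIV (\<lambda>t. P z (max 0 t))"
      by (rule continuous_on_compose2) (auto intro!: continuous_intros)
    then show "continuous_on UNIV (R z)"
      unfolding R_def by (intro continuous_intros)
    show "norm (R z t) \<le> dist z 0 / 2 + (norm x0 + norm (A 0) / (2 * l))" for t
      using R_diff[of z t 0] R0[of t] norm_triangle_ineq[of "R z t - R 0 t" "R 0 t"] by simp
  qed
  have "\<exists>!z. Bcontfun (R z) = z"
  proof (rule banach_fix_type[of "1/2"])
    show "\<forall>z y. dist (Bcontfun (R z)) (Bcontfun (R y)) \<le> 1 / 2 * dist z y"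
    proof (intro allI dist_bound)
      show "dist (apply_bcontfun (Bcontfun (R z)) t) (apply_bcontfun (Bcontfun (R y)) t) \<le> 1 / 2 * dist z y" for z y t
        unfolding Bcontfun_inverse[OF Rb] using R_diff[of z t y] by (simp add: dist_norm[of "R z t"])
    qed
  qed auto
  then obtain z where "Bcontfun (R z) = z" by blast
  then have z: "apply_bcontfun z = R z" using Bcontfun_inverse[OF Rb] by metis
  define X where "X t = x0 + P z t" for t
  have X: "X t = exp (2 * l * t) *\<^sub>R apply_bcontfun z t" if "t \<ge> 0" for t
    using that by (simp add: z R_def X_def flip: exp_add)
  show ?thesis
  proof (intro exI[of _ X] conjI allI impI)
    show "X 0 = x0" by (simp add: X_def P_def)
    fix t :: real assume t: "t \<ge> 0"
    have "(X has_vector_derivative 0 + G z t) (at t within {0..})"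
      unfolding X_def by (intro has_vector_derivative_add has_vector_derivative_const dP' t)
    then show "(X has_vector_derivative A (X t)) (at t within {0..})"
      by (simp add: X[OF t] G_def)
  qed
qed

text \<open>Gronwall's argument: \<open>exp (- 2 * L * t) * norm (X t - Y t) ^ 2\<close> is nonincreasing.\<close>

lemma lipschitz_ode_unique:
  fixes A :: "'a::real_inner \<Rightarrow> 'a"
  assumes lip: "L-lipschitz_on S A"
    and X: "\<And>t. t \<in> {0..T} \<Longrightarrow> (X has_vector_derivative A (X t)) (at t within {0..T})"
    and Y: "\<And>t. t \<in> {0..T} \<Longrightarrow> (Y has_vector_derivative A (Y t)) (at t within {0..T})"
    and S: "\<And>t. t \<in> {0..T} \<Longrightarrow> X t \<in> S \<and> Y t \<in> S"
    and "X 0 = Y 0" and t: "t \<in> {0..T}"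
  shows "X t = Y t"
proof -
  let ?e = "\<lambda>s. exp (- (2 * L * s)) * inner (X s - Y s) (X s - Y s)"
  let ?d = "\<lambda>s. exp (- (2 * L * s)) * (2 * inner (X s - Y s) (A (X s) - A (Y s)))
             - 2 * L * exp (- (2 * L * s)) * inner (X s - Y s) (X s - Y s)"
  have der: "(?e has_real_derivative ?d s) (at s within {0..t})" if s: "s \<in> {0..t}" for s
  proof -
    have sT: "s \<in> {0..T}" and sub: "{0..t} \<subseteq> {0..T}" using s t by auto
    have "((\<lambda>s. X s - Y s) has_vector_derivative A (X s) - A (Y s)) (at s within {0..t})"
      by (intro has_vector_derivative_diff has_vector_derivative_within_subset[OF X sub]
          has_vector_derivative_within_subset[OF Y sub] sT)
    from bounded_bilinear.has_vector_derivative[OF bounded_bilinear_inner this this]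
    have i: "((\<lambda>s. inner (X s - Y s) (X s - Y s)) has_real_derivative 2 * inner (X s - Y s) (A (X s) - A (Y s))) (at s within {0..t})"
      by (simp add: has_real_derivative_iff_has_vector_derivative inner_commute)
    have "((\<lambda>s. exp (- (2 * L * s))) has_real_derivative - (2 * L * exp (- (2 * L * s)))) (at s within {0..t})"
      by (auto intro!: derivative_eq_intros)
    from DERIV_mult[OF this i] show ?thesis
      by (rule DERIV_cong) (simp add: mult_ac)
  qed
  have "\<exists>s\<in>{0..t}. ?e t - ?e 0 = ?d s * (t - 0)"
    by (rule mvt_very_simple[where f = ?e and f' = "\<lambda>s. (*) (?d s)"])
       (use t der in \<open>auto simp: has_field_derivative_def\<close>)
  then obtain s where s: "s \<in> {0..t}" "?e t - ?e 0 = ?d s * t" by (auto simp del: right_diff_distrib)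
  then have sT: "s \<in> {0..T}" using t by auto
  have "inner (X s - Y s) (A (X s) - A (Y s)) \<le> norm (X s - Y s) * norm (A (X s) - A (Y s))"
    by (rule norm_cauchy_schwarz)
  also have "\<dots> \<le> norm (X s - Y s) * (L * norm (X s - Y s))"
    using lipschitz_onD[OF lip] S[OF sT] by (intro mult_left_mono) (auto simp: dist_norm)
  finally have "?d s \<le> 0"
    by (simp add: power2_norm_eq_inner[symmetric] power2_eq_square mult_ac)
  then have "?e t \<le> 0" using s t \<open>X 0 = Y 0\<close> by (simp add: mult_nonpos_nonneg)
  then have "inner (X t - Y t) (X t - Y t) \<le> 0" by (simp add: mult_le_0_iff)
  then have "inner (X t - Y t) (X t - Y t) = 0"
    by (rule antisym) (rule inner_ge_zero)
  then show ?thesis by simp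
qed

section \<open>Homogeneous powers\<close>

definition radial_pow :: "real \<Rightarrow> 'a::real_normed_vector \<Rightarrow> 'a" where
  "radial_pow p z = (norm z powr p) *\<^sub>R z"

lemma radial_pow_0 [simp]: "radial_pow p 0 = 0"
  by (simp add: radial_pow_def)

text \<open>For \<open>p < 1\<close> the derivative of \<open>\<lambda>x. x powr p\<close> is unbounded near \<open>0\<close>; the factor \<open>b\<close>, which is smaller
  than any intermediate point, compensates for this.\<close>

lemma powr_increment_le:
  fixes a b p \<rho> :: real
  assumes "p > 0" "0 \<le> b" "b \<le> a" "a \<le> \<rho>"
  shows "(a powr p - b powr p) * b \<le> p * \<rho> powr p * (a - b)"
proof (cases "b = 0 \<or> a = b")
  case True
  then show ?thesis using assms by auto
next
  case False
  then have b: "0 < b" "b < a" using assms by auto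
  have "\<exists>\<xi>. b < \<xi> \<and> \<xi> < a \<and> a powr p - b powr p = (a - b) * (p * \<xi> powr (p - 1))"
    by (rule MVT2) (use b in \<open>auto intro: has_real_derivative_powr\<close>)
  then obtain \<xi> where \<xi>: "b < \<xi>" "\<xi> < a" "a powr p - b powr p = (a - b) * (p * \<xi> powr (p - 1))"
    by blast
  have "\<xi> powr (p - 1) * b \<le> \<xi> powr (p - 1) * \<xi>"
    using \<xi> by (simp add: mult_left_mono)
  also have "\<dots> = \<xi> powr p"
    using \<xi> b by (simp add: powr_mult_base[of \<xi> "p - 1"] mult.commute[of _ \<xi>])
  also have "\<dots> \<le> \<rho> powr p"
    using \<xi> b assms by (intro powr_mono2) auto
  finally have "\<xi> powr (p - 1) * b \<le> \<rho> powr p" .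
  then have "((a - b) * p) * (\<xi> powr (p - 1) * b) \<le> ((a - b) * p) * \<rho> powr p"
    using b assms by (intro mult_left_mono) auto
  then show ?thesis by (simp add: \<xi>(3) mult_ac)
qed

text \<open>The factor \<open>\<rho> powr p\<close> is what makes the nonlinearity small: on solutions of size \<open>\<epsilon>\<close> it becomes
  \<open>\<epsilon> powr (\<alpha> - 1)\<close>, the inverse of the natural time scale.\<close>

lemma lipschitz_on_radial_pow:
  assumes "p > 0" "\<rho> \<ge> 0"
  shows "((p + 1) * \<rho> powr p)-lipschitz_on (cball 0 \<rho>) (radial_pow p :: 'a::real_normed_vector \<Rightarrow> 'a)"
proof (rule lipschitz_onI)
  have *: "norm (radial_pow p z - radial_pow p y) \<le> (p + 1) * \<rho> powr p * norm (z - y)"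
    if "norm y \<le> norm z" "norm z \<le> \<rho>" for z y :: 'a
  proof -
    have "radial_pow p z - radial_pow p y = (norm z powr p) *\<^sub>R (z - y) + (norm z powr p - norm y powr p) *\<^sub>R y"
      by (simp add: radial_pow_def algebra_simps)
    then have "norm (radial_pow p z - radial_pow p y) \<le> norm z powr p * norm (z - y) + \<bar>norm z powr p - norm y powr p\<bar> * norm y"
      using norm_triangle_ineq[of "(norm z powr p) *\<^sub>R (z - y)" "(norm z powr p - norm y powr p) *\<^sub>R y"]
      by simp
    also have "\<bar>norm z powr p - norm y powr p\<bar> = norm z powr p - norm y powr p"
      using powr_mono2[of p "norm y" "norm z"] that assms by simp
    also have "(norm z powr p - norm y powr p) * norm y \<le> p * \<rho> powr p * (norm z - norm y)"
      using that assms by (intro powr_increment_le) auto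
    also have "\<dots> \<le> p * \<rho> powr p * norm (z - y)"
      using assms by (intro mult_left_mono norm_triangle_ineq2) auto
    also have "norm z powr p * norm (z - y) \<le> \<rho> powr p * norm (z - y)"
      using that assms by (intro mult_right_mono powr_mono2) auto
    finally show ?thesis by (simp add: algebra_simps)
  qed
  fix z y :: 'a assume zy: "z \<in> cball 0 \<rho>" "y \<in> cball 0 \<rho>"
  show "dist (radial_pow p z) (radial_pow p y) \<le> (p + 1) * \<rho> powr p * dist z y"
  proof (cases "norm y \<le> norm z")
    case True
    then show ?thesis using *[of y z] zy by (simp add: dist_norm)
  next
    case False
    then show ?thesis using *[of z y] zy by (simp add: dist_norm norm_minus_commute)
  qed
qed (use assms in auto)

lemma radial_pow_gradient:
  fixes z :: "'a::real_inner"
  assumes "p > 0"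
  shows "((\<lambda>z. norm z powr (p + 2)) has_derivative (\<lambda>v. inner ((p + 2) *\<^sub>R radial_pow p z) v)) (at z within S)"
proof (rule has_derivative_at_withinI, cases "z = 0")
  case True
  have "((\<lambda>y. norm (y::'a) powr (p + 1)) \<longlongrightarrow> 0) (at 0)"
    by (rule tendsto_zero_powrI[where b = "p + 1"]) (use assms in \<open>auto intro!: tendsto_eq_intros\<close>)
  then have "((\<lambda>y. norm (norm (y::'a) powr (p + 2)) / norm y) \<longlongrightarrow> 0) (at 0)"
  proof (rule Lim_transform_eventually)
    have "norm y powr (p + 1) = norm (norm y powr (p + 2)) / norm y" if "y \<noteq> 0" for y :: 'a
      using that by (simp add: powr_add power2_eq_square powr_numeral)
    then show "\<forall>\<^sub>F y in at (0::'a). norm y powr (p + 1) = norm (norm y powr (p + 2)) / norm y"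
      by (auto simp: eventually_at_filter)
  qed
  then show "((\<lambda>z. norm z powr (p + 2)) has_derivative (\<lambda>v. inner ((p + 2) *\<^sub>R radial_pow p z) v)) (at z)"
    using True assms by (simp add: has_derivative_iff_norm)
next
  case False
  have "((\<lambda>z. norm z powr (p + 2)) has_derivative (\<lambda>v. inner v (sgn z) * ((p + 2) * norm z powr (p + 2 - 1)))) (at z)"
    using False by (intro DERIV_compose_FDERIV[where f = "\<lambda>r. r powr (p + 2)"]
        has_real_derivative_powr has_derivative_norm) auto
  moreover have "inner v (sgn z) * ((p + 2) * norm z powr (p + 2 - 1)) = inner ((p + 2) *\<^sub>R radial_pow p z) v" for v
  proof -
    have "norm z powr (p + 2 - 1) = norm z * norm z powr p"
      using powr_mult_base[of "norm z" p] by (simp add: add.commute)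
    then show ?thesis using False by (simp add: sgn_div_norm radial_pow_def inner_commute)
  qed
  ultimately show "((\<lambda>z. norm z powr (p + 2)) has_derivative (\<lambda>v. inner ((p + 2) *\<^sub>R radial_pow p z) v)) (at z)"
    by (simp only:)
qed

lemma lipschitz_on_scaled_radial_pow:
  assumes "p > 0" "\<rho> \<ge> 0" "c \<ge> 0"
  shows "(c * ((p + 1) * \<rho> powr p))-lipschitz_on (cball 0 \<rho>) (\<lambda>z::'a::real_normed_vector. c *\<^sub>R radial_pow p z)"
  using lipschitz_on_cmult[OF lipschitz_on_radial_pow[OF assms(1,2)], of c] assms(3) by simp

text \<open>The derivative of \<open>V_pow\<close>. Writing both branches with one radial power reduces its Lipschitz
  constant to that of \<open>radial_pow\<close>, since \<open>max\<close> and \<open>min\<close> with \<open>0\<close> are Lipschitz with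
  constant \<open>1\<close>.\<close>

definition power_force :: "real \<Rightarrow> real \<Rightarrow> real \<Rightarrow> real \<Rightarrow> real" where
  "power_force \<alpha> k_minus k_plus r = k_plus * radial_pow (\<alpha> - 1) (max r 0) + k_minus * radial_pow (\<alpha> - 1) (min r 0)"

lemma power_force_0 [simp]: "power_force \<alpha> k_minus k_plus 0 = 0"
  by (simp add: power_force_def)

lemma power_force_homogeneous:
  assumes "r \<ge> 0"
  shows "power_force \<alpha> k_minus k_plus (r * x) = r powr \<alpha> * power_force \<alpha> k_minus k_plus x"
proof (cases "r = 0")
  case False
  with assms have r: "r > 0" by simp
  have m: "max (r * x) 0 = r * max x 0" "min (r * x) 0 = r * min x 0"
    using r by (auto simp: max_def min_def mult_le_0_iff zero_le_mult_iff not_le)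
  have "r powr (\<alpha> - 1) * r = r powr \<alpha>"
    using r by (simp add: powr_mult_base[of r "\<alpha> - 1"] mult.commute[of _ r])
  then have "radial_pow (\<alpha> - 1) (r * y) = r powr \<alpha> * radial_pow (\<alpha> - 1) y" for y :: real
    using r by (simp add: radial_pow_def abs_mult powr_mult)
  then show ?thesis unfolding power_force_def m by (simp add: distrib_left mult.left_commute)
qed auto

lemma lipschitz_on_power_force:
  assumes "\<alpha> > 1" "\<rho> \<ge> 0"
  shows "((\<bar>k_plus\<bar> + \<bar>k_minus\<bar>) * \<alpha> * \<rho> powr (\<alpha> - 1))-lipschitz_on {-\<rho>..\<rho>} (power_force \<alpha> k_minus k_plus)"
proof (rule lipschitz_onI)
  let ?K = "\<alpha> * \<rho> powr (\<alpha> - 1)"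
  have radial_pow: "\<bar>radial_pow (\<alpha> - 1) x - radial_pow (\<alpha> - 1) y\<bar> \<le> ?K * \<bar>x - y\<bar>" if "\<bar>x\<bar> \<le> \<rho>" "\<bar>y\<bar> \<le> \<rho>" for x y :: real
    using lipschitz_onD[OF lipschitz_on_radial_pow[of "\<alpha> - 1" \<rho>], of x y] that assms by (simp add: dist_norm)
  fix r s assume rs: "r \<in> {-\<rho>..\<rho>}" "s \<in> {-\<rho>..\<rho>}"
  have "\<bar>radial_pow (\<alpha> - 1) (max r 0) - radial_pow (\<alpha> - 1) (max s 0)\<bar> \<le> ?K * \<bar>max r 0 - max s 0\<bar>"
    using rs by (intro radial_pow) auto
  also have "\<dots> \<le> ?K * \<bar>r - s\<bar>"
    using assms by (intro mult_left_mono) auto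
  finally have 1: "\<bar>radial_pow (\<alpha> - 1) (max r 0) - radial_pow (\<alpha> - 1) (max s 0)\<bar> \<le> ?K * \<bar>r - s\<bar>" .
  have "\<bar>radial_pow (\<alpha> - 1) (min r 0) - radial_pow (\<alpha> - 1) (min s 0)\<bar> \<le> ?K * \<bar>min r 0 - min s 0\<bar>"
    using rs by (intro radial_pow) auto
  also have "\<dots> \<le> ?K * \<bar>r - s\<bar>"
    using assms by (intro mult_left_mono) auto
  finally have 2: "\<bar>radial_pow (\<alpha> - 1) (min r 0) - radial_pow (\<alpha> - 1) (min s 0)\<bar> \<le> ?K * \<bar>r - s\<bar>" .
  have "\<bar>power_force \<alpha> k_minus k_plus r - power_force \<alpha> k_minus k_plus s\<bar>
      = \<bar>k_plus * (radial_pow (\<alpha> - 1) (max r 0) - radial_pow (\<alpha> - 1) (max s 0)) + k_minus * (radial_pow (\<alpha> - 1) (min r 0) - radial_pow (\<alpha> - 1) (min s 0))\<bar>"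
    by (simp add: power_force_def algebra_simps)
  also have "\<dots> \<le> \<bar>k_plus\<bar> * \<bar>radial_pow (\<alpha> - 1) (max r 0) - radial_pow (\<alpha> - 1) (max s 0)\<bar> + \<bar>k_minus\<bar> * \<bar>radial_pow (\<alpha> - 1) (min r 0) - radial_pow (\<alpha> - 1) (min s 0)\<bar>"
    by (simp add: abs_mult flip: abs_mult) (metis abs_mult abs_triangle_ineq)
  also have "\<dots> \<le> \<bar>k_plus\<bar> * (?K * \<bar>r - s\<bar>) + \<bar>k_minus\<bar> * (?K * \<bar>r - s\<bar>)"
    using 1 2 by (intro add_mono mult_left_mono) auto
  finally show "dist (power_force \<alpha> k_minus k_plus r) (power_force \<alpha> k_minus k_plus s)
      \<le> (\<bar>k_plus\<bar> + \<bar>k_minus\<bar>) * \<alpha> * \<rho> powr (\<alpha> - 1) * dist r s"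
    by (simp add: dist_norm algebra_simps)
qed (use assms in auto)

lemma V_pow_bound:
  assumes "\<alpha> > 1"
  shows "\<bar>V_pow \<alpha> k_minus k_plus r\<bar> \<le> (\<bar>k_minus\<bar> + \<bar>k_plus\<bar>) * \<bar>r\<bar> powr (\<alpha> + 1)"
proof -
  have "\<bar>k / (1 + \<alpha>)\<bar> \<le> \<bar>k_minus\<bar> + \<bar>k_plus\<bar>" if "\<bar>k\<bar> \<le> \<bar>k_minus\<bar> + \<bar>k_plus\<bar>" for k
  proof -
    have "\<bar>k\<bar> / (1 + \<alpha>) \<le> \<bar>k\<bar>" using assms by (simp add: field_simps)
    then show ?thesis using that assms by simp
  qed
  from this[of k_minus] this[of k_plus] show ?thesis
    unfolding V_pow_def
    by (cases "r \<le> 0") (simp_all only: if_True if_False abs_mult abs_of_nonneg[OF powr_ge_zero], auto intro!: mult_right_mono simp del: abs_divide)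
qed

lemma V_pow_derivative:
  assumes "\<alpha> > 1"
  shows "(V_pow \<alpha> k_minus k_plus has_real_derivative power_force \<alpha> k_minus k_plus r) (at r)"
proof -
  have pwr: "((\<lambda>r. k / (1 + \<alpha>) * \<bar>r\<bar> powr (\<alpha> + 1)) has_real_derivative k * radial_pow (\<alpha> - 1) r) (at r)" for k and r :: real
  proof -
    have "((\<lambda>r. \<bar>r\<bar> powr (\<alpha> + 1)) has_real_derivative (\<alpha> + 1) * radial_pow (\<alpha> - 1) r) (at r)"
      using radial_pow_gradient[of "\<alpha> - 1" r UNIV] assms by (simp add: has_field_derivative_def add.commute[of 1 \<alpha>])
    from DERIV_cmult[OF this, of "k / (1 + \<alpha>)"] show ?thesis
      by (rule DERIV_cong) (use assms in \<open>simp add: add.commute[of 1 \<alpha>]\<close>)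
  qed
  consider "r < 0" | "r > 0" | "r = 0" by linarith
  then show ?thesis
  proof cases
    case 1
    have "(V_pow \<alpha> k_minus k_plus has_real_derivative k_minus * radial_pow (\<alpha> - 1) r) (at r)"
      by (rule has_field_derivative_transform_within_open[OF pwr[of k_minus r], of "{..<0}"])
         (use 1 in \<open>auto simp: V_pow_def\<close>)
    then show ?thesis using 1 by (simp add: power_force_def)
  next
    case 2
    have "(V_pow \<alpha> k_minus k_plus has_real_derivative k_plus * radial_pow (\<alpha> - 1) r) (at r)"
      by (rule has_field_derivative_transform_within_open[OF pwr[of k_plus r], of "{0<..}"])
         (use 2 in \<open>auto simp: V_pow_def\<close>)
    then show ?thesis using 2 by (simp add: power_force_def)
  next
    case 3
    let ?K = "\<bar>k_minus\<bar> + \<bar>k_plus\<bar>"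
    have "(V_pow \<alpha> k_minus k_plus has_real_derivative 0) (at 0 within UNIV)"
    proof (rule has_derivative_zero_of_quadratic_bound)
      show "((\<lambda>r. (?K * (1 + \<alpha>)) / (1 + \<alpha>) * \<bar>r\<bar> powr (\<alpha> + 1)) has_real_derivative 0) (at 0 within UNIV)"
        using pwr[of "?K * (1 + \<alpha>)" 0] by simp
      show "\<bar>V_pow \<alpha> k_minus k_plus r\<bar> \<le> (?K * (1 + \<alpha>)) / (1 + \<alpha>) * \<bar>r\<bar> powr (\<alpha> + 1)" for r
        using V_pow_bound[OF assms, of k_minus k_plus r] assms by simp
    qed (use assms in auto)
    then show ?thesis using 3 by simp
  qed
qed

section \<open>Averages over a rotation\<close>

lemma continuous_antiderivative:
  fixes k :: "real \<Rightarrow> 'a::euclidean_space"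
  assumes "continuous_on UNIV k"
  obtains K where "\<And>u. (K has_vector_derivative k u) (at u)"
  using einterval_antiderivative[of "- \<infinity>" "\<infinity>" k] assms
  by (auto simp: continuous_on_eq_continuous_at)

text \<open>The integral is the projection of \<open>s \<mapsto> f (Re (cis (- s) * z))\<close> onto its first harmonic. It
  commutes with rotations of \<open>z\<close> by periodicity and scales like \<open>norm z powr a\<close> by homogeneity, so
  only \<open>z = 1\<close> matters. There the coefficient is real, because \<open>sin u * f (cos u)\<close> is an exact
  derivative of a periodic function. That \<open>c\<close> is real is decisive: an imaginary part would make
  the averaged rate of change of the invariant nonzero.\<close>

lemma circle_average:
  fixes f :: "real \<Rightarrow> real"
  assumes cont: "continuous_on UNIV f"
    and hom: "\<And>r x. r \<ge> 0 \<Longrightarrow> f (r * x) = r powr a * f x"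
  obtains c :: real where
    "\<And>z. ((\<lambda>s. cis s * complex_of_real (f (Re (cis (- s) * z)))) has_integral c *\<^sub>R radial_pow (a - 1) z) {0..2 * pi}"
proof -
  define k where "k u = cis u * complex_of_real (f (cos u))" for u
  have "continuous_on UNIV k"
    unfolding k_def by (intro continuous_intros continuous_on_compose2[OF cont]) auto
  then obtain K where K: "\<And>u. (K has_vector_derivative k u) (at u)"
    using continuous_antiderivative[of k] by blast
  obtain F where F: "\<And>u. (F has_vector_derivative f u) (at u)"
    using continuous_antiderivative[OF cont] by blast
  define c where "c = Re (K (2 * pi) - K 0)"
  \<comment> \<open>The integrand is periodic, so the increment of its antiderivative over a period is constant.\<close>
  have "\<exists>d. \<forall>u\<in>UNIV. K (u + 2 * pi) - K u = d"
  proof (rule has_vector_derivative_zero_constant)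
    fix u :: real
    have "((\<lambda>u. u + 2 * pi) has_vector_derivative 1) (at u)"
      by (auto intro!: derivative_eq_intros simp flip: has_real_derivative_iff_has_vector_derivative)
    from vector_diff_chain_at[OF this K] have "((\<lambda>u. K (u + 2 * pi)) has_vector_derivative k u) (at u)"
      by (simp add: o_def k_def cis_mult[symmetric])
    from has_vector_derivative_diff[OF this K]
    show "((\<lambda>u. K (u + 2 * pi) - K u) has_vector_derivative 0) (at u within UNIV)" by simp
  qed auto
  then obtain d where d: "\<And>u. K (u + 2 * pi) - K u = d" by blast
  \<comment> \<open>The imaginary part of the integrand is an exact derivative of a function of \<open>cos u\<close>.\<close>
  have "\<exists>e. \<forall>u\<in>UNIV. Im (K u) + F (cos u) = e"
  proof (rule has_vector_derivative_zero_constant)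
    fix u :: real
    have "((\<lambda>u. Im (K u)) has_real_derivative sin u * f (cos u)) (at u)"
      using bounded_linear.has_vector_derivative[OF bounded_linear_Im K[of u]]
      by (simp add: has_real_derivative_iff_has_vector_derivative k_def)
    moreover have "((\<lambda>u. F (cos u)) has_real_derivative f (cos u) * (- sin u)) (at u)"
      using F by (intro DERIV_chain2[of F] DERIV_cos) (simp add: has_real_derivative_iff_has_vector_derivative)
    ultimately have "((\<lambda>u. Im (K u) + F (cos u)) has_real_derivative sin u * f (cos u) + f (cos u) * (- sin u)) (at u)"
      by (rule DERIV_add)
    then show "((\<lambda>u. Im (K u) + F (cos u)) has_vector_derivative 0) (at u within UNIV)"
      by (simp add: has_real_derivative_iff_has_vector_derivative)
  qed auto
  then obtain e where e: "\<And>u. Im (K u) + F (cos u) = e" by blast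
  have "Im (K (2 * pi)) = Im (K 0)"
    using e[of "2 * pi"] e[of 0] by simp
  then have dc: "d = complex_of_real c"
    using d[of 0] by (simp add: c_def complex_eq_iff flip: d[of 0])
  have "((\<lambda>s. cis s * complex_of_real (f (Re (cis (- s) * z)))) has_integral c *\<^sub>R radial_pow (a - 1) z) {0..2 * pi}" for z
  proof -
    define r where "r = norm z"
    define \<theta> where "\<theta> = Arg z"
    have z: "z = complex_of_real r * cis \<theta>"
      using rcis_cmod_Arg[of z] by (simp add: rcis_def r_def \<theta>_def)
    have "r \<ge> 0" by (simp add: r_def)
    let ?C = "complex_of_real (r powr a) * cis \<theta>"
    have eq: "cis s * complex_of_real (f (Re (cis (- s) * z))) = ?C * k (s - \<theta>)" for s
    proof -
      have "cis (- s) * z = complex_of_real r * cis (\<theta> - s)"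
        unfolding z by (simp add: cis_mult mult.left_commute)
      then have "Re (cis (- s) * z) = r * cos (s - \<theta>)"
        by (simp add: cos_diff mult.commute)
      then have "f (Re (cis (- s) * z)) = r powr a * f (cos (s - \<theta>))"
        using hom[OF \<open>r \<ge> 0\<close>] by simp
      moreover have "cis s = cis \<theta> * cis (s - \<theta>)" by (simp add: cis_mult)
      ultimately show ?thesis by (simp add: k_def mult_ac)
    qed
    have "((\<lambda>s. ?C * k (s - \<theta>)) has_integral (?C * K (2 * pi - \<theta>) - ?C * K (0 - \<theta>))) {0..2 * pi}"
    proof (rule fundamental_theorem_of_calculus)
      fix s :: real
      have "((\<lambda>s. s - \<theta>) has_vector_derivative 1) (at s within {0..2*pi})"
        by (auto intro!: derivative_eq_intros simp flip: has_real_derivative_iff_has_vector_derivative)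
      from vector_diff_chain_within[OF this has_vector_derivative_at_within[OF K]]
      have "((\<lambda>s. K (s - \<theta>)) has_vector_derivative k (s - \<theta>)) (at s within {0..2*pi})"
        by (simp add: o_def)
      then show "((\<lambda>s. ?C * K (s - \<theta>)) has_vector_derivative ?C * k (s - \<theta>)) (at s within {0..2*pi})"
        by (rule has_vector_derivative_mult_right)
    qed auto
    moreover have "?C * K (2 * pi - \<theta>) - ?C * K (0 - \<theta>) = ?C * d"
      using d[of "- \<theta>"] by (simp add: algebra_simps)
    moreover have "?C * d = c *\<^sub>R radial_pow (a - 1) z"
    proof (cases "r = 0")
      case True
      then show ?thesis using z by simp
    next
      case False
      then have "r powr a = r powr (a - 1) * r"
        using powr_mult_base[of r "a - 1"] \<open>r \<ge> 0\<close> by (simp add: mult.commute)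
      then have "?C * d = c *\<^sub>R (r powr (a - 1) *\<^sub>R (complex_of_real r * cis \<theta>))"
        by (simp add: dc scaleR_conv_of_real)
      also have "complex_of_real r * cis \<theta> = z" by (rule z[symmetric])
      finally show ?thesis by (simp only: radial_pow_def r_def)
    qed
    ultimately show ?thesis by (simp only: eq)
  qed
  then show thesis by (rule that)
qed

lemma continuous_on_cmul_cis: "continuous_on S (\<lambda>s. cmul (cis (h s)) Z)" if "continuous_on S h"
  by (intro bounded_bilinear.continuous_on[OF bounded_bilinear_cmul] continuous_intros that)

lemma continuous_on_superpos:
  assumes "L-lipschitz_on S g" "0 \<in> S" "g 0 = 0" "\<And>Z n. Z \<in> A \<Longrightarrow> coord Z n \<in> S"
  shows "continuous_on A (superpos g)"
proof (rule lipschitz_on_continuous_on)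
  show "L-lipschitz_on A (superpos g)"
    by (rule lipschitz_onI)
       (use norm_superpos_diff_le[OF assms(1-3)] assms(4) lipschitz_on_nonneg[OF assms(1)] in \<open>auto simp: dist_norm\<close>)
qed

lemma superpos_radial_pow_cmul:
  assumes "p > 0" "norm c = 1"
  shows "superpos (radial_pow p) (cmul c Z) = cmul c (superpos (radial_pow p) Z)"
proof -
  have c: "coord (superpos (radial_pow p) Y) n = radial_pow p (coord Y n)" for Y n
    by (rule coord_superpos[OF lipschitz_on_radial_pow[OF assms(1), of "norm Y"]]) (auto simp: norm_coord_le)
  show ?thesis
    by (rule l2_eqI) (simp add: c radial_pow_def norm_mult assms(2))
qed

text \<open>Evaluation at a lattice site is bounded and linear, so the vector-valued integral can be computed
  site by site.\<close>

lemma l2_circle_average: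
  fixes f :: "real \<Rightarrow> real"
  assumes avg: "\<And>z. ((\<lambda>s. cis s * complex_of_real (f (Re (cis (- s) * z)))) has_integral c *\<^sub>R radial_pow p z) {0..2 * pi}"
    and lip: "L-lipschitz_on {- norm U..norm U} f" and "f 0 = 0" and "p > 0"
  shows "((\<lambda>s. cmul (cis s) (superpos (on_Re f) (cmul (cis (- s)) U))) has_integral c *\<^sub>R superpos (radial_pow p) U) {0..2 * pi}"
    (is "(?G has_integral _) _")
proof -
  let ?S = "Re -` {- norm U..norm U}"
  note L = lipschitz_on_Re[OF lip]
  have f0: "on_Re f 0 = 0" "0 \<in> ?S" by (simp_all add: on_Re_def \<open>f 0 = 0\<close>)
  have S: "coord Z n \<in> ?S" if "norm Z \<le> norm U" for Z n
    using abs_Re_le_cmod[of "coord Z n"] norm_coord_le[of Z n] that by auto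
  have "continuous_on {0..2*pi} (\<lambda>s. superpos (on_Re f) (cmul (cis (- s)) U))"
    by (rule continuous_on_compose2[OF continuous_on_superpos[OF L f0(2,1), of "cball 0 (norm U)"]])
       (use S in \<open>auto intro!: continuous_on_cmul_cis continuous_intros\<close>)
  then have "continuous_on {0..2*pi} ?G"
    by (intro bounded_bilinear.continuous_on[OF bounded_bilinear_cmul] continuous_intros)
  then have "?G integrable_on {0..2*pi}" by (rule integrable_continuous_real)
  then obtain M where M: "(?G has_integral M) {0..2*pi}" by blast
  have "M = c *\<^sub>R superpos (radial_pow p) U"
  proof (rule l2_eqI)
    fix n
    have "((\<lambda>Z. coord Z n) \<circ> ?G has_integral coord M n) {0..2*pi}"
      by (rule has_integral_linear[OF M bounded_linear_coord])
    moreover have "((\<lambda>Z. coord Z n) \<circ> ?G) = (\<lambda>s. cis s * complex_of_real (f (Re (cis (- s) * coord U n))))"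
    proof
      fix s
      have "coord (superpos (on_Re f) (cmul (cis (- s)) U)) n = on_Re f (coord (cmul (cis (- s)) U) n)"
        by (rule coord_superpos[OF L f0(2,1)]) (rule S, simp)
      then show "((\<lambda>Z. coord Z n) \<circ> ?G) s = cis s * complex_of_real (f (Re (cis (- s) * coord U n)))"
        by (simp add: on_Re_def)
    qed
    ultimately have "coord M n = c *\<^sub>R radial_pow p (coord U n)"
      using avg[of "coord U n"] has_integral_unique by metis
    also have "radial_pow p (coord U n) = coord (superpos (radial_pow p) U) n"
      by (rule coord_superpos[OF lipschitz_on_radial_pow[OF \<open>p > 0\<close>, of "norm U"], symmetric]) (auto simp: norm_coord_le)
    finally show "coord M n = coord (c *\<^sub>R superpos (radial_pow p) U) n" by simp
  qed
  with M show ?thesis by simp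
qed

text \<open>The Laplacian is minus the square of a difference operator that commutes with multiplication by
  \<open>i\<close>; summation by parts leaves \<open>\<langle>Y, i Y\<rangle> = 0\<close> for \<open>Y = fdiff W\<close>.\<close>

lemma discrete_laplacian_skew: "inner W (cmul \<i> (bdiff (fdiff W))) = 0"
proof -
  have "inner W (cmul \<i> (bdiff (fdiff W))) = - inner (fdiff W) (cmul \<i> (fdiff W))"
    by (simp add: inner_fdiff bdiff_cmul)
  then show ?thesis by (simp add: cmul_ii_skew)
qed

text \<open>The superposition operator of the radial power commutes with rotations. Moving the rotation to the
  second factor of the inner product turns the average into \<open>c * \<langle>W, i \<Delta> W\<rangle>\<close>.\<close>

lemma resonant_average_zero:
  fixes f :: "real \<Rightarrow> real"
  assumes avg: "\<And>z. ((\<lambda>s. cis s * complex_of_real (f (Re (cis (- s) * z)))) has_integral c *\<^sub>R radial_pow p z) {0..2 * pi}"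
    and lip: "L-lipschitz_on {- norm U..norm U} f" and "f 0 = 0" and "p > 0"
  shows "((\<lambda>s. inner (superpos (radial_pow p) (cmul (cis (- s)) U))
      (cmul \<i> (bdiff (fdiff (superpos (on_Re f) (cmul (cis (- s)) U)))))) has_integral 0) {0..2 * pi}"
proof -
  define W where "W = superpos (radial_pow p) U"
  define h where "h Z = inner W (cmul \<i> (bdiff (fdiff Z)))" for Z
  have bl: "bounded_linear h"
    unfolding h_def
    by (intro bounded_linear_compose[OF bounded_linear_inner_right]
        bounded_linear_compose[OF bounded_bilinear.bounded_linear_right[OF bounded_bilinear_cmul]]
        bounded_linear_compose[OF bounded_linear_bdiff] bounded_linear_fdiff)
  have eq: "inner (superpos (radial_pow p) (cmul (cis (- s)) U)) (cmul \<i> (bdiff (fdiff Z))) = h (cmul (cis s) Z)" for s Z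
  proof -
    have "superpos (radial_pow p) (cmul (cis (- s)) U) = cmul (cis (- s)) W"
      unfolding W_def using \<open>p > 0\<close> by (intro superpos_radial_pow_cmul) auto
    then show ?thesis
      by (simp add: h_def inner_cmul cis_cnj fdiff_cmul bdiff_cmul mult.commute)
  qed
  have "(h \<circ> (\<lambda>s. cmul (cis s) (superpos (on_Re f) (cmul (cis (- s)) U))) has_integral h (c *\<^sub>R W)) {0..2*pi}"
    unfolding W_def by (rule has_integral_linear[OF l2_circle_average[OF assms] bl])
  moreover have "h (c *\<^sub>R W) = 0"
    using discrete_laplacian_skew[of W] linear_cmul[OF bounded_linear.linear[OF bl], of c W] by (simp add: h_def)
  ultimately show ?thesis by (simp add: eq o_def)
qed

section \<open>The lattice vector field and its energy\<close>

text \<open>With \<open>Z = x + i y\<close> this is the lattice equation. The bracket is the gradient of the energy, so the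
  factor \<open>- i\<close> displays the Hamiltonian structure.\<close>

definition lattice_field :: "(real \<Rightarrow> real) \<Rightarrow> (real \<Rightarrow> real) \<Rightarrow> l2 \<Rightarrow> l2" where
  "lattice_field f g Z = cmul (- \<i>) (Z - fdiff (superpos (on_Re f) (bdiff Z)) + superpos (on_Re g) Z)"

lemma norm_bdiff_fdiff_le: "norm (bdiff (fdiff Z)) \<le> 4 * norm Z"
  using norm_bdiff_le[of "fdiff Z"] norm_fdiff_le[of Z] by simp

lemma lipschitz_lattice_field:
  assumes f: "K-lipschitz_on T f" "f 0 = 0" and g: "K-lipschitz_on T g" "g 0 = 0" and "0 \<in> T"
    and A: "\<And>Z n. Z \<in> A \<Longrightarrow> Re (coord (bdiff Z) n) \<in> T \<and> Re (coord Z n) \<in> T"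
  shows "(1 + 5 * K)-lipschitz_on A (lattice_field f g)"
proof (rule lipschitz_onI)
  have K: "K \<ge> 0" using f(1) by (rule lipschitz_on_nonneg)
  then show "1 + 5 * K \<ge> 0" by simp
  fix Z Y assume ZY: "Z \<in> A" "Y \<in> A"
  let ?f = "\<lambda>Z. superpos (on_Re f) (bdiff Z)" and ?g = "superpos (on_Re g)"
  have df: "norm (?f Z - ?f Y) \<le> K * norm (bdiff (Z - Y))"
    using norm_superpos_diff_le[OF lipschitz_on_Re[OF f(1)], of "bdiff Z" "bdiff Y"] A ZY \<open>0 \<in> T\<close> f(2)
    by (simp add: on_Re_def linear_diff[OF bounded_linear.linear[OF bounded_linear_bdiff]])
  also have "\<dots> \<le> K * (2 * norm (Z - Y))"
    using K norm_bdiff_le by (intro mult_left_mono) auto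
  finally have df: "norm (?f Z - ?f Y) \<le> 2 * K * norm (Z - Y)" by simp
  have dg: "norm (?g Z - ?g Y) \<le> K * norm (Z - Y)"
    using norm_superpos_diff_le[OF lipschitz_on_Re[OF g(1)], of Z Y] A ZY \<open>0 \<in> T\<close> g(2)
    by (simp add: on_Re_def)
  have "lattice_field f g Z - lattice_field f g Y
      = cmul (- \<i>) (((Z - Y) - fdiff (?f Z - ?f Y)) + (?g Z - ?g Y))"
    unfolding lattice_field_def
    by (rule l2_eqI) (simp add: algebra_simps)
  then have "dist (lattice_field f g Z) (lattice_field f g Y) = norm (((Z - Y) - fdiff (?f Z - ?f Y)) + (?g Z - ?g Y))"
    by (simp add: dist_norm)
  also have "\<dots> \<le> norm (Z - Y) + norm (fdiff (?f Z - ?f Y)) + norm (?g Z - ?g Y)"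
    using norm_triangle_ineq[of "(Z - Y) - fdiff (?f Z - ?f Y)" "?g Z - ?g Y"]
      norm_triangle_ineq4[of "Z - Y" "fdiff (?f Z - ?f Y)"] by simp
  also have "\<dots> \<le> (1 + 5 * K) * dist Z Y"
    using df dg norm_fdiff_le[of "?f Z - ?f Y"] by (simp add: dist_norm algebra_simps)
  finally show "dist (lattice_field f g Z) (lattice_field f g Y) \<le> (1 + 5 * K) * dist Z Y" .
qed

lemma on_Re_gradient:
  assumes "(F has_real_derivative f (Re z)) (at (Re z))"
  shows "((\<lambda>z. F (Re z)) has_derivative (\<lambda>v. inner (on_Re f z) v)) (at z within S)"
proof -
  have "((\<lambda>z. F (Re z)) has_derivative (\<lambda>v. Re v * f (Re z))) (at z within S)"
    by (rule DERIV_compose_FDERIV[of F "f (Re z)" Re z Re, OF assms]) (auto intro!: derivative_eq_intros)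
  moreover have "Re v * f (Re z) = inner (on_Re f z) v" for v
    by (simp add: on_Re_def inner_complex_def mult.commute)
  ultimately show ?thesis by (simp only:)
qed

text \<open>The energy \<open>norm Z ^ 2 / 2 + (\<Sum> n. F (Re (bdiff Z))) + (\<Sum> n. G (Re Z))\<close>, with antiderivatives \<open>F\<close>
  and \<open>G\<close> of the forces, has derivative \<open>\<langle>A, - i A\<rangle> = 0\<close> for its gradient \<open>A\<close>. If the forces have a
  small Lipschitz constant \<open>K\<close>, the two potential terms are at most \<open>(4 + 1) * K * norm Z ^ 2\<close>, so
  that the energy controls the norm from both sides, whatever the signs of the potentials.\<close>

lemma energy_bound:
  assumes f: "K-lipschitz_on UNIV f" "f 0 = 0" and g: "K-lipschitz_on UNIV g" "g 0 = 0"
    and Z: "\<And>t. t \<ge> 0 \<Longrightarrow> (Z has_vector_derivative lattice_field f g (Z t)) (at t within {0..})"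
    and "t \<ge> 0"
  shows "(1 - 10 * K) * (norm (Z t))\<^sup>2 \<le> (1 + 10 * K) * (norm (Z 0))\<^sup>2"
proof -
  have pot: "\<exists>F. F 0 = 0 \<and> (\<forall>u. (F has_real_derivative h u) (at u))" if h: "K-lipschitz_on UNIV h" for h
  proof -
    obtain H where H: "\<And>u. (H has_vector_derivative h u) (at u)"
      using continuous_antiderivative[of h, OF lipschitz_on_continuous_on[OF h]] by blast
    have "((\<lambda>u. H u - H 0) has_real_derivative h u) (at u)" for u
      using has_vector_derivative_diff[OF H[of u] has_vector_derivative_const[of "H 0"]]
      by (simp add: has_real_derivative_iff_has_vector_derivative)
    then show ?thesis by (intro exI[of _ "\<lambda>u. H u - H 0"]) simp
  qed
  obtain F where F: "F 0 = 0" "\<And>u. (F has_real_derivative f u) (at u)" using pot[OF f(1)] by blast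
  obtain G where G: "G 0 = 0" "\<And>u. (G has_real_derivative g u) (at u)" using pot[OF g(1)] by blast
  have lf: "K-lipschitz_on UNIV (on_Re f)" and lg: "K-lipschitz_on UNIV (on_Re g)"
    using lipschitz_on_Re[OF f(1)] lipschitz_on_Re[OF g(1)] by simp_all
  have z: "on_Re f 0 = 0" "on_Re g 0 = 0" using f g by (simp_all add: on_Re_def)
  have Fg: "((\<lambda>z. F (Re z)) has_derivative (\<lambda>v. inner (on_Re f z) v)) (at z within UNIV)" for z
    by (rule on_Re_gradient[where F = F and f = f]) (rule F(2))
  have Gg: "((\<lambda>z. G (Re z)) has_derivative (\<lambda>v. inner (on_Re g z) v)) (at z within UNIV)" for z
    by (rule on_Re_gradient[where F = G and f = g]) (rule G(2))
  note Fd = lattice_sum_has_derivative[where h = "\<lambda>z. F (Re z)" and g = "on_Re f" and S = UNIV, OF _ _ _ z(1) Fg lf]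
  note Gd = lattice_sum_has_derivative[where h = "\<lambda>z. G (Re z)" and g = "on_Re g" and S = UNIV, OF _ _ _ z(2) Gg lg]
  note Fb = lattice_sum_bound[where h = "\<lambda>z. F (Re z)" and g = "on_Re f" and S = UNIV, OF _ _ _ z(1) Fg lf]
  note Gb = lattice_sum_bound[where h = "\<lambda>z. G (Re z)" and g = "on_Re g" and S = UNIV, OF _ _ _ z(2) Gg lg]
  define E where "E t = (1/2) * (inner (Z t) (Z t)) + lattice_sum (\<lambda>z. F (Re z)) (bdiff (Z t)) + lattice_sum (\<lambda>z. G (Re z)) (Z t)" for t
  have "\<exists>c. \<forall>t\<in>{0..}. E t = c"
  proof (rule has_vector_derivative_zero_constant)
    fix t :: real assume "t \<in> {0..}"
    then have t: "t \<ge> 0" by simp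
    let ?D = "lattice_field f g (Z t)"
    let ?A = "Z t - fdiff (superpos (on_Re f) (bdiff (Z t))) + superpos (on_Re g) (Z t)"
    have 1: "((\<lambda>t. inner (Z t) (Z t)) has_real_derivative 2 * inner (Z t) ?D) (at t within {0..})"
      using bounded_bilinear.has_vector_derivative[OF bounded_bilinear_inner Z[OF t] Z[OF t]]
      by (simp add: has_real_derivative_iff_has_vector_derivative inner_commute)
    have 2: "((\<lambda>t. lattice_sum (\<lambda>z. F (Re z)) (bdiff (Z t))) has_real_derivative
        inner (superpos (on_Re f) (bdiff (Z t))) (bdiff ?D)) (at t within {0..})"
      by (rule Fd) (use t F(1) in \<open>auto intro: bounded_linear.has_vector_derivative[OF bounded_linear_bdiff Z]\<close>)
    have 3: "((\<lambda>t. lattice_sum (\<lambda>z. G (Re z)) (Z t)) has_real_derivative inner (superpos (on_Re g) (Z t)) ?D) (at t within {0..})"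
      by (rule Gd) (use t G(1) in \<open>auto intro: Z\<close>)
    have "(E has_real_derivative (1/2) * (2 * inner (Z t) ?D) + inner (superpos (on_Re f) (bdiff (Z t))) (bdiff ?D)
        + inner (superpos (on_Re g) (Z t)) ?D) (at t within {0..})"
      unfolding E_def by (intro DERIV_add DERIV_cmult 1 2 3)
    moreover have "(1/2) * (2 * inner (Z t) ?D) + inner (superpos (on_Re f) (bdiff (Z t))) (bdiff ?D)
        + inner (superpos (on_Re g) (Z t)) ?D = inner ?A (cmul (- \<i>) ?A)"
      using inner_fdiff[of "superpos (on_Re f) (bdiff (Z t))" ?D]
      by (simp add: inner_add_left inner_diff_left lattice_field_def)
    moreover have "inner ?A (cmul (- \<i>) ?A) = 0"
    proof -
      have "cmul (- \<i>) ?A = - cmul \<i> ?A" by (rule l2_eqI) (simp add: algebra_simps)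
      then show ?thesis by (simp only: inner_minus_right cmul_ii_skew minus_zero)
    qed
    ultimately show "(E has_vector_derivative 0) (at t within {0..})"
      by (simp add: has_real_derivative_iff_has_vector_derivative)
  qed auto
  then have E: "E t = E 0" using \<open>t \<ge> 0\<close> by fastforce
  have K: "K \<ge> 0" using f(1) by (rule lipschitz_on_nonneg)
  have dev: "\<bar>E s - (1/2) * (norm (Z s))\<^sup>2\<bar> \<le> 5 * K * (norm (Z s))\<^sup>2" for s
  proof -
    have "\<bar>lattice_sum (\<lambda>z. F (Re z)) (bdiff (Z s))\<bar> \<le> K * (norm (bdiff (Z s)))\<^sup>2"
      by (rule Fb) (use F in auto)
    also have "\<dots> \<le> K * (2 * norm (Z s))\<^sup>2"
      using K norm_bdiff_le by (intro mult_left_mono power_mono) auto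
    finally have "\<bar>lattice_sum (\<lambda>z. F (Re z)) (bdiff (Z s))\<bar> \<le> 4 * K * (norm (Z s))\<^sup>2"
      by (simp add: power_mult_distrib)
    moreover have "\<bar>lattice_sum (\<lambda>z. G (Re z)) (Z s)\<bar> \<le> K * (norm (Z s))\<^sup>2"
      by (rule Gb) (use G in auto)
    ultimately show ?thesis by (simp add: E_def power2_norm_eq_inner[symmetric])
  qed
  show ?thesis using dev[of t] dev[of 0] E by (simp add: algebra_simps)
qed

section \<open>The adiabatic invariant\<close>

text \<open>With \<open>p = \<alpha> - 1\<close> and \<open>Z\<close> a difference sequence this is the adiabatic invariant.\<close>

definition pow_sum :: "real \<Rightarrow> l2 \<Rightarrow> real" where
  "pow_sum p Z = lattice_sum (\<lambda>z. norm z powr (p + 2)) Z"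

lemma coord_superpos_radial_pow: "p > 0 \<Longrightarrow> coord (superpos (radial_pow p) Z) n = radial_pow p (coord Z n)"
  by (rule coord_superpos[OF lipschitz_on_radial_pow[of p "norm Z"]]) (auto simp: norm_coord_le)

lemma norm_superpos_radial_pow_le:
  assumes "p > 0" "norm Z \<le> \<sigma>"
  shows "norm (superpos (radial_pow p) Z) \<le> \<sigma> powr p * norm Z"
proof (rule norm_superpos_le)
  fix n
  have "norm (coord Z n) \<le> \<sigma>" using norm_coord_le[of Z n] assms(2) by linarith
  then show "norm (radial_pow p (coord Z n)) \<le> \<sigma> powr p * norm (coord Z n)"
    using assms(1) by (auto simp: radial_pow_def intro!: mult_right_mono powr_mono2)
qed simp

lemma norm_superpos_radial_pow_diff_le:
  assumes "p > 0" "norm Z \<le> \<sigma>" "norm Y \<le> \<sigma>"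
  shows "norm (superpos (radial_pow p) Z - superpos (radial_pow p) Y) \<le> (p + 1) * \<sigma> powr p * norm (Z - Y)"
proof (rule norm_superpos_diff_le[OF lipschitz_on_radial_pow])
  show "coord Z n \<in> cball 0 \<sigma>" "coord Y n \<in> cball 0 \<sigma>" for n
    using norm_coord_le[of Z n] norm_coord_le[of Y n] assms by auto
qed (use assms norm_ge_zero[of Z] in \<open>auto simp del: norm_ge_zero\<close>)

lemma pow_sum_has_derivative:
  assumes "p > 0" and der: "(Z has_vector_derivative D) (at t within T)" and "t \<in> T"
    and b: "\<And>s. s \<in> T \<Longrightarrow> norm (Z s) \<le> \<sigma>"
  shows "((\<lambda>s. pow_sum p (Z s)) has_real_derivative (p + 2) * inner (superpos (radial_pow p) (Z t)) D) (at t within T)"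
proof -
  let ?g = "\<lambda>z::complex. (p + 2) *\<^sub>R radial_pow p z"
  have \<sigma>: "\<sigma> \<ge> 0" using b[OF \<open>t \<in> T\<close>] norm_ge_zero[of "Z t"] by linarith
  note lip = lipschitz_on_scaled_radial_pow[OF \<open>p > 0\<close> \<sigma>, of "p + 2", where 'a = complex]
  have c: "coord (Z s) n \<in> cball 0 \<sigma>" if "s \<in> T" for s n
    using norm_coord_le[of "Z s" n] b[OF that] by simp
  have "((\<lambda>s. lattice_sum (\<lambda>z. norm z powr (p + 2)) (Z s)) has_real_derivative inner (superpos ?g (Z t)) D) (at t within T)"
    by (rule lattice_sum_has_derivative[where S = "cball 0 \<sigma>", OF _ _ _ _ radial_pow_gradient lip der])
       (use \<open>p > 0\<close> \<sigma> c \<open>t \<in> T\<close> in auto)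
  moreover have "superpos ?g (Z t) = (p + 2) *\<^sub>R superpos (radial_pow p) (Z t)"
  proof (rule l2_eqI)
    fix n
    have "coord (superpos ?g (Z t)) n = ?g (coord (Z t) n)"
      by (rule coord_superpos[OF lip]) (use \<open>p > 0\<close> \<sigma> c \<open>t \<in> T\<close> in auto)
    then show "coord (superpos ?g (Z t)) n = coord ((p + 2) *\<^sub>R superpos (radial_pow p) (Z t)) n"
      by (simp add: coord_superpos_radial_pow[OF \<open>p > 0\<close>])
  qed
  ultimately show ?thesis by (simp add: pow_sum_def)
qed

text \<open>The sum depends on the moduli only, so it is constant along rotations.\<close>

lemma inner_superpos_radial_pow_ii:
  assumes "p > 0"
  shows "inner (superpos (radial_pow p) Z) (cmul (- \<i>) Z) = 0"
  by (simp add: inner_l2_def coord_superpos_radial_pow[OF assms] radial_pow_def inner_complex_def algebra_simps)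

text \<open>The properties of the homogeneous force on which averaging relies. The force of the
  lattice is homogeneous of degree \<open>\<alpha> = p + 1\<close>.\<close>

locale averaging =
  fixes p \<kappa> :: real and f :: "real \<Rightarrow> real"
  assumes p: "p > 0" and \<kappa>: "\<kappa> \<ge> 0"
    and lip: "\<And>\<rho>. \<rho> \<ge> 0 \<Longrightarrow> (\<kappa> * \<rho> powr p)-lipschitz_on {-\<rho>..\<rho>} f"
    and hom: "\<And>r x. r \<ge> 0 \<Longrightarrow> f (r * x) = r powr (p + 1) * f x"
begin

lemma f0: "f 0 = 0"
  using hom[of 0 0] by simp

lemma coord_Re_bound: "norm Z \<le> \<sigma> \<Longrightarrow> coord Z n \<in> Re -` {-\<sigma>..\<sigma>}"
  using abs_Re_le_cmod[of "coord Z n"] norm_coord_le[of Z n] by auto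

text \<open>The part of the forcing of the difference variable that comes from the homogeneous force.\<close>

definition leading :: "l2 \<Rightarrow> l2" where
  "leading Z = bdiff (fdiff (superpos (on_Re f) Z))"

text \<open>Up to the factor \<open>p + 2\<close>, the leading part of the time derivative of \<open>pow_sum p\<close>.\<close>

definition resonant :: "l2 \<Rightarrow> real" where
  "resonant Z = inner (superpos (radial_pow p) Z) (cmul \<i> (leading Z))"

lemma leading_diff_le:
  assumes "norm Z \<le> \<sigma>" "norm Y \<le> \<sigma>"
  shows "norm (leading Z - leading Y) \<le> 4 * \<kappa> * \<sigma> powr p * norm (Z - Y)"
proof -
  have \<sigma>: "\<sigma> \<ge> 0" using assms norm_ge_zero[of Z] by linarith
  have "leading Z - leading Y = bdiff (fdiff (superpos (on_Re f) Z - superpos (on_Re f) Y))"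
    unfolding leading_def by (rule l2_eqI) simp
  then have "norm (leading Z - leading Y) \<le> 4 * norm (superpos (on_Re f) Z - superpos (on_Re f) Y)"
    using norm_bdiff_fdiff_le by metis
  also have "norm (superpos (on_Re f) Z - superpos (on_Re f) Y) \<le> \<kappa> * \<sigma> powr p * norm (Z - Y)"
    by (rule norm_superpos_diff_le[OF lipschitz_on_Re[OF lip[OF \<sigma>]]])
       (use assms \<sigma> f0 coord_Re_bound in \<open>auto simp: on_Re_def\<close>)
  finally show ?thesis by simp
qed

lemma leading_le:
  assumes "norm Z \<le> \<sigma>"
  shows "norm (leading Z) \<le> 4 * \<kappa> * \<sigma> powr p * norm Z"
proof -
  have \<sigma>: "\<sigma> \<ge> 0" using assms norm_ge_zero[of Z] by linarith
  have "coord (superpos (on_Re f) 0) n = on_Re f (coord 0 n)" for n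
    by (rule coord_superpos[OF lipschitz_on_Re[OF lip[OF \<sigma>]]])
       (use \<sigma> f0 in \<open>auto simp: on_Re_def\<close>)
  then have "leading 0 = 0"
    unfolding leading_def by (intro l2_eqI) (simp add: on_Re_def f0)
  with leading_diff_le[of Z \<sigma> 0] assms \<sigma> show ?thesis by simp
qed

text \<open>In orders of \<open>\<sigma>\<close>, the constant is \<open>\<sigma> powr (2 * \<alpha> - 1)\<close>: one factor \<open>\<sigma> powr p\<close> more than the
  size of \<open>superpos (radial_pow p) Z\<close>.\<close>

lemma resonant_diff_le:
  assumes "norm Z \<le> \<sigma>" "norm Y \<le> \<sigma>"
  shows "\<bar>resonant Z - resonant Y\<bar> \<le> 4 * \<kappa> * (p + 2) * (\<sigma> powr p * (\<sigma> powr p * \<sigma>)) * norm (Z - Y)"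
proof -
  have \<sigma>: "\<sigma> \<ge> 0" using assms norm_ge_zero[of Z] by linarith
  let ?w = "superpos (radial_pow p)"
  have c: "cmul \<i> A - cmul \<i> B = cmul \<i> (A - B)" for A B
    by (rule l2_eqI) (simp add: algebra_simps)
  have "resonant Z - resonant Y = inner (?w Z - ?w Y) (cmul \<i> (leading Z)) + inner (?w Y) (cmul \<i> (leading Z - leading Y))"
    by (simp add: resonant_def inner_diff_left inner_diff_right flip: c)
  also have "\<bar>\<dots>\<bar> \<le> norm (?w Z - ?w Y) * norm (leading Z) + norm (?w Y) * norm (leading Z - leading Y)"
    using Cauchy_Schwarz_ineq2[of "?w Z - ?w Y" "cmul \<i> (leading Z)"]
      Cauchy_Schwarz_ineq2[of "?w Y" "cmul \<i> (leading Z - leading Y)"] by simp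
  also have "\<dots> \<le> ((p + 1) * \<sigma> powr p * norm (Z - Y)) * (4 * \<kappa> * \<sigma> powr p * \<sigma>)
      + (\<sigma> powr p * \<sigma>) * (4 * \<kappa> * \<sigma> powr p * norm (Z - Y))"
  proof (intro add_mono mult_mono)
    have "\<sigma> powr p * norm Y \<le> \<sigma> powr p * \<sigma>" using assms by (intro mult_left_mono) auto
    then show "norm (?w Y) \<le> \<sigma> powr p * \<sigma>"
      using norm_superpos_radial_pow_le[OF p assms(2)] by linarith
    have "4 * \<kappa> * \<sigma> powr p * norm Z \<le> 4 * \<kappa> * \<sigma> powr p * \<sigma>" using assms \<kappa> by (intro mult_left_mono) auto
    then show "norm (leading Z) \<le> 4 * \<kappa> * \<sigma> powr p * \<sigma>"
      using leading_le[OF assms(1)] by linarith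
  qed (use norm_superpos_radial_pow_diff_le[OF p assms] leading_diff_le[OF assms] p \<kappa> \<sigma> in auto)
  also have "\<dots> = 4 * \<kappa> * (p + 2) * (\<sigma> powr p * (\<sigma> powr p * \<sigma>)) * norm (Z - Y)"
    by (simp add: algebra_simps)
  finally show ?thesis .
qed

lemma resonant_average: "((\<lambda>s. resonant (cmul (cis (- s)) U)) has_integral 0) {0..2 * pi}"
proof -
  have cont: "continuous_on UNIV f"
  proof (rule continuous_at_imp_continuous_on, rule ballI)
    fix x :: real
    let ?\<rho> = "\<bar>x\<bar> + 1"
    have "continuous_on {-?\<rho><..<?\<rho>} f"
      by (rule continuous_on_subset[OF lipschitz_on_continuous_on[OF lip[of ?\<rho>]]]) auto
    then show "isCont f x"
      by (rule continuous_on_interior) (auto simp: interior_open)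
  qed
  obtain c where "\<And>z. ((\<lambda>s. cis s * complex_of_real (f (Re (cis (- s) * z)))) has_integral c *\<^sub>R radial_pow p z) {0..2 * pi}"
    using circle_average[OF cont hom] by (simp only: add_diff_cancel) blast
  then show ?thesis
    unfolding resonant_def leading_def
    by (rule resonant_average_zero[OF _ lip]) (use f0 p in auto)
qed

text \<open>A curve that solves the rotation equation \<open>U' = - i U\<close> up to a forcing \<open>B\<close>, which equals the
  leading forcing up to an error \<open>b\<close>.\<close>

context
  fixes U B :: "real \<Rightarrow> l2" and \<sigma> b :: real
  assumes U: "\<And>t. t \<ge> 0 \<Longrightarrow> (U has_vector_derivative cmul (- \<i>) (U t) + cmul \<i> (B t)) (at t within {0..})"
    and \<sigma>: "\<And>t. t \<ge> 0 \<Longrightarrow> norm (U t) \<le> \<sigma>"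
    and b: "\<And>t. t \<ge> 0 \<Longrightarrow> norm (B t - leading (U t)) \<le> b"
begin

lemma sigma_nonneg: "\<sigma> \<ge> 0"
  using \<sigma>[of 0] norm_ge_zero[of "U 0"] by linarith

lemma norm_superpos_radial_pow_U: "t \<ge> 0 \<Longrightarrow> norm (superpos (radial_pow p) (U t)) \<le> \<sigma> powr p * \<sigma>"
  using norm_superpos_radial_pow_le[OF p \<sigma>, of t] mult_left_mono[OF \<sigma>, of t "\<sigma> powr p"] by simp

lemma norm_B_le:
  assumes "t \<ge> 0"
  shows "norm (B t) \<le> b + 4 * \<kappa> * (\<sigma> powr p * \<sigma>)"
proof -
  have "norm (leading (U t)) \<le> 4 * \<kappa> * \<sigma> powr p * norm (U t)" by (rule leading_le[OF \<sigma>[OF assms]])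
  also have "\<dots> \<le> 4 * \<kappa> * \<sigma> powr p * \<sigma>" using \<sigma>[OF assms] \<kappa> by (intro mult_left_mono) auto
  finally show ?thesis
    using b[OF assms] norm_triangle_ineq[of "B t - leading (U t)" "leading (U t)"] by (simp add: mult.assoc)
qed

lemma pow_sum_derivative:
  assumes "t \<ge> 0"
  shows "((\<lambda>t. pow_sum p (U t)) has_vector_derivative (p + 2) * inner (superpos (radial_pow p) (U t)) (cmul \<i> (B t))) (at t within {0..})"
proof -
  have "((\<lambda>s. pow_sum p (U s)) has_real_derivative
      (p + 2) * inner (superpos (radial_pow p) (U t)) (cmul (- \<i>) (U t) + cmul \<i> (B t))) (at t within {0..})"
    by (rule pow_sum_has_derivative[OF p U]) (use assms \<sigma> in auto)
  then show ?thesis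
    by (simp add: inner_add_right inner_superpos_radial_pow_ii[OF p] has_real_derivative_iff_has_vector_derivative)
qed

lemma pow_sum_drift:
  assumes "0 \<le> s" "s \<le> t"
  shows "\<bar>pow_sum p (U t) - pow_sum p (U s)\<bar>
    \<le> (p + 2) * ((\<sigma> powr p * \<sigma>) * (b + 4 * \<kappa> * (\<sigma> powr p * \<sigma>))) * (t - s)"
proof -
  have "norm (pow_sum p (U t) - pow_sum p (U s))
    \<le> ((p + 2) * ((\<sigma> powr p * \<sigma>) * (b + 4 * \<kappa> * (\<sigma> powr p * \<sigma>)))) * (t - s)"
  proof (rule norm_increment_le_linear[OF assms(2)])
    fix u assume u: "u \<in> {s..t}"
    then have "u \<ge> 0" using assms by auto
    show "((\<lambda>t. pow_sum p (U t)) has_vector_derivative (p + 2) * inner (superpos (radial_pow p) (U u)) (cmul \<i> (B u))) (at u within {s..t})"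
      by (rule has_vector_derivative_within_subset[OF pow_sum_derivative[OF \<open>u \<ge> 0\<close>]]) (use assms in auto)
    have "\<bar>inner (superpos (radial_pow p) (U u)) (cmul \<i> (B u))\<bar> \<le> norm (superpos (radial_pow p) (U u)) * norm (B u)"
      using Cauchy_Schwarz_ineq2[of "superpos (radial_pow p) (U u)" "cmul \<i> (B u)"] by simp
    also have "\<dots> \<le> (\<sigma> powr p * \<sigma>) * (b + 4 * \<kappa> * (\<sigma> powr p * \<sigma>))"
      by (intro mult_mono norm_superpos_radial_pow_U norm_B_le \<open>u \<ge> 0\<close>) (use sigma_nonneg in auto)
    finally show "norm ((p + 2) * inner (superpos (radial_pow p) (U u)) (cmul \<i> (B u)))
        \<le> (p + 2) * ((\<sigma> powr p * \<sigma>) * (b + 4 * \<kappa> * (\<sigma> powr p * \<sigma>)))"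
      using p by (simp add: abs_mult mult_left_mono)
  qed
  then show ?thesis by simp
qed

text \<open>Variation of constants: in the rotating frame only the forcing contributes to the derivative.\<close>

lemma deviation_from_rotation:
  assumes "t \<ge> 0" "s \<ge> 0"
  shows "norm (U (t + s) - cmul (cis (- s)) (U t)) \<le> (b + 4 * \<kappa> * (\<sigma> powr p * \<sigma>)) * s"
proof -
  let ?Y = "\<lambda>r. cmul (cis (r - t)) (U r)"
  have "norm (?Y (t + s) - ?Y t) \<le> (b + 4 * \<kappa> * (\<sigma> powr p * \<sigma>)) * (t + s - t)"
  proof (rule norm_increment_le_linear)
    fix r assume r: "r \<in> {t..t + s}"
    then have r0: "r \<ge> 0" using assms by auto
    have "((\<lambda>r. cis (r - t)) has_vector_derivative \<i> * cis (r - t)) (at r within {t..t + s})"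
      unfolding has_vector_derivative_def by (auto intro!: derivative_eq_intros)
    from bounded_bilinear.has_vector_derivative[OF bounded_bilinear_cmul this
        has_vector_derivative_within_subset[OF U[OF r0], of "{t..t + s}"]]
    have "(?Y has_vector_derivative cmul (cis (r - t)) (cmul (- \<i>) (U r) + cmul \<i> (B r)) + cmul (\<i> * cis (r - t)) (U r))
        (at r within {t..t + s})"
      using assms by auto
    moreover have "cmul (cis (r - t)) (cmul (- \<i>) (U r) + cmul \<i> (B r)) + cmul (\<i> * cis (r - t)) (U r)
        = cmul (cis (r - t) * \<i>) (B r)"
      by (rule l2_eqI) (simp add: algebra_simps)
    ultimately show "(?Y has_vector_derivative cmul (cis (r - t) * \<i>) (B r)) (at r within {t..t + s})" by simp
    show "norm (cmul (cis (r - t) * \<i>) (B r)) \<le> b + 4 * \<kappa> * (\<sigma> powr p * \<sigma>)"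
      using norm_B_le[OF r0] by (simp add: norm_mult)
  qed (use assms in auto)
  moreover have "U (t + s) - cmul (cis (- s)) (U t) = cmul (cis (- s)) (?Y (t + s) - ?Y t)"
    by (rule l2_eqI) (simp add: algebra_simps cis_mult flip: mult.assoc)
  ultimately show ?thesis by simp
qed

text \<open>The first summand accounts for the error \<open>b\<close> in the forcing, the second one for the deviation
  from a pure rotation, multiplied by the Lipschitz constant of \<open>resonant\<close>.\<close>

definition period_error :: real where
  "period_error = 2 * pi * (p + 2) * ((\<sigma> powr p * \<sigma>) * b
     + 4 * \<kappa> * (p + 2) * (\<sigma> powr p * (\<sigma> powr p * \<sigma>)) * ((b + 4 * \<kappa> * (\<sigma> powr p * \<sigma>)) * (2 * pi)))"

text \<open>The rate of change of \<open>pow_sum p (U (t + s))\<close> is compared with that along the rotation through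
  \<open>U t\<close>. Subtracting the integral of the latter, which vanishes over the period, leaves a quantity
  whose derivative is small.\<close>

lemma pow_sum_period:
  assumes "t \<ge> 0"
  shows "\<bar>pow_sum p (U (t + 2 * pi)) - pow_sum p (U t)\<bar> \<le> period_error"
proof -
  let ?R = "\<lambda>s. resonant (cmul (cis (- s)) (U t))"
  let ?\<beta> = "b + 4 * \<kappa> * (\<sigma> powr p * \<sigma>)"
  let ?c = "4 * \<kappa> * (p + 2) * (\<sigma> powr p * (\<sigma> powr p * \<sigma>))"
  have \<beta>: "?\<beta> \<ge> 0" using norm_B_le[OF assms] norm_ge_zero[of "B t"] by linarith
  have c: "?c \<ge> 0" using \<kappa> p sigma_nonneg by simp
  have "continuous_on {0..2*pi} ?R"
  proof (rule continuous_on_compose2[where g = resonant])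
    have "?c-lipschitz_on (cball 0 (norm (U t))) resonant"
    proof (rule lipschitz_onI)
      fix Z Y :: l2 assume "Z \<in> cball 0 (norm (U t))" "Y \<in> cball 0 (norm (U t))"
      then have "norm Z \<le> \<sigma>" "norm Y \<le> \<sigma>" using \<sigma>[OF assms] by auto
      then show "dist (resonant Z) (resonant Y) \<le> ?c * dist Z Y"
        using resonant_diff_le by (simp add: dist_norm)
    qed (rule c)
    then show "continuous_on (cball 0 (norm (U t))) resonant" by (rule lipschitz_on_continuous_on)
    show "continuous_on {0..2*pi} (\<lambda>s. cmul (cis (- s)) (U t))"
      by (intro continuous_on_cmul_cis continuous_intros)
  qed auto
  then have dR: "((\<lambda>s. integral {0..s} ?R) has_vector_derivative ?R s) (at s within {0..2*pi})" if "s \<in> {0..2*pi}" for s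
    using integral_has_vector_derivative that by blast
  let ?\<psi> = "\<lambda>s. pow_sum p (U (t + s)) - (p + 2) * integral {0..s} ?R"
  let ?d = "\<lambda>s. (p + 2) * inner (superpos (radial_pow p) (U (t + s))) (cmul \<i> (B (t + s))) - (p + 2) * ?R s"
  have "norm (?\<psi> (2 * pi) - ?\<psi> 0) \<le> ((p + 2) * ((\<sigma> powr p * \<sigma>) * b + ?c * (?\<beta> * (2 * pi)))) * (2 * pi - 0)"
  proof (rule norm_increment_le_linear)
    fix s :: real assume s: "s \<in> {0..2*pi}"
    then have ts: "t + s \<ge> 0" using assms by simp
    have "((\<lambda>s. t + s) has_vector_derivative 1) (at s within {0..2*pi})"
      by (auto intro!: derivative_eq_intros simp flip: has_real_derivative_iff_has_vector_derivative)
    from vector_diff_chain_within[OF this has_vector_derivative_within_subset[OF pow_sum_derivative[OF ts]]]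
    have "((\<lambda>s. pow_sum p (U (t + s))) has_vector_derivative
        (p + 2) * inner (superpos (radial_pow p) (U (t + s))) (cmul \<i> (B (t + s)))) (at s within {0..2*pi})"
      using assms by (auto simp: o_def)
    then show "(?\<psi> has_vector_derivative ?d s) (at s within {0..2*pi})"
      by (intro has_vector_derivative_diff has_vector_derivative_mult_right dR s)
    have i: "inner (superpos (radial_pow p) (U (t + s))) (cmul \<i> (B (t + s)))
        = inner (superpos (radial_pow p) (U (t + s))) (cmul \<i> (B (t + s) - leading (U (t + s)))) + resonant (U (t + s))"
    proof -
      have "cmul \<i> (B (t + s)) = cmul \<i> (B (t + s) - leading (U (t + s))) + cmul \<i> (leading (U (t + s)))"
        by (rule l2_eqI) (simp add: algebra_simps)
      then show ?thesis by (simp only: inner_add_right resonant_def)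
    qed
    have "\<bar>inner (superpos (radial_pow p) (U (t + s))) (cmul \<i> (B (t + s) - leading (U (t + s))))\<bar>
        \<le> norm (superpos (radial_pow p) (U (t + s))) * norm (B (t + s) - leading (U (t + s)))"
      using Cauchy_Schwarz_ineq2[of "superpos (radial_pow p) (U (t + s))" "cmul \<i> (B (t + s) - leading (U (t + s)))"] by simp
    also have "\<dots> \<le> (\<sigma> powr p * \<sigma>) * b"
      by (intro mult_mono norm_superpos_radial_pow_U b ts) (use sigma_nonneg in auto)
    finally have 1: "\<bar>inner (superpos (radial_pow p) (U (t + s))) (cmul \<i> (B (t + s) - leading (U (t + s))))\<bar> \<le> (\<sigma> powr p * \<sigma>) * b" .
    have "\<bar>resonant (U (t + s)) - ?R s\<bar> \<le> ?c * norm (U (t + s) - cmul (cis (- s)) (U t))"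
      by (rule resonant_diff_le) (use \<sigma>[OF ts] \<sigma>[OF assms] in auto)
    also have "\<dots> \<le> ?c * (?\<beta> * s)"
      using deviation_from_rotation[OF assms, of s] s by (intro mult_left_mono c) auto
    also have "\<dots> \<le> ?c * (?\<beta> * (2 * pi))"
      using s by (intro mult_left_mono c \<beta>) auto
    finally have 2: "\<bar>resonant (U (t + s)) - ?R s\<bar> \<le> ?c * (?\<beta> * (2 * pi))" .
    have "?d s = (p + 2) * (inner (superpos (radial_pow p) (U (t + s))) (cmul \<i> (B (t + s) - leading (U (t + s))))
        + (resonant (U (t + s)) - ?R s))"
      unfolding i by (simp only: right_diff_distrib distrib_left add_diff_eq)
    also have "norm \<dots> \<le> (p + 2) * ((\<sigma> powr p * \<sigma>) * b + ?c * (?\<beta> * (2 * pi)))"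
    proof -
      have "\<bar>x + y\<bar> \<le> X + Y" if "\<bar>x\<bar> \<le> X" "\<bar>y\<bar> \<le> Y" for x y X Y :: real using that by linarith
      from this[OF 1 2] show ?thesis using p unfolding real_norm_def abs_mult by (intro mult_mono) auto
    qed
    finally show "norm (?d s) \<le> (p + 2) * ((\<sigma> powr p * \<sigma>) * b + ?c * (?\<beta> * (2 * pi)))" .
  qed auto
  moreover have "integral {0..2*pi} ?R = 0"
    using resonant_average by (rule integral_unique)
  then have "?\<psi> (2 * pi) - ?\<psi> 0 = pow_sum p (U (t + 2 * pi)) - pow_sum p (U t)"
    by simp
  moreover have "period_error = ((p + 2) * ((\<sigma> powr p * \<sigma>) * b + ?c * (?\<beta> * (2 * pi)))) * (2 * pi - 0)"
    by (simp only: period_error_def diff_zero mult_ac)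
  ultimately show ?thesis
    by (simp only: real_norm_def)
qed

lemma pow_sum_periods: "\<bar>pow_sum p (U (2 * pi * real k)) - pow_sum p (U 0)\<bar> \<le> real k * period_error"
proof (induction k)
  case (Suc k)
  have "2 * pi * real (Suc k) = 2 * pi * real k + 2 * pi" by (simp add: algebra_simps)
  then have "\<bar>pow_sum p (U (2 * pi * real (Suc k))) - pow_sum p (U (2 * pi * real k))\<bar> \<le> period_error"
    using pow_sum_period[of "2 * pi * real k"] by simp
  then show ?case using Suc.IH by (simp add: algebra_simps)
qed simp

text \<open>Whole periods contribute second-order errors only; the remainder of the time interval is
  shorter than one period, where the first-order drift bound suffices.\<close>

lemma pow_sum_adiabatic:
  assumes "t \<ge> 0"
  shows "\<bar>pow_sum p (U t) - pow_sum p (U 0)\<bar> \<le> t * period_error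
    + (p + 2) * ((\<sigma> powr p * \<sigma>) * (b + 4 * \<kappa> * (\<sigma> powr p * \<sigma>))) * (2 * pi)"
proof -
  define k where "k = nat \<lfloor>t / (2 * pi)\<rfloor>"
  have "real k = of_int \<lfloor>t / (2 * pi)\<rfloor>" using assms by (simp add: k_def)
  then have "real k \<le> t / (2 * pi)" "t / (2 * pi) < real k + 1" by linarith+
  then have k: "2 * pi * real k \<le> t" "t - 2 * pi * real k \<le> 2 * pi"
    by (simp_all add: field_simps)
  have e: "period_error \<ge> 0" using pow_sum_period[of 0] by linarith
  have \<beta>: "b + 4 * \<kappa> * (\<sigma> powr p * \<sigma>) \<ge> 0" using norm_B_le[OF assms] norm_ge_zero[of "B t"] by linarith
  have "1 * real k \<le> 2 * pi * real k" using pi_gt3 by (intro mult_right_mono) auto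
  then have "real k \<le> t" using k(1) by simp
  then have "real k * period_error \<le> t * period_error" using e by (rule mult_right_mono)
  moreover have "\<bar>pow_sum p (U t) - pow_sum p (U (2 * pi * real k))\<bar>
      \<le> (p + 2) * ((\<sigma> powr p * \<sigma>) * (b + 4 * \<kappa> * (\<sigma> powr p * \<sigma>))) * (t - 2 * pi * real k)"
    by (rule pow_sum_drift) (use k in auto)
  moreover have "\<dots> \<le> (p + 2) * ((\<sigma> powr p * \<sigma>) * (b + 4 * \<kappa> * (\<sigma> powr p * \<sigma>))) * (2 * pi)"
    using p sigma_nonneg \<beta> by (intro mult_left_mono k(2)) auto
  ultimately show ?thesis using pow_sum_periods[of k] by linarith
qed

end

end

section \<open>The forces near the origin\<close>

lemma C2_derivatives:
  assumes "C2 f"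
  shows "(f has_real_derivative deriv f x) (at x)"
    and "(deriv f has_real_derivative deriv (deriv f) x) (at x)"
    and "continuous_on UNIV (deriv (deriv f))"
proof -
  have "f field_differentiable at x"
    using assms by (auto simp: C2_def differentiable_on_def real_differentiable_def field_differentiable_def)
  then show "(f has_real_derivative deriv f x) (at x)"
    by (simp add: DERIV_deriv_iff_field_differentiable)
  obtain D where D: "\<And>x. (deriv f has_vector_derivative D x) (at x)" "continuous_on UNIV D"
    using assms by (auto simp: C2_def C1_differentiable_on_def)
  then have D': "(deriv f has_real_derivative D x) (at x)" for x
    by (simp add: has_real_derivative_iff_has_vector_derivative)
  then have "deriv (deriv f) = D" by (auto intro: DERIV_imp_deriv)
  with D' D(2) show "(deriv f has_real_derivative deriv (deriv f) x) (at x)"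
    and "continuous_on UNIV (deriv (deriv f))" by auto
qed

lemma lipschitz_on_derivative_bound:
  fixes f :: "real \<Rightarrow> real"
  assumes "\<And>x. (f has_real_derivative f' x) (at x)" and "\<And>x. x \<in> {a..b} \<Longrightarrow> \<bar>f' x\<bar> \<le> K" and "K \<ge> 0"
  shows "K-lipschitz_on {a..b} f"
proof (rule lipschitz_onI)
  fix x y assume "x \<in> {a..b}" "y \<in> {a..b}"
  then have "norm (f x - f y) \<le> K * norm (x - y)"
    by (intro field_differentiable_bound[where S = "{a..b}" and f' = f'])
       (use assms in \<open>auto intro: has_field_derivative_at_within\<close>)
  then show "dist (f x) (f y) \<le> K * dist x y" by (simp add: dist_norm)
qed (rule assms(3))

lemma C2_deriv_lipschitz:
  assumes "C2 f"
  shows "\<exists>L. L-lipschitz_on {a..b} (deriv f)"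
proof -
  have "bounded (deriv (deriv f) ` {a..b})"
    by (intro compact_imp_bounded compact_continuous_image continuous_on_subset[OF C2_derivatives(3)[OF assms]]) auto
  then obtain K where "\<forall>x\<in>{a..b}. \<bar>deriv (deriv f) x\<bar> \<le> K" "K > 0"
    unfolding bounded_pos by auto
  then show ?thesis
    using lipschitz_on_derivative_bound[OF C2_derivatives(2)[OF assms], of a b K] by auto
qed

lemma C2_deriv_lipschitz_small:
  assumes "C2 f" and "deriv (deriv f) 0 = 0" and "K > 0"
  obtains r where "r > 0" "K-lipschitz_on {-r..r} (deriv f)"
proof -
  have "isCont (deriv (deriv f)) 0"
    using C2_derivatives(3)[OF assms(1)] by (simp add: continuous_on_eq_continuous_at)
  then obtain d where d: "d > 0" "\<And>x. \<bar>x\<bar> < d \<Longrightarrow> \<bar>deriv (deriv f) x\<bar> < K"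
    using assms(2,3) unfolding continuous_at_eps_delta by (auto simp: dist_norm)
  have "K-lipschitz_on {-(d/2)..d/2} (deriv f)"
  proof (rule lipschitz_on_derivative_bound[OF C2_derivatives(2)[OF assms(1)]])
    show "\<bar>deriv (deriv f) x\<bar> \<le> K" if "x \<in> {-(d/2)..d/2}" for x
    proof -
      have "\<bar>x\<bar> < d" using that d(1) by auto
      then show ?thesis using d(2)[of x] by simp
    qed
  qed (use assms in auto)
  with d(1) show thesis using that[of "d / 2"] by auto
qed

text \<open>The bound on the derivative holds away from \<open>0\<close> only, which is enough for the mean value theorem on
  either side of the origin.\<close>

lemma power_bound_of_derivative:
  fixes h :: "real \<Rightarrow> real"
  assumes cont: "continuous_on UNIV h" and diff: "\<And>x. x \<noteq> 0 \<Longrightarrow> h differentiable (at x)"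
    and "h 0 = 0" and "q > 0" and O: "deriv h \<in> O[at 0](\<lambda>r. \<bar>r\<bar> powr q)"
  obtains C r where "C \<ge> 0" "r > 0" "\<And>x. \<bar>x\<bar> \<le> r \<Longrightarrow> \<bar>h x\<bar> \<le> C * (\<bar>x\<bar> powr q * \<bar>x\<bar>)"
proof -
  obtain C where C: "C > 0" "\<forall>\<^sub>F x in at 0. norm (deriv h x) \<le> C * norm (\<bar>x\<bar> powr q)"
    using O by (rule landau_o.bigE)
  then obtain d where d: "d > 0" "\<And>x. x \<noteq> 0 \<Longrightarrow> \<bar>x\<bar> < d \<Longrightarrow> \<bar>deriv h x\<bar> \<le> C * \<bar>x\<bar> powr q"
    unfolding eventually_at by (auto simp: dist_norm)
  have "\<bar>h x\<bar> \<le> C * (\<bar>x\<bar> powr q * \<bar>x\<bar>)" if x: "\<bar>x\<bar> \<le> d / 2" for x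
  proof (cases "x = 0")
    case False
    have mvt: "\<exists>l z. a < z \<and> z < b \<and> (h has_real_derivative l) (at z) \<and> h b - h a = (b - a) * l"
      if "a < b" "0 \<le> a \<or> b \<le> 0" for a b
      by (rule MVT[OF that(1) continuous_on_subset[OF cont]]) (use that diff in auto)
    have "\<exists>l z. z \<noteq> 0 \<and> \<bar>z\<bar> \<le> \<bar>x\<bar> \<and> (h has_real_derivative l) (at z) \<and> \<bar>h x\<bar> = \<bar>x\<bar> * \<bar>l\<bar>"
    proof (cases "x > 0")
      case True
      from mvt[OF this] obtain l z where "0 < z" "z < x" "(h has_real_derivative l) (at z)" "h x - h 0 = (x - 0) * l"
        by auto
      then show ?thesis
        using \<open>h 0 = 0\<close> by (intro exI[of _ l] exI[of _ z]) (auto simp: abs_mult)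
    next
      case False
      with \<open>x \<noteq> 0\<close> have "x < 0" by simp
      from mvt[OF this] obtain l z where "x < z" "z < 0" "(h has_real_derivative l) (at z)" "h 0 - h x = (0 - x) * l"
        by auto
      then show ?thesis
        using \<open>h 0 = 0\<close> by (intro exI[of _ l] exI[of _ z]) (auto simp: abs_mult)
    qed
    then obtain l z where z: "z \<noteq> 0" "\<bar>z\<bar> \<le> \<bar>x\<bar>" "(h has_real_derivative l) (at z)" "\<bar>h x\<bar> = \<bar>x\<bar> * \<bar>l\<bar>"
      by blast
    have "\<bar>l\<bar> \<le> C * \<bar>z\<bar> powr q"
      using d(2)[of z] z x d(1) DERIV_imp_deriv[OF z(3)] by auto
    also have "\<dots> \<le> C * \<bar>x\<bar> powr q"
      using C z \<open>q > 0\<close> by (intro mult_left_mono powr_mono2) auto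
    finally have "\<bar>x\<bar> * \<bar>l\<bar> \<le> \<bar>x\<bar> * (C * \<bar>x\<bar> powr q)" by (intro mult_left_mono) auto
    then show ?thesis by (simp add: z(4) mult_ac)
  qed (simp add: \<open>h 0 = 0\<close>)
  then show thesis using that[of C "d / 2"] C d by auto
qed

lemma derivative_zero_of_power_bound:
  fixes h :: "real \<Rightarrow> real"
  assumes d: "(h has_real_derivative d) (at 0)" and "h 0 = 0" and "q > 0" and "r > 0"
    and b: "\<And>x. \<bar>x\<bar> \<le> r \<Longrightarrow> \<bar>h x\<bar> \<le> C * (\<bar>x\<bar> powr q * \<bar>x\<bar>)"
  shows "d = 0"
proof (rule tendsto_unique[of "at (0::real)"])
  show "((\<lambda>x. h x / x) \<longlongrightarrow> d) (at 0)"
    using d \<open>h 0 = 0\<close> by (simp add: has_field_derivative_iff)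
  have "((\<lambda>x. \<bar>x\<bar> powr q) \<longlongrightarrow> 0) (at (0::real))"
    by (rule tendsto_zero_powrI[where b = q]) (use \<open>q > 0\<close> in \<open>auto intro!: tendsto_eq_intros\<close>)
  then have l: "((\<lambda>x. C * \<bar>x\<bar> powr q) \<longlongrightarrow> 0) (at (0::real))"
    by (rule tendsto_mult_right_zero)
  show "((\<lambda>x. h x / x) \<longlongrightarrow> 0) (at 0)"
  proof (rule Lim_null_comparison[OF _ l])
    show "\<forall>\<^sub>F x in at 0. norm (h x / x) \<le> C * \<bar>x\<bar> powr q"
      unfolding eventually_at
    proof (intro exI[of _ r] conjI ballI impI)
      fix x :: real assume "x \<noteq> 0 \<and> dist x 0 < r"
      then show "norm (h x / x) \<le> C * \<bar>x\<bar> powr q"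
        using b[of x] by (simp add: abs_divide divide_le_eq mult.assoc)
    qed (use \<open>r > 0\<close> in auto)
  qed
qed auto

lemma power_force_differentiable:
  assumes "x \<noteq> 0"
  shows "power_force \<alpha> k_minus k_plus differentiable (at x)"
proof (cases "x > 0")
  case True
  have "((\<lambda>r. k_plus * (r powr (\<alpha> - 1) * r)) has_real_derivative
      k_plus * (((\<alpha> - 1) * x powr (\<alpha> - 1 - 1)) * x + 1 * x powr (\<alpha> - 1))) (at x)"
    by (intro DERIV_cmult DERIV_mult has_real_derivative_powr True DERIV_ident)
  then have "(power_force \<alpha> k_minus k_plus has_real_derivative
      k_plus * (((\<alpha> - 1) * x powr (\<alpha> - 1 - 1)) * x + 1 * x powr (\<alpha> - 1))) (at x)"
    by (rule has_field_derivative_transform_within_open[of _ _ _ "{0<..}"])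
       (use True in \<open>auto simp: power_force_def radial_pow_def\<close>)
  then show ?thesis by (auto simp: real_differentiable_def)
next
  case False
  then have x: "- x > 0" using assms by simp
  have "((\<lambda>r. (- r) powr (\<alpha> - 1)) has_real_derivative ((\<alpha> - 1) * (- x) powr (\<alpha> - 1 - 1)) * (- 1)) (at x)"
    by (rule DERIV_chain2[where f = "\<lambda>z. z powr (\<alpha> - 1)" and g = uminus, OF has_real_derivative_powr[OF x]]) (auto intro!: derivative_eq_intros)
  from DERIV_cmult[OF DERIV_mult[OF this DERIV_ident], of k_minus]
  obtain D where "((\<lambda>r. k_minus * ((- r) powr (\<alpha> - 1) * r)) has_real_derivative D) (at x)" by blast
  then have "(power_force \<alpha> k_minus k_plus has_real_derivative D) (at x)"
    by (rule has_field_derivative_transform_within_open[of _ _ _ "{..<0}"])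
       (use x in \<open>auto simp: power_force_def radial_pow_def\<close>)
  then show ?thesis by (auto simp: real_differentiable_def)
qed

lemma abs_power_force_le:
  assumes "\<alpha> > 1"
  shows "\<bar>power_force \<alpha> k_minus k_plus x\<bar> \<le> (\<bar>k_plus\<bar> + \<bar>k_minus\<bar>) * \<alpha> * (\<bar>x\<bar> powr (\<alpha> - 1) * \<bar>x\<bar>)"
proof -
  have x: "x \<in> {-\<bar>x\<bar>..\<bar>x\<bar>}" "0 \<in> {-\<bar>x\<bar>..\<bar>x\<bar>}" by auto
  show ?thesis
    using lipschitz_onD[OF lipschitz_on_power_force[OF assms abs_ge_zero] x, of k_minus k_plus]
    by (simp add: dist_norm mult.assoc)
qed

text \<open>The perturbation \<open>W'\<close> of the homogeneous force is of higher order at the origin, which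
  moreover forces \<open>V''(0) = 0\<close>.\<close>

lemma interaction_force_expansion:
  assumes "\<alpha> > 1" "\<beta> > 0" "C2 V" and V: "V = (\<lambda>r. V_pow \<alpha> k_minus k_plus r + W r)" and "deriv W 0 = 0"
    and O: "deriv (deriv W) \<in> O[at 0](\<lambda>r. \<bar>r\<bar> powr (\<alpha> - 1 + \<beta>))"
  obtains C r where "C \<ge> 0" "r > 0"
    "\<And>x. \<bar>x\<bar> \<le> r \<Longrightarrow> \<bar>deriv V x - power_force \<alpha> k_minus k_plus x\<bar> \<le> C * (\<bar>x\<bar> powr (\<alpha> - 1 + \<beta>) * \<bar>x\<bar>)"
    "deriv V 0 = 0" "deriv (deriv V) 0 = 0"
proof -
  let ?f = "power_force \<alpha> k_minus k_plus"
  have "(W has_real_derivative deriv V x - ?f x) (at x)" for x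
    using DERIV_diff[OF C2_derivatives(1)[OF \<open>C2 V\<close>, of x] V_pow_derivative[OF \<open>\<alpha> > 1\<close>, of k_minus k_plus x]]
    by (simp add: V)
  then have W: "deriv W = (\<lambda>x. deriv V x - ?f x)" by (auto intro: DERIV_imp_deriv)
  have V0: "deriv V 0 = 0" using \<open>deriv W 0 = 0\<close> by (simp add: W)
  have cV: "continuous_on UNIV (deriv V)"
    using C2_derivatives(2)[OF \<open>C2 V\<close>] by (meson DERIV_continuous_on has_field_derivative_at_within)
  have cf: "continuous_on UNIV ?f"
  proof (rule continuous_at_imp_continuous_on, rule ballI)
    fix x :: real
    have "continuous_on {-(\<bar>x\<bar> + 1)<..<\<bar>x\<bar> + 1} ?f"
      by (rule continuous_on_subset[OF lipschitz_on_continuous_on[OF lipschitz_on_power_force[OF \<open>\<alpha> > 1\<close>, of "\<bar>x\<bar> + 1"]]]) auto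
    then show "isCont ?f x" by (rule continuous_on_interior) (auto simp: interior_open)
  qed
  have "deriv W differentiable (at x)" if "x \<noteq> 0" for x
    unfolding W using C2_derivatives(2)[OF \<open>C2 V\<close>, of x] power_force_differentiable[OF that]
    by (intro differentiable_diff) (auto simp: real_differentiable_def)
  moreover have "continuous_on UNIV (deriv W)" unfolding W by (intro continuous_intros cV cf)
  moreover have "\<alpha> - 1 + \<beta> > 0" using assms by simp
  ultimately obtain C r where Cr: "C \<ge> 0" "r > 0" "\<And>x. \<bar>x\<bar> \<le> r \<Longrightarrow> \<bar>deriv W x\<bar> \<le> C * (\<bar>x\<bar> powr (\<alpha> - 1 + \<beta>) * \<bar>x\<bar>)"
    using power_bound_of_derivative[of "deriv W" "\<alpha> - 1 + \<beta>", OF _ _ \<open>deriv W 0 = 0\<close> _ O] by blast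
  have "deriv (deriv V) 0 = 0"
  proof (rule derivative_zero_of_power_bound[OF C2_derivatives(2)[OF \<open>C2 V\<close>] V0, of "\<alpha> - 1" "min r 1"])
    fix x :: real assume x: "\<bar>x\<bar> \<le> min r 1"
    have "\<bar>x\<bar> powr (\<alpha> - 1 + \<beta>) \<le> \<bar>x\<bar> powr (\<alpha> - 1)"
      using x assms by (intro powr_mono') auto
    then have "C * (\<bar>x\<bar> powr (\<alpha> - 1 + \<beta>) * \<bar>x\<bar>) \<le> C * (\<bar>x\<bar> powr (\<alpha> - 1) * \<bar>x\<bar>)"
      using Cr by (intro mult_left_mono mult_right_mono) auto
    moreover have "\<bar>deriv V x\<bar> \<le> \<bar>deriv W x\<bar> + \<bar>?f x\<bar>" by (simp add: W)
    ultimately have "\<bar>deriv V x\<bar> \<le> C * (\<bar>x\<bar> powr (\<alpha> - 1) * \<bar>x\<bar>)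
        + (\<bar>k_plus\<bar> + \<bar>k_minus\<bar>) * \<alpha> * (\<bar>x\<bar> powr (\<alpha> - 1) * \<bar>x\<bar>)"
      using Cr(3)[of x] x abs_power_force_le[OF \<open>\<alpha> > 1\<close>, of k_minus k_plus x] by simp
    then show "\<bar>deriv V x\<bar> \<le> (C + (\<bar>k_plus\<bar> + \<bar>k_minus\<bar>) * \<alpha>) * (\<bar>x\<bar> powr (\<alpha> - 1) * \<bar>x\<bar>)"
      by (simp only: distrib_right)
  qed (use assms Cr in auto)
  then show thesis using that[OF Cr(1,2) _ V0] Cr(3) by (simp add: W)
qed

lemma onsite_force_bound:
  assumes "q > 0" "C2 \<phi>" "deriv \<phi> 0 = 0" and O: "deriv (deriv \<phi>) \<in> O[at 0](\<lambda>x. \<bar>x\<bar> powr q)"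
  obtains C r where "C \<ge> 0" "r > 0" "\<And>x. \<bar>x\<bar> \<le> r \<Longrightarrow> \<bar>deriv \<phi> x\<bar> \<le> C * (\<bar>x\<bar> powr q * \<bar>x\<bar>)"
    "deriv (deriv \<phi>) 0 = 0"
proof -
  have "continuous_on UNIV (deriv \<phi>)"
    using C2_derivatives(2)[OF \<open>C2 \<phi>\<close>] by (meson DERIV_continuous_on has_field_derivative_at_within)
  moreover have "deriv \<phi> differentiable (at x)" for x
    using C2_derivatives(2)[OF \<open>C2 \<phi>\<close>, of x] by (auto simp: real_differentiable_def)
  ultimately obtain C r where Cr: "C \<ge> 0" "r > 0" "\<And>x. \<bar>x\<bar> \<le> r \<Longrightarrow> \<bar>deriv \<phi> x\<bar> \<le> C * (\<bar>x\<bar> powr q * \<bar>x\<bar>)"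
    using power_bound_of_derivative[of "deriv \<phi>" q, OF _ _ \<open>deriv \<phi> 0 = 0\<close> \<open>q > 0\<close> O] by blast
  moreover have "deriv (deriv \<phi>) 0 = 0"
    by (rule derivative_zero_of_power_bound[OF C2_derivatives(2)[OF \<open>C2 \<phi>\<close>] \<open>deriv \<phi> 0 = 0\<close> \<open>q > 0\<close> Cr(2,3)])
  ultimately show thesis using that by blast
qed

section \<open>Existence and uniqueness of solutions\<close>

text \<open>Composing a force with this truncation makes a Lipschitz bound near the origin global.\<close>

definition clamp_to :: "real \<Rightarrow> real \<Rightarrow> real" where
  "clamp_to r x = max (- r) (min r x)"

lemma lipschitz_on_clamped:
  assumes "K-lipschitz_on {-r..r} f" "r \<ge> 0"
  shows "K-lipschitz_on UNIV (\<lambda>x. f (clamp_to r x))"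
proof (rule lipschitz_onI)
  fix x y
  have "dist (f (clamp_to r x)) (f (clamp_to r y)) \<le> K * dist (clamp_to r x) (clamp_to r y)"
    by (rule lipschitz_onD[OF assms(1)]) (use assms(2) in \<open>auto simp: clamp_to_def\<close>)
  also have "\<dots> \<le> K * dist x y"
    using lipschitz_on_nonneg[OF assms(1)]
    by (intro mult_left_mono) (auto simp: clamp_to_def dist_real_def)
  finally show "dist (f (clamp_to r x)) (f (clamp_to r y)) \<le> K * dist x y" .
qed (rule lipschitz_on_nonneg[OF assms(1)])

lemma superpos_cong: "(\<And>n. g (coord Z n) = h (coord Z n)) \<Longrightarrow> superpos g Z = superpos h Z"
  by (simp add: superpos_def)

lemma abs_Re_coord_le: "\<bar>Re (coord Z n)\<bar> \<le> norm Z"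
  using abs_Re_le_cmod[of "coord Z n"] norm_coord_le[of Z n] by linarith

text \<open>The equation with truncated forces has a global solution. The energy bound keeps this solution,
  and its differences, in the region where the truncation does nothing, so it solves the original
  equation.\<close>

lemma lattice_flow_exists:
  assumes f: "K-lipschitz_on {-r..r} f" "f 0 = 0" and g: "K-lipschitz_on {-r..r} g" "g 0 = 0"
    and K: "10 * K < 1" "1 + 10 * K \<le> c\<^sup>2 * (1 - 10 * K)" and "c \<ge> 0" and r: "2 * (c * norm Z0) \<le> r"
  obtains Z where "Z 0 = Z0" "\<And>t. t \<ge> 0 \<Longrightarrow> (Z has_vector_derivative lattice_field f g (Z t)) (at t within {0..})"
    "\<And>t. t \<ge> 0 \<Longrightarrow> norm (Z t) \<le> c * norm Z0"
proof -
  have r0: "r \<ge> 0" using r \<open>c \<ge> 0\<close> by (meson mult_nonneg_nonneg norm_ge_zero order_trans zero_le_numeral)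
  let ?f = "\<lambda>x. f (clamp_to r x)" and ?g = "\<lambda>x. g (clamp_to r x)"
  have z: "?f 0 = 0" "?g 0 = 0" using f g r0 by (simp_all add: clamp_to_def)
  have lf: "K-lipschitz_on UNIV ?f" and lg: "K-lipschitz_on UNIV ?g"
    using f g r0 by (auto intro: lipschitz_on_clamped)
  have "(1 + 5 * K)-lipschitz_on UNIV (lattice_field ?f ?g)"
    by (rule lipschitz_lattice_field[OF lf z(1) lg z(2)]) auto
  from lipschitz_ode_exists[OF this, of Z0] obtain Z where Z: "Z 0 = Z0"
    "\<And>t. t \<ge> 0 \<Longrightarrow> (Z has_vector_derivative lattice_field ?f ?g (Z t)) (at t within {0..})" by blast
  have b: "norm (Z t) \<le> c * norm Z0" if t: "t \<ge> 0" for t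
  proof (rule power2_le_imp_le)
    have "(1 - 10 * K) * (norm (Z t))\<^sup>2 \<le> (1 + 10 * K) * (norm Z0)\<^sup>2"
      using energy_bound[OF lf z(1) lg z(2) Z(2) t] Z(1) by simp
    also have "\<dots> \<le> (c\<^sup>2 * (1 - 10 * K)) * (norm Z0)\<^sup>2"
      by (intro mult_right_mono K) auto
    finally have "(1 - 10 * K) * (norm (Z t))\<^sup>2 \<le> (1 - 10 * K) * (c * norm Z0)\<^sup>2"
      by (simp add: power_mult_distrib mult_ac)
    then show "(norm (Z t))\<^sup>2 \<le> (c * norm Z0)\<^sup>2" using K by simp
  qed (use \<open>c \<ge> 0\<close> in simp)
  have eq: "lattice_field ?f ?g (Z t) = lattice_field f g (Z t)" if t: "t \<ge> 0" for t
  proof -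
    have cl: "clamp_to r x = x" if "\<bar>x\<bar> \<le> r" for x using that by (simp add: clamp_to_def)
    have "norm (bdiff (Z t)) \<le> r" using norm_bdiff_le[of "Z t"] b[OF t] r by linarith
    then have 1: "\<bar>Re (coord (bdiff (Z t)) n)\<bar> \<le> r" for n
      using abs_Re_coord_le[of "bdiff (Z t)" n] by linarith
    have 2: "\<bar>Re (coord (Z t) n)\<bar> \<le> r" for n
      using abs_Re_coord_le[of "Z t" n] b[OF t] r norm_ge_zero[of "Z t"] by linarith
    have "superpos (on_Re ?f) (bdiff (Z t)) = superpos (on_Re f) (bdiff (Z t))"
      by (rule superpos_cong) (simp only: on_Re_def cl[OF 1])
    moreover have "superpos (on_Re ?g) (Z t) = superpos (on_Re g) (Z t)"
      by (rule superpos_cong) (simp only: on_Re_def cl[OF 2])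
    ultimately show ?thesis by (simp only: lattice_field_def)
  qed
  show thesis using that[of Z] Z b eq by simp
qed

text \<open>Two solutions on a compact time interval stay in a common ball, where the field is Lipschitz.\<close>

lemma lattice_flow_unique:
  assumes f: "\<And>B. \<exists>L. L-lipschitz_on {-B..B} f" "f 0 = 0" and g: "\<And>B. \<exists>L. L-lipschitz_on {-B..B} g" "g 0 = 0"
    and X: "\<And>t. t \<in> {0..T} \<Longrightarrow> (X has_vector_derivative lattice_field f g (X t)) (at t within {0..T})"
    and Y: "\<And>t. t \<in> {0..T} \<Longrightarrow> (Y has_vector_derivative lattice_field f g (Y t)) (at t within {0..T})"
    and "X 0 = Y 0" and t: "t \<in> {0..T}"
  shows "X t = Y t"
proof -
  have bounded: "\<exists>B. \<forall>t\<in>{0..T}. norm (W t) \<le> B"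
    if "\<And>t. t \<in> {0..T} \<Longrightarrow> (W has_vector_derivative lattice_field f g (W t)) (at t within {0..T})" for W
  proof -
    have "continuous_on {0..T} W"
      using that by (meson continuous_on_eq_continuous_within has_vector_derivative_continuous)
    then have "bounded (W ` {0..T})" by (intro compact_imp_bounded compact_continuous_image) auto
    then show ?thesis by (auto simp: bounded_iff)
  qed
  obtain B1 where B1: "\<And>t. t \<in> {0..T} \<Longrightarrow> norm (X t) \<le> B1" using bounded[OF X] by blast
  obtain B2 where B2: "\<And>t. t \<in> {0..T} \<Longrightarrow> norm (Y t) \<le> B2" using bounded[OF Y] by blast
  define B where "B = max B1 B2"
  have B: "norm (X s) \<le> B" "norm (Y s) \<le> B" if "s \<in> {0..T}" for s
    using B1[OF that] B2[OF that] by (auto simp: B_def)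
  have "B \<ge> 0" using B(1)[OF t] norm_ge_zero[of "X t"] by linarith
  obtain Lf where Lf: "Lf-lipschitz_on {-(2*B)..2*B} f" using f(1) by blast
  obtain Lg where Lg: "Lg-lipschitz_on {-(2*B)..2*B} g" using g(1) by blast
  have "(1 + 5 * max Lf Lg)-lipschitz_on (cball 0 B) (lattice_field f g)"
  proof (rule lipschitz_lattice_field[where f = f and g = g, OF _ f(2) _ g(2)])
    show "(max Lf Lg)-lipschitz_on {-(2*B)..2*B} f" "(max Lf Lg)-lipschitz_on {-(2*B)..2*B} g"
      by (rule lipschitz_on_le[OF Lf] lipschitz_on_le[OF Lg], simp)+
    fix Z :: l2 and n assume "Z \<in> cball 0 B"
    then have "\<bar>Re (coord (bdiff Z) n)\<bar> \<le> 2 * B" "\<bar>Re (coord Z n)\<bar> \<le> 2 * B"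
      using abs_Re_coord_le[of "bdiff Z" n] abs_Re_coord_le[of Z n] norm_bdiff_le[of Z] \<open>B \<ge> 0\<close> by auto
    then show "Re (coord (bdiff Z) n) \<in> {-(2*B)..2*B} \<and> Re (coord Z n) \<in> {-(2*B)..2*B}"
      by (simp add: abs_le_iff)
  qed (use \<open>B \<ge> 0\<close> in simp)
  then show ?thesis
    by (rule lipschitz_ode_unique[OF _ X Y _ \<open>X 0 = Y 0\<close> t]) (use B in auto)
qed

section \<open>Complex sequences as pairs of real sequences\<close>

definition to_pair :: "l2 \<Rightarrow> seq_pair" where
  "to_pair Z = (\<lambda>n. Re (coord Z n), \<lambda>n. Im (coord Z n))"

definition of_pair :: "seq_pair \<Rightarrow> l2" where
  "of_pair X = Abs_l2 (\<lambda>n. Complex (fst X n) (snd X n))"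

lemma to_pair_in_l2_pairs: "to_pair Z \<in> l2_pairs"
proof -
  have "(\<lambda>n. (norm (Re (coord Z n)))\<^sup>2) summable_on UNIV" "(\<lambda>n. (norm (Im (coord Z n)))\<^sup>2) summable_on UNIV"
    by (rule square_summable_dominated[OF summable_coord[of Z], where K = 1],
        simp add: abs_Re_le_cmod abs_Im_le_cmod)+
  then show ?thesis by (simp add: l2_pairs_def to_pair_def)
qed

lemma to_pair_of_pair:
  assumes "X \<in> l2_pairs"
  shows "to_pair (of_pair X) = X"
proof -
  have "(\<lambda>n. (norm (Complex (fst X n) (snd X n)))\<^sup>2) summable_on UNIV"
    using assms by (simp add: l2_pairs_def cmod_power2 summable_on_add)
  then have "coord (of_pair X) n = Complex (fst X n) (snd X n)" for n
    by (simp add: of_pair_def Abs_l2_inverse)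
  then show ?thesis by (simp add: to_pair_def)
qed

lemma to_pair_inject: "to_pair Z = to_pair Y \<Longrightarrow> Z = Y"
  by (rule l2_eqI) (simp add: to_pair_def fun_eq_iff complex_eq_iff)

lemma norm_q_to_pair: "q > 0 \<Longrightarrow> norm_q q (to_pair Z) = (\<Sum>\<^sub>\<infinity>n. norm (coord Z n) powr q) powr (1 / q)"
  by (simp add: norm_q_def to_pair_def cmod_def powr_powr flip: powr_half_sqrt)

lemma norm_q_2_to_pair [simp]: "norm_q 2 (to_pair Z) = norm Z"
proof -
  have "norm_q 2 (to_pair Z) = (\<Sum>\<^sub>\<infinity>n. norm (coord Z n) powr 2) powr (1 / 2)"
    by (rule norm_q_to_pair) simp
  also have "(\<Sum>\<^sub>\<infinity>n. norm (coord Z n) powr 2) = (norm Z)\<^sup>2"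
    by (simp add: norm_l2_power2)
  finally show ?thesis by (simp add: powr_half_sqrt)
qed

lemma to_pair_scale: "seq_scale c (to_pair Z) = to_pair (c *\<^sub>R Z)"
  by (simp add: seq_scale_def to_pair_def)

lemma to_pair_diff: "to_pair Z - to_pair Y = to_pair (Z - Y)"
  by (simp add: to_pair_def fun_diff_def)

lemma has_l2_derivative_iff:
  assumes X: "\<And>s. s \<in> S \<Longrightarrow> X s = to_pair (Z s)" and t: "t \<in> S"
  shows "has_l2_derivative X (to_pair D) t S \<longleftrightarrow> (Z has_vector_derivative D) (at t within S)"
proof -
  have "((\<lambda>s. norm_q 2 (seq_scale (1 / (s - t)) (X s - X t) - to_pair D)) \<longlongrightarrow> 0) (at t within S)
      \<longleftrightarrow> ((\<lambda>s. norm ((Z s - Z t) - (s - t) *\<^sub>R D) / norm (s - t)) \<longlongrightarrow> 0) (at t within S)"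
  proof (rule tendsto_cong)
    show "\<forall>\<^sub>F s in at t within S. norm_q 2 (seq_scale (1 / (s - t)) (X s - X t) - to_pair D)
        = norm ((Z s - Z t) - (s - t) *\<^sub>R D) / norm (s - t)"
      unfolding eventually_at_filter
    proof (intro always_eventually allI impI)
      fix s assume s: "s \<noteq> t" "s \<in> S"
      have "norm_q 2 (seq_scale (1 / (s - t)) (X s - X t) - to_pair D) = norm ((1 / (s - t)) *\<^sub>R (Z s - Z t) - D)"
        by (simp add: X s t to_pair_diff to_pair_scale)
      also have "(1 / (s - t)) *\<^sub>R (Z s - Z t) - D = (1 / (s - t)) *\<^sub>R ((Z s - Z t) - (s - t) *\<^sub>R D)"
        using s by (simp add: scaleR_diff_right)
      finally show "norm_q 2 (seq_scale (1 / (s - t)) (X s - X t) - to_pair D)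
        = norm ((Z s - Z t) - (s - t) *\<^sub>R D) / norm (s - t)" by simp
    qed
  qed
  then show ?thesis
    by (simp add: has_l2_derivative_def X to_pair_in_l2_pairs has_vector_derivative_def has_derivative_iff_norm
        bounded_linear_scaleR_left)
qed

lemma lattice_field_to_pair:
  assumes f: "\<And>B. \<exists>L. L-lipschitz_on {-B..B} (deriv V)" "deriv V 0 = 0"
    and g: "\<And>B. \<exists>L. L-lipschitz_on {-B..B} (deriv \<phi>)" "deriv \<phi> 0 = 0"
  shows "J_lattice (to_pair Z) + G_lattice V \<phi> (to_pair Z) = to_pair (lattice_field (deriv V) (deriv \<phi>) Z)"
proof -
  have c: "coord (superpos (on_Re h) Y) n = complex_of_real (h (Re (coord Y n)))"
    if h: "\<And>B. \<exists>L. L-lipschitz_on {-B..B} h" "h 0 = 0" for h :: "real \<Rightarrow> real" and Y n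
  proof -
    obtain L where L: "L-lipschitz_on {-norm Y..norm Y} h" using h(1) by blast
    have "coord (superpos (on_Re h) Y) n = on_Re h (coord Y n)"
    proof (rule coord_superpos[OF lipschitz_on_Re[OF L]])
      show "coord Y n \<in> Re -` {-norm Y..norm Y}" for n
        using abs_Re_coord_le[of Y n] by (simp add: abs_le_iff)
    qed (use h in \<open>auto simp: on_Re_def\<close>)
    then show ?thesis by (simp add: on_Re_def)
  qed
  show ?thesis
    by (simp add: J_lattice_def G_lattice_def F_lattice_def to_pair_def lattice_field_def delta_plus_def delta_minus_def
        c[OF f] c[OF g] plus_fun_def fun_diff_def fun_eq_iff)
qed

lemma lattice_solution_iff:
  assumes "\<And>B. \<exists>L. L-lipschitz_on {-B..B} (deriv V)" "deriv V 0 = 0"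
    and "\<And>B. \<exists>L. L-lipschitz_on {-B..B} (deriv \<phi>)" "deriv \<phi> 0 = 0"
    and X: "\<And>s. s \<in> S \<Longrightarrow> X s = to_pair (Z s)"
  shows "lattice_solution V \<phi> X S \<longleftrightarrow>
    (\<forall>t\<in>S. (Z has_vector_derivative lattice_field (deriv V) (deriv \<phi>) (Z t)) (at t within S))"
  unfolding lattice_solution_def
  using has_l2_derivative_iff[of S X Z, OF X]
  by (auto simp: X lattice_field_to_pair[OF assms(1-4)] to_pair_in_l2_pairs)

lemma norm_coord_le_norm_inf: "norm (coord Z n) \<le> norm_inf (to_pair Z)"
proof -
  have "norm_inf (to_pair Z) = (SUP n. norm (coord Z n))"
    by (simp add: norm_inf_def to_pair_def cmod_def)
  moreover have "bdd_above (range (\<lambda>n. norm (coord Z n)))"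
    by (rule bdd_aboveI2[where M = "norm Z"]) (rule norm_coord_le)
  ultimately show ?thesis
    using cSUP_upper[of n UNIV "\<lambda>n. norm (coord Z n)"] by simp
qed

section \<open>Drift of the adiabatic invariant along lattice solutions\<close>

lemma averaging_power_force:
  assumes "\<alpha> > 1"
  shows "averaging (\<alpha> - 1) ((\<bar>k_plus\<bar> + \<bar>k_minus\<bar>) * \<alpha>) (power_force \<alpha> k_minus k_plus)"
  by unfold_locales
     (use assms in \<open>auto simp: power_force_homogeneous intro: lipschitz_on_power_force\<close>)

lemma bdiff_lattice_field:
  "bdiff (lattice_field f g Z) = cmul (- \<i>) (bdiff Z)
    + cmul \<i> (bdiff (fdiff (superpos (on_Re f) (bdiff Z))) - bdiff (superpos (on_Re g) Z))"
  by (rule l2_eqI) (simp add: lattice_field_def algebra_simps)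

context averaging
begin

text \<open>The factor \<open>6 = 4 + 2\<close> collects the operator norms of \<open>bdiff \<circ> fdiff\<close>, which acts on the interaction
  force, and of \<open>bdiff\<close>, which acts on the on-site force.\<close>

lemma force_remainder_le:
  assumes g: "\<And>x. \<bar>x\<bar> \<le> \<sigma> \<Longrightarrow> \<bar>h x - f x\<bar> \<le> D * \<bar>x\<bar>" "\<And>x. \<bar>x\<bar> \<le> \<sigma> \<Longrightarrow> \<bar>g x\<bar> \<le> D * \<bar>x\<bar>"
    and "D \<ge> 0" and h: "L-lipschitz_on {-\<sigma>..\<sigma>} h" "h 0 = 0"
    and Z: "norm Z \<le> \<sigma>" "norm (bdiff Z) \<le> \<sigma>"
  shows "norm ((bdiff (fdiff (superpos (on_Re h) (bdiff Z))) - bdiff (superpos (on_Re g) Z)) - leading (bdiff Z)) \<le> 6 * D * \<sigma>"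
proof -
  let ?U = "bdiff Z"
  have \<sigma>: "\<sigma> \<ge> 0" using Z norm_ge_zero[of Z] by linarith
  have Re_le: "\<bar>Re (coord Y n)\<bar> \<le> \<sigma>" if "norm Y \<le> \<sigma>" for Y n
    using abs_Re_coord_le[of Y n] that by linarith
  have c: "coord (superpos (on_Re k) ?U) n = on_Re k (coord ?U n)"
    if "K-lipschitz_on {-\<sigma>..\<sigma>} k" "k 0 = 0" for k K n
    by (rule coord_superpos[OF lipschitz_on_Re[OF that(1)]])
       (use that \<sigma> coord_Re_bound[OF Z(2)] in \<open>auto simp: on_Re_def\<close>)
  have "norm (superpos (on_Re h) ?U - superpos (on_Re f) ?U) \<le> D * norm ?U"
  proof (rule norm_l2_mono)
    fix n
    have "norm (coord (superpos (on_Re h) ?U - superpos (on_Re f) ?U) n)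
        = \<bar>h (Re (coord ?U n)) - f (Re (coord ?U n))\<bar>"
      by (simp only: coord_diff c[OF h] c[OF lip[OF \<sigma>] f0] on_Re_def norm_of_real flip: of_real_diff)
    also have "\<dots> \<le> D * \<bar>Re (coord ?U n)\<bar>" by (rule g(1)[OF Re_le[OF Z(2)]])
    also have "\<dots> \<le> D * norm (coord ?U n)" by (intro mult_left_mono abs_Re_le_cmod \<open>D \<ge> 0\<close>)
    finally show "norm (coord (superpos (on_Re h) ?U - superpos (on_Re f) ?U) n) \<le> D * norm (coord ?U n)" .
  qed (rule \<open>D \<ge> 0\<close>)
  also have "\<dots> \<le> D * \<sigma>" by (intro mult_left_mono Z \<open>D \<ge> 0\<close>)
  finally have 1: "norm (superpos (on_Re h) ?U - superpos (on_Re f) ?U) \<le> D * \<sigma>" .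
  have "norm (superpos (on_Re g) Z) \<le> D * norm Z"
  proof (rule norm_superpos_le[OF \<open>D \<ge> 0\<close>])
    fix n
    have "norm (on_Re g (coord Z n)) = \<bar>g (Re (coord Z n))\<bar>" by (simp add: on_Re_def)
    also have "\<dots> \<le> D * \<bar>Re (coord Z n)\<bar>" by (rule g(2)[OF Re_le[OF Z(1)]])
    also have "\<dots> \<le> D * norm (coord Z n)" by (intro mult_left_mono abs_Re_le_cmod \<open>D \<ge> 0\<close>)
    finally show "norm (on_Re g (coord Z n)) \<le> D * norm (coord Z n)" .
  qed
  also have "\<dots> \<le> D * \<sigma>" by (intro mult_left_mono Z \<open>D \<ge> 0\<close>)
  finally have 2: "norm (superpos (on_Re g) Z) \<le> D * \<sigma>" .
  have "(bdiff (fdiff (superpos (on_Re h) ?U)) - bdiff (superpos (on_Re g) Z)) - leading ?U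
      = bdiff (fdiff (superpos (on_Re h) ?U - superpos (on_Re f) ?U)) - bdiff (superpos (on_Re g) Z)"
    unfolding leading_def by (rule l2_eqI) simp
  also have "norm \<dots> \<le> norm (bdiff (fdiff (superpos (on_Re h) ?U - superpos (on_Re f) ?U))) + norm (bdiff (superpos (on_Re g) Z))"
    by (rule norm_triangle_ineq4)
  also have "\<dots> \<le> 4 * (D * \<sigma>) + 2 * (D * \<sigma>)"
    using norm_bdiff_fdiff_le[of "superpos (on_Re h) ?U - superpos (on_Re f) ?U"]
      norm_bdiff_le[of "superpos (on_Re g) Z"] 1 2 by linarith
  finally show ?thesis by simp
qed

text \<open>The quantity \<open>(\<sigma> powr p * \<sigma>)\<^sup>2\<close> is the size of the rate of change. The summand \<open>1\<close> in the last factor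
  stems from the last, incomplete period, where there is no cancellation; over complete periods the
  cancellation gains the factor \<open>\<sigma> powr \<eta>\<close>. The deviation from a rotation gains even \<open>\<sigma> powr p\<close>, which
  is where \<open>\<eta> \<le> p\<close> enters.\<close>

lemma pow_sum_almost_conserved:
  assumes C: "C \<ge> 0" and \<eta>: "0 < \<eta>" "\<eta> \<le> p" and \<sigma>: "0 < \<sigma>" "\<sigma> \<le> 1"
    and h: "\<And>x. \<bar>x\<bar> \<le> \<sigma> \<Longrightarrow> \<bar>h x - f x\<bar> \<le> C * (\<bar>x\<bar> powr (p + \<eta>) * \<bar>x\<bar>)" "L-lipschitz_on {-\<sigma>..\<sigma>} h" "h 0 = 0"
    and g: "\<And>x. \<bar>x\<bar> \<le> \<sigma> \<Longrightarrow> \<bar>g x\<bar> \<le> C * (\<bar>x\<bar> powr (p + \<eta>) * \<bar>x\<bar>)"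
    and Z: "\<And>t. t \<ge> 0 \<Longrightarrow> (Z has_vector_derivative lattice_field h g (Z t)) (at t within {0..})"
    and b: "\<And>t. t \<ge> 0 \<Longrightarrow> 2 * norm (Z t) \<le> \<sigma>" and t: "t \<ge> 0"
  shows "\<bar>pow_sum p (bdiff (Z t)) - pow_sum p (bdiff (Z 0))\<bar>
    \<le> 2 * pi * (p + 2) * (6 * C + 4 * \<kappa>) * (2 + 8 * pi * \<kappa> * (p + 2)) * (\<sigma> powr p * \<sigma>)\<^sup>2 * (1 + t * \<sigma> powr \<eta>)"
proof -
  define s where "s = \<sigma> powr p"
  define m where "m = \<sigma> powr \<eta>"
  define D where "D = C * (s * m)"
  have s: "0 \<le> s" "s \<le> m" and m: "0 \<le> m" "m \<le> 1"
    using \<sigma> \<eta> by (auto simp: s_def m_def intro: powr_mono' powr_le1)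
  have D0: "D \<ge> 0" using C s m by (simp add: D_def)
  have Dx: "C * (\<bar>x\<bar> powr (p + \<eta>) * \<bar>x\<bar>) \<le> D * \<bar>x\<bar>" if "\<bar>x\<bar> \<le> \<sigma>" for x
  proof -
    have "\<bar>x\<bar> powr (p + \<eta>) \<le> \<sigma> powr (p + \<eta>)" using that p \<eta> by (intro powr_mono2) auto
    then have "C * (\<bar>x\<bar> powr (p + \<eta>) * \<bar>x\<bar>) \<le> C * (\<sigma> powr (p + \<eta>) * \<bar>x\<bar>)"
      using C by (intro mult_left_mono mult_right_mono) auto
    then show ?thesis by (simp add: D_def s_def m_def powr_add mult.assoc)
  qed
  let ?B = "\<lambda>t. bdiff (fdiff (superpos (on_Re h) (bdiff (Z t)))) - bdiff (superpos (on_Re g) (Z t))"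
  let ?U = "\<lambda>t. bdiff (Z t)"
  have dU: "(?U has_vector_derivative cmul (- \<i>) (?U t) + cmul \<i> (?B t)) (at t within {0..})" if "t \<ge> 0" for t
    unfolding bdiff_lattice_field[symmetric]
    by (rule bounded_linear.has_vector_derivative[OF bounded_linear_bdiff Z[OF that]])
  have U\<sigma>: "norm (?U t) \<le> \<sigma>" if "t \<ge> 0" for t
    using norm_bdiff_le[of "Z t"] b[OF that] by linarith
  have Z\<sigma>: "norm (Z t) \<le> \<sigma>" if "t \<ge> 0" for t
    using b[OF that] norm_ge_zero[of "Z t"] by linarith
  have B: "norm (?B t - leading (?U t)) \<le> 6 * D * \<sigma>" if "t \<ge> 0" for t
    by (rule force_remainder_le[OF _ _ D0 h(2,3) Z\<sigma>[OF that] U\<sigma>[OF that]])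
       (use h(1) g Dx in \<open>fastforce intro: order_trans\<close>)+
  have "\<bar>pow_sum p (?U t) - pow_sum p (?U 0)\<bar>
      \<le> t * period_error \<sigma> (6 * D * \<sigma>) + (p + 2) * ((s * \<sigma>) * (6 * D * \<sigma> + 4 * \<kappa> * (s * \<sigma>))) * (2 * pi)"
    unfolding s_def by (rule pow_sum_adiabatic[where U = ?U, OF dU U\<sigma> B t])
  also have "\<dots> \<le> 2 * pi * (p + 2) * (6 * C + 4 * \<kappa>) * (2 + 8 * pi * \<kappa> * (p + 2)) * (s * \<sigma>)\<^sup>2 * (1 + t * m)"
  proof -
    let ?E = "6 * C + 4 * \<kappa>"
    have E: "?E \<ge> 0" using C \<kappa> by simp
    have 1: "6 * D * \<sigma> + 4 * \<kappa> * (s * \<sigma>) \<le> ?E * (s * \<sigma>)"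
    proof -
      have "C * (s * m) * \<sigma> \<le> C * (s * 1) * \<sigma>" using C s m \<sigma> by (intro mult_left_mono mult_right_mono) auto
      then show ?thesis by (simp add: D_def algebra_simps)
    qed
    have 2: "(p + 2) * ((s * \<sigma>) * (6 * D * \<sigma> + 4 * \<kappa> * (s * \<sigma>))) * (2 * pi) \<le> 2 * pi * (p + 2) * ?E * (s * \<sigma>)\<^sup>2"
    proof -
      have "(s * \<sigma>) * (6 * D * \<sigma> + 4 * \<kappa> * (s * \<sigma>)) \<le> (s * \<sigma>) * (?E * (s * \<sigma>))"
        using 1 s \<sigma> by (intro mult_left_mono) auto
      then have "(p + 2) * ((s * \<sigma>) * (6 * D * \<sigma> + 4 * \<kappa> * (s * \<sigma>))) * (2 * pi) \<le> (p + 2) * ((s * \<sigma>) * (?E * (s * \<sigma>))) * (2 * pi)"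
        by (rule mult_right_mono[OF mult_left_mono]) (use p in auto)
      then show ?thesis by (simp only: power2_eq_square mult_ac)
    qed
    have 3: "period_error \<sigma> (6 * D * \<sigma>) \<le> 2 * pi * (p + 2) * ?E * (1 + 8 * pi * \<kappa> * (p + 2)) * (s * \<sigma>)\<^sup>2 * m"
    proof -
      have a: "(s * \<sigma>) * (6 * D * \<sigma>) \<le> ?E * (s * \<sigma>)\<^sup>2 * m"
      proof -
        have "(s * \<sigma>) * (6 * D * \<sigma>) = (6 * C) * ((s * \<sigma>)\<^sup>2 * m)"
          by (simp add: D_def power2_eq_square mult_ac)
        also have "\<dots> \<le> ?E * ((s * \<sigma>)\<^sup>2 * m)" using \<kappa> m by (intro mult_right_mono) auto
        finally show ?thesis by (simp add: mult.assoc)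
      qed
      have "(s * (s * \<sigma>)) * (6 * D * \<sigma> + 4 * \<kappa> * (s * \<sigma>)) \<le> (m * (s * \<sigma>)) * (?E * (s * \<sigma>))"
        by (intro mult_mono 1) (use s m \<sigma> E D0 \<kappa> in auto)
      then have "4 * \<kappa> * (p + 2) * (2 * pi) * ((s * (s * \<sigma>)) * (6 * D * \<sigma> + 4 * \<kappa> * (s * \<sigma>)))
          \<le> 4 * \<kappa> * (p + 2) * (2 * pi) * ((m * (s * \<sigma>)) * (?E * (s * \<sigma>)))"
        using \<kappa> p by (intro mult_left_mono) auto
      also have "\<dots> = ?E * (8 * pi * \<kappa> * (p + 2)) * (s * \<sigma>)\<^sup>2 * m"
        by (simp add: power2_eq_square mult_ac)
      finally have c: "4 * \<kappa> * (p + 2) * (s * (s * \<sigma>)) * ((6 * D * \<sigma> + 4 * \<kappa> * (s * \<sigma>)) * (2 * pi))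
          \<le> ?E * (8 * pi * \<kappa> * (p + 2)) * (s * \<sigma>)\<^sup>2 * m"
        by (simp only: mult_ac)
      have "period_error \<sigma> (6 * D * \<sigma>) = 2 * pi * (p + 2) * ((s * \<sigma>) * (6 * D * \<sigma>)
          + 4 * \<kappa> * (p + 2) * (s * (s * \<sigma>)) * ((6 * D * \<sigma> + 4 * \<kappa> * (s * \<sigma>)) * (2 * pi)))"
        unfolding s_def by (rule period_error_def[OF dU U\<sigma> B])
      also have "\<dots> \<le> 2 * pi * (p + 2) * (?E * (s * \<sigma>)\<^sup>2 * m + ?E * (8 * pi * \<kappa> * (p + 2)) * (s * \<sigma>)\<^sup>2 * m)"
        using p by (intro mult_left_mono add_mono a c) auto
      finally show ?thesis by (simp add: algebra_simps)
    qed
    let ?P = "2 * pi * (p + 2) * ?E" and ?q = "8 * pi * \<kappa> * (p + 2)"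
    have P: "?P \<ge> 0" and q: "?q \<ge> 0" using p E \<kappa> by auto
    have "t * period_error \<sigma> (6 * D * \<sigma>) \<le> t * (?P * (1 + ?q) * (s * \<sigma>)\<^sup>2 * m)"
      by (rule mult_left_mono[OF 3 t])
    also have "\<dots> = (?P * (s * \<sigma>)\<^sup>2) * ((1 + ?q) * (t * m))" by (simp only: mult_ac)
    finally have 4: "t * period_error \<sigma> (6 * D * \<sigma>) \<le> (?P * (s * \<sigma>)\<^sup>2) * ((1 + ?q) * (t * m))" .
    have "t * period_error \<sigma> (6 * D * \<sigma>) + (p + 2) * ((s * \<sigma>) * (6 * D * \<sigma> + 4 * \<kappa> * (s * \<sigma>))) * (2 * pi)
        \<le> (?P * (s * \<sigma>)\<^sup>2) * ((1 + ?q) * (t * m)) + (?P * (s * \<sigma>)\<^sup>2) * 1"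
      using add_mono[OF 4 2] by (simp only: mult_1_right)
    also have "\<dots> = (?P * (s * \<sigma>)\<^sup>2) * ((1 + ?q) * (t * m) + 1)" by (simp only: distrib_left)
    also have "\<dots> \<le> (?P * (s * \<sigma>)\<^sup>2) * ((2 + ?q) * (1 + t * m))"
    proof (rule mult_left_mono)
      have "t * m \<ge> 0" using t m by simp
      then show "(1 + ?q) * (t * m) + 1 \<le> (2 + ?q) * (1 + t * m)" using q by (simp add: algebra_simps)
    qed (use P in simp)
    finally show ?thesis by (simp only: mult_ac)
  qed
  finally show ?thesis by (simp only: s_def m_def)
qed

end

section \<open>The lower bound\<close>

text \<open>Interpolation between the supremum and the square-summation norm.\<close>

lemma pow_sum_le_sup:
  assumes "p > 0"
  shows "pow_sum p (bdiff Z) \<le> (2 * norm_inf (to_pair Z)) powr p * (4 * (norm Z)\<^sup>2)"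
proof -
  let ?x = "norm_inf (to_pair Z)" and ?U = "bdiff Z"
  have split: "norm z powr (p + 2) = norm z powr p * (norm z)\<^sup>2" for z :: complex
    by (cases "z = 0") (simp_all add: powr_add)
  have u: "norm (coord ?U n) \<le> 2 * ?x" for n
    using norm_triangle_ineq4[of "coord Z n" "coord Z (n - 1)"] norm_coord_le_norm_inf[of Z n]
      norm_coord_le_norm_inf[of Z "n - 1"] by simp
  have le: "norm (coord ?U n) powr (p + 2) \<le> (2 * ?x) powr p * (norm (coord ?U n))\<^sup>2" for n
    unfolding split using assms u by (intro mult_right_mono powr_mono2) auto
  have s: "(\<lambda>n. (2 * ?x) powr p * (norm (coord ?U n))\<^sup>2) summable_on UNIV"
    by (intro summable_on_cmult_right summable_coord)
  have "pow_sum p ?U \<le> (\<Sum>\<^sub>\<infinity>n. (2 * ?x) powr p * (norm (coord ?U n))\<^sup>2)"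
    unfolding pow_sum_def lattice_sum_def
    by (rule infsum_mono[OF summable_on_comparison_test[OF s le] s le]) simp
  also have "\<dots> = (2 * ?x) powr p * (norm ?U)\<^sup>2"
    by (simp add: infsum_cmult_right' norm_l2_power2)
  also have "\<dots> \<le> (2 * ?x) powr p * (2 * norm Z)\<^sup>2"
    by (intro mult_left_mono power_mono norm_bdiff_le) auto
  finally show ?thesis by (simp add: power_mult_distrib)
qed

text \<open>The factor \<open>1 / 2\<close> in the lower bound allows a total loss of \<open>2 powr p = q * q\<close> in the chain of
  inequalities. One factor \<open>q\<close> is granted to the decrease of \<open>pow_sum\<close>, the other one to the growth of
  the squared norm.\<close>

lemma norm_inf_lower_bound:
  assumes p: "p > 0" and \<iota>: "\<iota> > 0" and \<epsilon>: "\<epsilon> > 0" and q: "q = 2 powr (p / 2)"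
    and N: "(\<iota> * \<epsilon>) powr (p + 2) / q \<le> pow_sum p (bdiff Z)" and Z: "(norm Z)\<^sup>2 \<le> q * \<epsilon>\<^sup>2"
  shows "1 / 2 * (1 / 2 * \<iota>) powr ((p + 2) / p) * \<epsilon> \<le> norm_inf (to_pair Z)"
proof (rule ccontr)
  let ?x = "norm_inf (to_pair Z)" and ?y = "1 / 2 * (1 / 2 * \<iota>) powr ((p + 2) / p) * \<epsilon>"
  assume "\<not> ?y \<le> ?x"
  then have lt: "?x < ?y" by simp
  have x: "?x \<ge> 0" using norm_coord_le_norm_inf[of Z 0] norm_ge_zero[of "coord Z 0"] by linarith
  have q0: "q > 0" by (simp add: q)
  have qq: "q * q = 2 powr p" by (simp add: q flip: powr_add)
  have "(2 * ?x) powr p < (2 * ?y) powr p"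
    using lt x p by (intro powr_less_mono2) auto
  also have "\<dots> = (1 / 2 * \<iota>) powr (p + 2) * \<epsilon> powr p"
    using p \<iota> \<epsilon> by (simp add: powr_mult powr_powr)
  finally have 1: "(2 * ?x) powr p < (1 / 2 * \<iota>) powr (p + 2) * \<epsilon> powr p" .
  have "(\<iota> * \<epsilon>) powr (p + 2) / q \<le> (2 * ?x) powr p * (4 * (norm Z)\<^sup>2)"
    using N pow_sum_le_sup[OF p, of Z] by linarith
  also have "\<dots> \<le> (2 * ?x) powr p * (4 * (q * \<epsilon>\<^sup>2))"
    using Z by (intro mult_left_mono) auto
  also have "\<dots> < ((1 / 2 * \<iota>) powr (p + 2) * \<epsilon> powr p) * (4 * (q * \<epsilon>\<^sup>2))"
    using 1 q0 \<epsilon> by (intro mult_strict_right_mono) auto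
  finally have "(\<iota> * \<epsilon>) powr (p + 2) < ((1 / 2 * \<iota>) powr (p + 2) * \<epsilon> powr p) * (4 * (q * \<epsilon>\<^sup>2)) * q"
    using q0 by (simp add: divide_less_eq)
  also have "\<dots> = (1 / 2) powr (p + 2) * (4 * (q * q)) * (\<iota> powr (p + 2) * (\<epsilon> powr p * \<epsilon>\<^sup>2))"
    using \<iota> by (simp only: powr_mult mult_ac)
  also have "4 * (q * q) = 2 powr (p + 2)" by (simp add: qq powr_add)
  also have "\<epsilon> powr p * \<epsilon>\<^sup>2 = \<epsilon> powr (p + 2)" using \<epsilon> by (simp add: powr_add)
  also have "(1 / 2) powr (p + 2) * 2 powr (p + 2) = (1::real)" by (simp flip: powr_mult)
  finally show False using \<iota> \<epsilon> by (simp add: powr_mult)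
qed

lemma pow_sum_ge_quotient:
  assumes "p > 0" and \<iota>: "\<iota> \<ge> 0" and \<epsilon>: "norm Z > 0" and Q: "\<iota> \<le> Q_quot (p + 1) (to_pair Z)"
  shows "(\<iota> * norm Z) powr (p + 2) \<le> pow_sum p (bdiff Z)"
proof -
  let ?S = "pow_sum p (bdiff Z)"
  have pair: "(delta_plus (fst (to_pair Z)), delta_plus (snd (to_pair Z))) = to_pair (fdiff Z)"
    by (simp add: to_pair_def delta_plus_def fun_eq_iff)
  have "(\<Sum>\<^sub>\<infinity>n. norm (coord (fdiff Z) n) powr (p + 2)) = ?S"
    unfolding pow_sum_def lattice_sum_def
    by (rule infsum_reindex_bij_witness[where j = "\<lambda>n. n + 1" and i = "\<lambda>n. n - 1"]) auto
  moreover have "norm_q (p + 2) (to_pair (fdiff Z)) = (\<Sum>\<^sub>\<infinity>n. norm (coord (fdiff Z) n) powr (p + 2)) powr (1 / (p + 2))"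
    by (rule norm_q_to_pair) (use \<open>p > 0\<close> in simp)
  ultimately have "\<iota> \<le> ?S powr (1 / (p + 2)) / norm Z"
    using Q unfolding Q_quot_def pair norm_q_2_to_pair by (simp only: add.assoc one_add_one)
  then have "\<iota> * norm Z \<le> ?S powr (1 / (p + 2))" using \<epsilon> by (simp add: le_divide_eq)
  then have "(\<iota> * norm Z) powr (p + 2) \<le> (?S powr (1 / (p + 2))) powr (p + 2)"
    using \<open>p > 0\<close> \<iota> by (intro powr_mono2) auto
  also have "\<dots> = ?S"
  proof -
    have "?S \<ge> 0" unfolding pow_sum_def lattice_sum_def by (rule infsum_nonneg) simp
    then show ?thesis using \<open>p > 0\<close> by (simp add: powr_powr)
  qed
  finally show ?thesis .
qed

text \<open>The logarithm is absorbed by half of the power: \<open>|ln x| * x powr \<eta> \<le> (2 / \<eta>) * x powr (\<eta> / 2)\<close>.\<close>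

lemma log_power_small:
  fixes A B p \<eta> \<delta> :: real
  assumes "p > 0" "\<eta> > 0" "\<delta> > 0"
  obtains e where "e > 0" "\<And>x. 0 < x \<Longrightarrow> x \<le> e \<Longrightarrow> A * (x powr p + B * (\<bar>ln x\<bar> * x powr \<eta>)) \<le> \<delta>"
proof -
  have tp: "((\<lambda>x. x powr a) \<longlongrightarrow> 0) (at_right (0::real))" if "a > 0" for a
    by (rule tendsto_zero_powrI[where b = a]) (use that in \<open>auto intro!: tendsto_eq_intros simp: eventually_at_filter\<close>)
  have tl: "((\<lambda>x. \<bar>ln x\<bar> * x powr \<eta>) \<longlongrightarrow> 0) (at_right (0::real))"
  proof (rule Lim_null_comparison)
    show "((\<lambda>x. (2 / \<eta>) * x powr (\<eta> / 2)) \<longlongrightarrow> 0) (at_right (0::real))"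
      by (rule tendsto_mult_right_zero[OF tp]) (use \<open>\<eta> > 0\<close> in simp)
    have "norm (\<bar>ln x\<bar> * x powr \<eta>) \<le> (2 / \<eta>) * x powr (\<eta> / 2)" if x: "0 < x" "x < 1" for x
    proof -
      have "\<bar>ln x\<bar> = ln (1 / x)" using x by (simp add: ln_div)
      also have "\<dots> \<le> (1 / x) powr (\<eta> / 2) / (\<eta> / 2)"
        by (rule ln_powr_bound) (use x \<open>\<eta> > 0\<close> in auto)
      also have "\<dots> = (2 / \<eta>) * x powr (- (\<eta> / 2))" using x by (simp add: powr_minus_divide powr_divide)
      finally have "\<bar>ln x\<bar> * x powr \<eta> \<le> ((2 / \<eta>) * x powr (- (\<eta> / 2))) * x powr \<eta>"
        by (intro mult_right_mono) auto
      also have "\<dots> = (2 / \<eta>) * x powr (\<eta> / 2)" by (simp add: mult.assoc flip: powr_add)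
      finally show ?thesis by simp
    qed
    then show "\<forall>\<^sub>F x in at_right 0. norm (\<bar>ln x\<bar> * x powr \<eta>) \<le> (2 / \<eta>) * x powr (\<eta> / 2)"
      unfolding eventually_at_right_field by (intro exI[of _ 1]) auto
  qed
  have "((\<lambda>x. A * (x powr p + B * (\<bar>ln x\<bar> * x powr \<eta>))) \<longlongrightarrow> A * (0 + B * 0)) (at_right 0)"
    by (intro tendsto_intros tp tl) (use assms in auto)
  then have "\<forall>\<^sub>F x in at_right 0. A * (x powr p + B * (\<bar>ln x\<bar> * x powr \<eta>)) < \<delta>"
    by (rule order_tendstoD) (use \<open>\<delta> > 0\<close> in simp)
  then obtain b where b: "b > 0" "\<And>x. 0 < x \<Longrightarrow> x < b \<Longrightarrow> A * (x powr p + B * (\<bar>ln x\<bar> * x powr \<eta>)) < \<delta>"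
    unfolding eventually_at_right_field by auto
  show thesis
  proof (rule that[of "b / 2"])
    fix x assume "0 < x" "x \<le> b / 2"
    then show "A * (x powr p + B * (\<bar>ln x\<bar> * x powr \<eta>)) \<le> \<delta>"
      using b(2)[of x] b(1) by simp
  qed (use b in simp)
qed

lemma I_const_le_Q_quot:
  assumes "X \<in> C" "X \<noteq> 0"
  shows "I_const \<alpha> C \<le> Q_quot \<alpha> X"
  unfolding I_const_def
proof (rule cInf_lower)
  show "bdd_below {Q_quot \<alpha> X | X. X \<in> C \<and> X \<noteq> 0}"
    by (rule bdd_belowI[of _ 0]) (auto simp: Q_quot_def norm_q_def)
  show "Q_quot \<alpha> X \<in> {Q_quot \<alpha> X | X. X \<in> C \<and> X \<noteq> 0}" using assms by blast
qed

theorem proposition2p23: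
  fixes \<alpha> k_minus k_plus \<beta> \<gamma> \<eta> :: real and V W \<phi> :: "real \<Rightarrow> real"
  assumes "\<alpha> > 1" and "(k_minus, k_plus) \<noteq> (0, 0)" and "\<beta> > 0" and "\<gamma> > 0"
    and "C2 V" and "V = (\<lambda>r. V_pow \<alpha> k_minus k_plus r + W r)"
    and "deriv W 0 = 0"
    and "deriv (deriv W) \<in> O[at 0](\<lambda>r. \<bar>r\<bar> powr (\<alpha> - 1 + \<beta>))"
    and "C2 \<phi>" and "deriv \<phi> 0 = 0"
    and "deriv (deriv \<phi>) \<in> O[at 0](\<lambda>x. \<bar>x\<bar> powr (\<alpha> - 1 + \<gamma>))"
    and "\<eta> = Min {\<alpha> - 1, \<beta>, \<gamma>}"
  shows "\<exists>\<nu>>0. \<forall>\<mu>\<in>{0<..<\<eta>}. \<forall>\<iota>>0. \<exists>\<epsilon>\<^sub>1>0.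
           \<forall>C. C \<subseteq> l2_pairs \<and> I_const \<alpha> C = \<iota> \<longrightarrow>
             (\<forall>\<epsilon>\<in>{0<..\<epsilon>\<^sub>1}. \<forall>X\<^sub>0\<in>C. norm_q 2 X\<^sub>0 = \<epsilon> \<longrightarrow>
               (let T = \<mu> * \<nu> * \<bar>ln \<epsilon>\<bar> * \<epsilon> powr (1 - \<alpha>);
                    M = 1 / 2 * (1 / 2 * I_const \<alpha> C) powr ((\<alpha> + 1) / (\<alpha> - 1))
                in \<exists>X. lattice_solution V \<phi> X {0..T} \<and> X 0 = X\<^sub>0 \<and>
                     (\<forall>Y. lattice_solution V \<phi> Y {0..T} \<and> Y 0 = X\<^sub>0
                            \<longrightarrow> (\<forall>t\<in>{0..T}. Y t = X t)) \<and>
                     (\<forall>t\<in>{0..T}. norm_inf (X t) \<ge> M * \<epsilon>)))"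
proof -
  define p where "p = \<alpha> - 1"
  have p: "p > 0" and \<alpha>: "\<alpha> = p + 1" using \<open>\<alpha> > 1\<close> by (auto simp: p_def)
  have \<eta>: "0 < \<eta>" "\<eta> \<le> p" "\<eta> \<le> \<beta>" "\<eta> \<le> \<gamma>" using assms by (auto simp: p_def)
  let ?f = "power_force \<alpha> k_minus k_plus"
  define \<kappa> where "\<kappa> = (\<bar>k_plus\<bar> + \<bar>k_minus\<bar>) * \<alpha>"
  interpret averaging p \<kappa> ?f
    unfolding p_def \<kappa>_def by (rule averaging_power_force[OF \<open>\<alpha> > 1\<close>])
  obtain Cv rv where v: "Cv \<ge> 0" "rv > 0"
    "\<And>x. \<bar>x\<bar> \<le> rv \<Longrightarrow> \<bar>deriv V x - ?f x\<bar> \<le> Cv * (\<bar>x\<bar> powr (\<alpha> - 1 + \<beta>) * \<bar>x\<bar>)"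
    and V0: "deriv V 0 = 0" "deriv (deriv V) 0 = 0"
    using interaction_force_expansion[OF assms(1,3,5-8)] by blast
  obtain Cf rf where ph: "Cf \<ge> 0" "rf > 0"
    "\<And>x. \<bar>x\<bar> \<le> rf \<Longrightarrow> \<bar>deriv \<phi> x\<bar> \<le> Cf * (\<bar>x\<bar> powr (\<alpha> - 1 + \<gamma>) * \<bar>x\<bar>)"
    and \<phi>0: "deriv (deriv \<phi>) 0 = 0"
    using onsite_force_bound[OF _ assms(9-11)] assms(1,4) by auto
  define C where "C = max Cv Cf"
  have C: "C \<ge> 0" using v by (simp add: C_def)
  \<comment> \<open>The square root of the total loss that the factor \<open>1 / 2\<close> in \<open>M\<close> permits.\<close>
  define q where "q = 2 powr (p / 2)"
  have "q > 1" using p by (simp add: q_def)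
  \<comment> \<open>The cap \<open>4\<close> keeps the solution below \<open>2 * \<epsilon>\<close>.\<close>
  define q' where "q' = min q 4"
  have q': "1 < q'" "q' \<le> q" "q' \<le> 4" using \<open>q > 1\<close> by (auto simp: q'_def)
  \<comment> \<open>Forces with this Lipschitz constant change the squared norm at most by the factor \<open>q'\<close>.\<close>
  define K where "K = (q' - 1) / (10 * (q' + 1))"
  have K: "K > 0" "10 * K < 1" "1 + 10 * K \<le> (sqrt q')\<^sup>2 * (1 - 10 * K)"
    using q' by (auto simp: K_def field_simps)
  obtain ra where ra: "ra > 0" "K-lipschitz_on {-ra..ra} (deriv V)"
    using C2_deriv_lipschitz_small[OF \<open>C2 V\<close> V0(2) K(1)] by blast
  obtain rb where rb: "rb > 0" "K-lipschitz_on {-rb..rb} (deriv \<phi>)"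
    using C2_deriv_lipschitz_small[OF \<open>C2 \<phi>\<close> \<phi>0 K(1)] by blast
  \<comment> \<open>The bound \<open>1\<close> lets larger exponents be replaced by \<open>p + \<eta>\<close>.\<close>
  define r where "r = Min {rv, rf, ra, rb, 1}"
  have r: "r > 0" "r \<le> rv" "r \<le> rf" "r \<le> ra" "r \<le> rb" "r \<le> 1"
    using v ph ra rb by (auto simp: r_def)
  have lV: "K-lipschitz_on {-r..r} (deriv V)" and l\<phi>: "K-lipschitz_on {-r..r} (deriv \<phi>)"
    using r by (auto intro: lipschitz_on_subset[OF ra(2)] lipschitz_on_subset[OF rb(2)])
  have weaken: "Cx * (\<bar>x\<bar> powr (\<alpha> - 1 + \<zeta>) * \<bar>x\<bar>) \<le> C * (\<bar>x\<bar> powr (p + \<eta>) * \<bar>x\<bar>)"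
    if "\<bar>x\<bar> \<le> r" "0 \<le> Cx" "Cx \<le> C" "\<eta> \<le> \<zeta>" for x Cx \<zeta>
    using that r p \<eta> by (intro mult_mono powr_mono') (auto simp: p_def)
  have bV: "\<bar>deriv V x - ?f x\<bar> \<le> C * (\<bar>x\<bar> powr (p + \<eta>) * \<bar>x\<bar>)" if "\<bar>x\<bar> \<le> r" for x
    using v(3)[of x] weaken[OF that v(1), of \<beta>] r \<eta> that by (simp add: C_def)
  have b\<phi>: "\<bar>deriv \<phi> x\<bar> \<le> C * (\<bar>x\<bar> powr (p + \<eta>) * \<bar>x\<bar>)" if "\<bar>x\<bar> \<le> r" for x
    using ph(3)[of x] weaken[OF that ph(1), of \<gamma>] r \<eta> that by (simp add: C_def)
  have locV: "\<exists>L. L-lipschitz_on {-B..B} (deriv V)" and loc\<phi>: "\<exists>L. L-lipschitz_on {-B..B} (deriv \<phi>)" for B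
    using C2_deriv_lipschitz assms by blast+
  define A where "A = 2 * pi * (p + 2) * (6 * C + 4 * \<kappa>) * (2 + 8 * pi * \<kappa> * (p + 2))"
  have A: "A \<ge> 0" using p \<kappa> C by (simp add: A_def)
  show ?thesis
  proof (rule exI[of _ 1], intro conjI ballI allI impI)
    fix \<mu> \<iota> :: real assume \<mu>: "\<mu> \<in> {0<..<\<eta>}" and \<iota>: "\<iota> > 0"
    have \<delta>: "(1 - 1 / q) * \<iota> powr (p + 2) > 0" using \<open>q > 1\<close> \<iota> by simp
    obtain e where e: "e > 0" "\<And>x. 0 < x \<Longrightarrow> x \<le> e \<Longrightarrow>
        A * (4 powr p * 4)\<^sup>2 * (x powr p + \<mu> * 4 powr \<eta> * (\<bar>ln x\<bar> * x powr \<eta>)) \<le> (1 - 1 / q) * \<iota> powr (p + 2)"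
      using log_power_small[OF p \<eta>(1) \<delta>] by metis
    show "\<exists>\<epsilon>\<^sub>1>0.
           \<forall>C. C \<subseteq> l2_pairs \<and> I_const \<alpha> C = \<iota> \<longrightarrow>
             (\<forall>\<epsilon>\<in>{0<..\<epsilon>\<^sub>1}. \<forall>X\<^sub>0\<in>C. norm_q 2 X\<^sub>0 = \<epsilon> \<longrightarrow>
               (let T = \<mu> * 1 * \<bar>ln \<epsilon>\<bar> * \<epsilon> powr (1 - \<alpha>);
                    M = 1 / 2 * (1 / 2 * I_const \<alpha> C) powr ((\<alpha> + 1) / (\<alpha> - 1))
                in \<exists>X. lattice_solution V \<phi> X {0..T} \<and> X 0 = X\<^sub>0 \<and>
                     (\<forall>Y. lattice_solution V \<phi> Y {0..T} \<and> Y 0 = X\<^sub>0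
                            \<longrightarrow> (\<forall>t\<in>{0..T}. Y t = X t)) \<and>
                     (\<forall>t\<in>{0..T}. norm_inf (X t) \<ge> M * \<epsilon>)))"
      unfolding Let_def
    proof (rule exI[of _ "min e (r / 4)"], intro conjI allI impI ballI)
      show "min e (r / 4) > 0" using e r by simp
      fix \<C> \<epsilon> X\<^sub>0
      assume \<C>: "\<C> \<subseteq> l2_pairs \<and> I_const \<alpha> \<C> = \<iota>" and "\<epsilon> \<in> {0<..min e (r / 4)}" and X0: "X\<^sub>0 \<in> \<C>" and "norm_q 2 X\<^sub>0 = \<epsilon>"
      then have \<epsilon>: "\<epsilon> > 0" "\<epsilon> \<le> e" "4 * \<epsilon> \<le> r" by auto
      define Z0 where "Z0 = of_pair X\<^sub>0"
      have tZ0: "to_pair Z0 = X\<^sub>0" using X0 \<C> by (auto simp: Z0_def intro: to_pair_of_pair)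
      then have nZ0: "norm Z0 = \<epsilon>" using \<open>norm_q 2 X\<^sub>0 = \<epsilon>\<close> norm_q_2_to_pair[of Z0] by simp
      define T where "T = \<mu> * 1 * \<bar>ln \<epsilon>\<bar> * \<epsilon> powr (1 - \<alpha>)"
      have "sqrt q' \<le> 2" using q' by (intro real_le_lsqrt) auto
      then have "sqrt q' * \<epsilon> \<le> 2 * \<epsilon>" using \<epsilon> by (intro mult_right_mono) auto
      then have "2 * (sqrt q' * norm Z0) \<le> r" using \<epsilon> unfolding nZ0 by linarith
      then obtain Z where Z: "Z 0 = Z0"
        "\<And>t. t \<ge> 0 \<Longrightarrow> (Z has_vector_derivative lattice_field (deriv V) (deriv \<phi>) (Z t)) (at t within {0..})"
        and nZ: "\<And>t. t \<ge> 0 \<Longrightarrow> norm (Z t) \<le> sqrt q' * \<epsilon>"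
        using lattice_flow_exists[OF lV V0(1) l\<phi> \<open>deriv \<phi> 0 = 0\<close> K(2,3), of Z0] nZ0 q' by auto
      have ZT: "(Z has_vector_derivative lattice_field (deriv V) (deriv \<phi>) (Z t)) (at t within {0..T})" if "t \<in> {0..T}" for t
        by (rule has_vector_derivative_within_subset[OF Z(2)]) (use that in auto)
      note sol = lattice_solution_iff[OF locV V0(1) loc\<phi> \<open>deriv \<phi> 0 = 0\<close>]
      have "X\<^sub>0 \<noteq> 0"
      proof
        assume "X\<^sub>0 = 0"
        also have "0 = to_pair 0" by (simp add: to_pair_def zero_prod_def zero_fun_def)
        finally have "Z0 = 0" using tZ0 to_pair_inject by blast
        with nZ0 \<epsilon> show False by simp
      qed
      then have "\<iota> \<le> Q_quot (p + 1) (to_pair Z0)"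
        using I_const_le_Q_quot[OF X0, of \<alpha>] \<C> by (simp add: tZ0 \<alpha>)
      then have N0: "(\<iota> * \<epsilon>) powr (p + 2) \<le> pow_sum p (bdiff (Z 0))"
        using pow_sum_ge_quotient[OF p, of \<iota> Z0] \<iota> \<epsilon> by (simp add: Z(1) nZ0)
      have lower: "1 / 2 * (1 / 2 * \<iota>) powr ((p + 2) / p) * \<epsilon> \<le> norm_inf (to_pair (Z t))" if t: "t \<in> {0..T}" for t
      proof (rule norm_inf_lower_bound[OF p \<iota> \<epsilon>(1) q_def])
        have "(norm (Z t))\<^sup>2 \<le> (sqrt q' * \<epsilon>)\<^sup>2" using nZ t by (intro power_mono) auto
        also have "\<dots> \<le> q * \<epsilon>\<^sup>2" using q' by (simp add: power_mult_distrib mult_right_mono)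
        finally show "(norm (Z t))\<^sup>2 \<le> q * \<epsilon>\<^sup>2" .
        have "\<bar>pow_sum p (bdiff (Z t)) - pow_sum p (bdiff (Z 0))\<bar>
            \<le> A * ((4 * \<epsilon>) powr p * (4 * \<epsilon>))\<^sup>2 * (1 + t * (4 * \<epsilon>) powr \<eta>)"
          unfolding A_def
          \<comment> \<open>The solution is bounded by \<open>2 * \<epsilon>\<close>, and taking differences doubles this.\<close>
        proof (rule pow_sum_almost_conserved[OF C \<eta>(1,2), where h = "deriv V" and g = "deriv \<phi>" and Z = Z])
          show "2 * norm (Z s) \<le> 4 * \<epsilon>" if "s \<ge> 0" for s
            using nZ[OF that] \<open>sqrt q' * \<epsilon> \<le> 2 * \<epsilon>\<close> by linarith
          show "K-lipschitz_on {- (4 * \<epsilon>)..4 * \<epsilon>} (deriv V)"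
            by (rule lipschitz_on_subset[OF lV]) (use \<epsilon> in auto)
        qed (use \<epsilon> r bV b\<phi> V0 Z(2) t in auto)
        also have "\<dots> \<le> A * ((4 * \<epsilon>) powr p * (4 * \<epsilon>))\<^sup>2 * (1 + T * (4 * \<epsilon>) powr \<eta>)"
          using A t by (intro mult_left_mono add_left_mono mult_right_mono) auto
        also have "\<dots> = A * (4 powr p * 4)\<^sup>2 * (\<epsilon> powr p + \<mu> * 4 powr \<eta> * (\<bar>ln \<epsilon>\<bar> * \<epsilon> powr \<eta>)) * \<epsilon> powr (p + 2)"
        proof -
          have "\<epsilon> powr (1 - \<alpha>) * \<epsilon> powr p = 1" using \<epsilon> by (simp add: p_def flip: powr_add)
          then have "T * \<epsilon> powr p = \<mu> * \<bar>ln \<epsilon>\<bar>" by (simp add: T_def mult.assoc)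
          then have time: "(1 + T * (4 * \<epsilon>) powr \<eta>) * \<epsilon> powr p = \<epsilon> powr p + \<mu> * 4 powr \<eta> * (\<bar>ln \<epsilon>\<bar> * \<epsilon> powr \<eta>)"
            using \<epsilon> by (simp add: powr_mult algebra_simps)
          have scale: "((4 * \<epsilon>) powr p * (4 * \<epsilon>))\<^sup>2 = (4 powr p * 4)\<^sup>2 * (\<epsilon> powr p * \<epsilon> powr (p + 2))"
            using \<epsilon> by (simp add: powr_mult powr_add power2_eq_square mult_ac)
          show ?thesis unfolding scale time[symmetric] by (simp only: mult_ac)
        qed
        also have "\<dots> \<le> ((1 - 1 / q) * \<iota> powr (p + 2)) * \<epsilon> powr (p + 2)"
          by (intro mult_right_mono e(2) \<epsilon>) auto
        also have "\<dots> = (1 - 1 / q) * (\<iota> * \<epsilon>) powr (p + 2)" using \<iota> \<epsilon> by (simp add: powr_mult)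
        finally show "(\<iota> * \<epsilon>) powr (p + 2) / q \<le> pow_sum p (bdiff (Z t))"
          using N0 by (simp add: left_diff_distrib abs_le_iff)
      qed
      have solution: "lattice_solution V \<phi> (\<lambda>t. to_pair (Z t)) {0..T}"
        using ZT by (subst sol[of _ _ Z]) auto
      have unique: "Y t = to_pair (Z t)"
        if Y: "lattice_solution V \<phi> Y {0..T} \<and> Y 0 = X\<^sub>0" and t: "t \<in> {0..T}" for Y t
      proof -
        have YZ: "Y s = to_pair (of_pair (Y s))" if "s \<in> {0..T}" for s
          using Y that by (auto simp: lattice_solution_def to_pair_of_pair)
        have "of_pair (Y t) = Z t"
        proof (rule lattice_flow_unique[OF locV V0(1) loc\<phi> \<open>deriv \<phi> 0 = 0\<close> _ ZT _ t])
          show "((\<lambda>s. of_pair (Y s)) has_vector_derivative lattice_field (deriv V) (deriv \<phi>) (of_pair (Y s))) (at s within {0..T})"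
            if "s \<in> {0..T}" for s
            using sol[of "{0..T}" Y "\<lambda>s. of_pair (Y s)", OF YZ] Y that by blast
          show "of_pair (Y 0) = Z 0" using Y Z(1) by (simp add: Z0_def)
        qed
        then show ?thesis using YZ[OF t] by simp
      qed
      have exponent: "(\<alpha> + 1) / (\<alpha> - 1) = (p + 2) / p" by (simp add: \<alpha>)
      have initial: "to_pair (Z 0) = X\<^sub>0" using Z(1) tZ0 by simp
      show "\<exists>X. lattice_solution V \<phi> X {0..\<mu> * 1 * \<bar>ln \<epsilon>\<bar> * \<epsilon> powr (1 - \<alpha>)} \<and> X 0 = X\<^sub>0 \<and>
          (\<forall>Y. lattice_solution V \<phi> Y {0..\<mu> * 1 * \<bar>ln \<epsilon>\<bar> * \<epsilon> powr (1 - \<alpha>)} \<and> Y 0 = X\<^sub>0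
             \<longrightarrow> (\<forall>t\<in>{0..\<mu> * 1 * \<bar>ln \<epsilon>\<bar> * \<epsilon> powr (1 - \<alpha>)}. Y t = X t)) \<and>
          (\<forall>t\<in>{0..\<mu> * 1 * \<bar>ln \<epsilon>\<bar> * \<epsilon> powr (1 - \<alpha>)}. norm_inf (X t) \<ge> 1 / 2 * (1 / 2 * I_const \<alpha> \<C>) powr ((\<alpha> + 1) / (\<alpha> - 1)) * \<epsilon>)"
        unfolding T_def[symmetric] exponent conjunct2[OF \<C>]
        by (rule exI[of _ "\<lambda>t. to_pair (Z t)"], intro conjI allI impI ballI)
           (rule solution initial unique lower; assumption)+
    qed
  qed simp
qed

end
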